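(* Let $A$ be a smooth algebra, let $\lambda\in A$, and let $\varrho:A\to\mathrm{End}(V)$ be a representation of $A$ on a (not necessarily finite-dimensional) vector space $V$. Then $\varrho$ can be extended to a representation of $\Pi^\lambda(A)$ if and only if the homology class of $\varrho(\lambda)$ in $H_0(A,\mathrm{End}\,V)$ is zero, i.e. $\varrho(\lambda)\in[\varrho(A),\mathrm{End}(V)]$. If it exists, an extension of $\varrho$ to $\Pi^\lambda(A)$ is unique if and only if $H_1(A,\mathrm{End}\,V)=0$.
   Context: All algebras are associative and unital over $\mathbb C$; $\otimes=\otimes_{\mathbb C}$. An algebra $A$ is called smooth if it is finitely generated and quasi-free; this implies that $\Omega^1A$, the kernel of the multiplication map $A\otimes A\to A$, is a finitely generated projective $A$-bimodule. $A\otimes A$ carries the outer bimodule structure $a.(x\otimes y).b=ax\otimes yb$ and the inner one $a.(x\otimes y).b=xb\otimes ay$. $\mathbb{D}\mathrm{er}(A)$ is the space of $\mathbb C$-linear derivations $A\to A\otimes A$ for the outer structure, an $A$-bimodule via the inner structure. $\Delta_A\in\mathbb{D}\mathrm{er}(A)$ is $\Delta_A(x)=x\otimes1-1\otimes x$, and $\Pi^\lambda(A)=T_A\mathbb{D}\mathrm{er}(A)/\langle\Delta_A-\lambda\rangle$, with its canonical homomorphism $A\to\Pi^\lambda(A)$. $H_\bullet(A,-)$ is Hochschild homology with coefficients in a bimodule; $\mathrm{End}(V)$ is an $A$-bimodule via $\varrho$; $[\varrho(A),\mathrm{End}(V)]$ is the linear span of commutators. *)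

theory Defs
  imports Complex_Main "HOL-Algebra.QuotRing" "HOL-Algebra.Subrings"
begin

section \<open>Complex vector spaces and associative unital complex algebras\<close>

definition complex_field :: "complex ring" where
  "complex_field = \<lparr>carrier = UNIV, mult = (*), one = 1, zero = 0, add = (+)\<rparr>"

text \<open>Vector spaces and algebras are both records of type \<open>(complex, _) module\<close>; for a mere
  vector space, \<^term>\<open>module complex_field V\<close>, the multiplicative fields are ignored. The zero
  algebra is allowed.\<close>

locale calgebra = module complex_field A + ring A for A (structure) +
  assumes smult_mult_left: "x \<in> carrier A \<Longrightarrow> y \<in> carrier A \<Longrightarrow>
      (c \<odot>\<^bsub>A\<^esub> x) \<otimes>\<^bsub>A\<^esub> y = c \<odot>\<^bsub>A\<^esub> (x \<otimes>\<^bsub>A\<^esub> y)"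
    and smult_mult_right: "x \<in> carrier A \<Longrightarrow> y \<in> carrier A \<Longrightarrow>
      x \<otimes>\<^bsub>A\<^esub> (c \<odot>\<^bsub>A\<^esub> y) = c \<odot>\<^bsub>A\<^esub> (x \<otimes>\<^bsub>A\<^esub> y)"

definition calg_hom ::
    "(complex, 'a, 'x) module_scheme \<Rightarrow> (complex, 'b, 'y) module_scheme \<Rightarrow> ('a \<Rightarrow> 'b) set" where
  "calg_hom A B = {h \<in> ring_hom A B. \<forall>c. \<forall>x \<in> carrier A. h (c \<odot>\<^bsub>A\<^esub> x) = c \<odot>\<^bsub>B\<^esub> h x}"

definition lin_span :: "(complex, 'a, 'x) module_scheme \<Rightarrow> 'a set \<Rightarrow> 'a set" where
  "lin_span M S = \<Inter>{H. submodule H complex_field M \<and> S \<subseteq> H}"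

definition calg_generated :: "(complex, 'a, 'x) module_scheme \<Rightarrow> 'a set \<Rightarrow> 'a set" where
  "calg_generated A S = \<Inter>{B. subring B A \<and> submodule B complex_field A \<and> S \<subseteq> B}"

text \<open>Quotient of an algebra by a two-sided ideal, and equally of a vector space by a subspace (where
  only the additive and scalar structure is used).\<close>

definition cquot :: "(complex, 'a, 'x) module_scheme \<Rightarrow> 'a set \<Rightarrow> (complex, 'a set) module"
    (infixl \<open>QuotC\<close> 65) where
  "M QuotC N =
    \<lparr>carrier = a_rcosets\<^bsub>M\<^esub> N, mult = rcoset_mult M N, one = N +>\<^bsub>M\<^esub> \<one>\<^bsub>M\<^esub>, zero = N,
     add = set_add M, smult = (\<lambda>c X. \<Union>x\<in>X. N +>\<^bsub>M\<^esub> (c \<odot>\<^bsub>M\<^esub> x))\<rparr>"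

definition End_alg :: "(complex, 'v, 'x) module_scheme \<Rightarrow> (complex, 'v \<Rightarrow> 'v) module" where
  "End_alg V =
    \<lparr>carrier = {f \<in> carrier V \<rightarrow>\<^sub>E carrier V.
        (\<forall>x \<in> carrier V. \<forall>y \<in> carrier V. f (x \<oplus>\<^bsub>V\<^esub> y) = f x \<oplus>\<^bsub>V\<^esub> f y) \<and>
        (\<forall>c. \<forall>x \<in> carrier V. f (c \<odot>\<^bsub>V\<^esub> x) = c \<odot>\<^bsub>V\<^esub> f x)},
     mult = (\<lambda>f g. \<lambda>x\<in>carrier V. f (g x)),
     one = (\<lambda>x\<in>carrier V. x),
     zero = (\<lambda>x\<in>carrier V. \<zero>\<^bsub>V\<^esub>),
     add = (\<lambda>f g. \<lambda>x\<in>carrier V. f x \<oplus>\<^bsub>V\<^esub> g x),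
     smult = (\<lambda>c f. \<lambda>x\<in>carrier V. c \<odot>\<^bsub>V\<^esub> f x)\<rparr>"


section \<open>Smooth algebras\<close>

definition finitely_generated_calg :: "(complex, 'a, 'x) module_scheme \<Rightarrow> bool" where
  "finitely_generated_calg A \<longleftrightarrow>
     (\<exists>S. finite S \<and> S \<subseteq> carrier A \<and> calg_generated A S = carrier A)"

definition nilpotent_ideal :: "'r set \<Rightarrow> ('r, 'x) ring_scheme \<Rightarrow> bool" where
  "nilpotent_ideal I R \<longleftrightarrow> ideal I R \<and>
     (\<exists>n. \<forall>xs. set xs \<subseteq> I \<and> length xs = n \<longrightarrow> foldr (\<otimes>\<^bsub>R\<^esub>) xs \<one>\<^bsub>R\<^esub> = \<zero>\<^bsub>R\<^esub>)"

definition nilpotent_lifting :: "'r itself \<Rightarrow> (complex, 'a, 'x) module_scheme \<Rightarrow> bool" where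
  "nilpotent_lifting (TYPE('r)) A \<longleftrightarrow>
     (\<forall>(R :: (complex, 'r) module) I. calgebra R \<and> nilpotent_ideal I R \<longrightarrow>
        (\<forall>\<phi> \<in> calg_hom A (R QuotC I). \<exists>\<psi> \<in> calg_hom A R. \<forall>a \<in> carrier A. I +>\<^bsub>R\<^esub> \<psi> a = \<phi> a))"

text \<open>Cuntz--Quillen: an algebra is quasi-free if homomorphisms out of it lift through every
  nilpotent extension. HOL cannot quantify over all carrier types of \<open>R\<close>, but
  \<^typ>\<open>'a list \<Rightarrow> complex\<close> suffices: given \<open>R\<close>, \<open>I\<close> and
  \<open>\<phi>\<close> over any type, choose a representative in \<open>R\<close> of
  \<open>\<phi> a\<close> for every \<open>a\<close>; these generate a subalgebra \<open>R'\<close> of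
  \<open>R\<close>, it is enough to lift through \<open>R' \<rightarrow> R'/(I \<inter> R')\<close>, and \<open>R'\<close>
  is a quotient of the free algebra on the set \<open>A\<close>, whose elements are finitely supported
  functions on words.\<close>

definition quasi_free :: "(complex, 'a, 'x) module_scheme \<Rightarrow> bool" where
  "quasi_free A \<longleftrightarrow> nilpotent_lifting (TYPE('a list \<Rightarrow> complex)) A"

definition smooth_calg :: "(complex, 'a, 'x) module_scheme \<Rightarrow> bool" where
  "smooth_calg A \<longleftrightarrow> calgebra A \<and> finitely_generated_calg A \<and> quasi_free A"


section \<open>Tensor products over the complex numbers\<close>

definition delta :: "'w \<Rightarrow> 'w \<Rightarrow> complex" where
  "delta w = (\<lambda>u. if u = w then 1 else 0)"

definition free_space :: "'w set \<Rightarrow> (complex, 'w \<Rightarrow> complex) module" where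
  "free_space W =
    \<lparr>carrier = {f. finite {w. f w \<noteq> 0} \<and> {w. f w \<noteq> 0} \<subseteq> W}, mult = undefined, one = undefined,
     zero = (\<lambda>w. 0), add = (\<lambda>f g w. f w + g w), smult = (\<lambda>c f w. c * f w)\<rparr>"

text \<open>\<open>mtensor P Q n\<close> is \<open>P \<otimes> Q \<otimes> \<dots> \<otimes> Q\<close> with \<open>n\<close> factors
  \<open>Q\<close>: the free vector space on the words \<open>(p, [q\<^sub>1, \<dots>, q\<^sub>n])\<close> modulo
  multilinearity. In particular \<open>mtensor A A 1\<close> is \<open>A \<otimes> A\<close>, with
  \<open>x \<otimes> y\<close> being \<open>tens A A x [y]\<close>.\<close>

definition words ::
    "(complex, 'p, 'x) module_scheme \<Rightarrow> (complex, 'q, 'y) module_scheme \<Rightarrow> nat \<Rightarrow> ('p \<times> 'q list) set"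
    where
  "words P Q n = {(p, qs). p \<in> carrier P \<and> qs \<in> lists (carrier Q) \<and> length qs = n}"

definition multilinear_rels ::
    "(complex, 'p, 'x) module_scheme \<Rightarrow> (complex, 'q, 'y) module_scheme \<Rightarrow> nat \<Rightarrow>
      ('p \<times> 'q list \<Rightarrow> complex) set" where
  "multilinear_rels P Q n =
     {delta (p \<oplus>\<^bsub>P\<^esub> p', qs) - delta (p, qs) - delta (p', qs) | p p' qs.
        (p, qs) \<in> words P Q n \<and> p' \<in> carrier P} \<union>
     {delta (c \<odot>\<^bsub>P\<^esub> p, qs) - (\<lambda>w. c * delta (p, qs) w) | c p qs. (p, qs) \<in> words P Q n} \<union>
     {delta (p, us @ (q \<oplus>\<^bsub>Q\<^esub> q') # vs) - delta (p, us @ q # vs) - delta (p, us @ q' # vs)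
        | p us q q' vs. (p, us @ q # vs) \<in> words P Q n \<and> q' \<in> carrier Q} \<union>
     {delta (p, us @ (c \<odot>\<^bsub>Q\<^esub> q) # vs) - (\<lambda>w. c * delta (p, us @ q # vs) w)
        | c p us q vs. (p, us @ q # vs) \<in> words P Q n}"

definition mtensor ::
    "(complex, 'p, 'x) module_scheme \<Rightarrow> (complex, 'q, 'y) module_scheme \<Rightarrow> nat \<Rightarrow>
      (complex, ('p \<times> 'q list \<Rightarrow> complex) set) module" where
  "mtensor P Q n =
     free_space (words P Q n) QuotC lin_span (free_space (words P Q n)) (multilinear_rels P Q n)"

definition tens ::
    "(complex, 'p, 'x) module_scheme \<Rightarrow> (complex, 'q, 'y) module_scheme \<Rightarrow> 'p \<Rightarrow> 'q list \<Rightarrow>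
      ('p \<times> 'q list \<Rightarrow> complex) set" where
  "tens P Q p qs =
     lin_span (free_space (words P Q (length qs))) (multilinear_rels P Q (length qs))
       +>\<^bsub>free_space (words P Q (length qs))\<^esub> delta (p, qs)"

text \<open>\<open>lin_ext M g\<close> extends a function \<open>g\<close> on basis words linearly to the free
  vector space, and \<open>quot_lift M g\<close> is the map induced on cosets, on each of which
  \<open>lin_ext M g\<close> is constant in all uses below.\<close>

definition lin_ext :: "(complex, 'm, 'x) module_scheme \<Rightarrow> ('w \<Rightarrow> 'm) \<Rightarrow> ('w \<Rightarrow> complex) \<Rightarrow> 'm" where
  "lin_ext M g v = (\<Oplus>\<^bsub>M\<^esub>w \<in> {w. v w \<noteq> 0}. v w \<odot>\<^bsub>M\<^esub> g w)"

definition quot_lift ::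
    "(complex, 'm, 'x) module_scheme \<Rightarrow> ('w \<Rightarrow> 'm) \<Rightarrow> ('w \<Rightarrow> complex) set \<Rightarrow> 'm" where
  "quot_lift M g X = the_elem (lin_ext M g ` X)"


section \<open>Bimodules and double derivations\<close>

record ('a, 'm) bimodule = "(complex, 'm) module" +
  lact :: "'a \<Rightarrow> 'm \<Rightarrow> 'm"
  ract :: "'m \<Rightarrow> 'a \<Rightarrow> 'm"

definition with_actions ::
    "(complex, 'm) module \<Rightarrow> ('a \<Rightarrow> 'm \<Rightarrow> 'm) \<Rightarrow> ('m \<Rightarrow> 'a \<Rightarrow> 'm) \<Rightarrow> ('a, 'm) bimodule" where
  "with_actions M l r = module.extend M (bimodule.fields l r)"

definition outer_bimodule ::
    "(complex, 'a) module \<Rightarrow> ('a, ('a \<times> 'a list \<Rightarrow> complex) set) bimodule" where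
  "outer_bimodule A = with_actions (mtensor A A 1)
     (\<lambda>a. quot_lift (mtensor A A 1) (\<lambda>(x, ys). tens A A (a \<otimes>\<^bsub>A\<^esub> x) [hd ys]))
     (\<lambda>X b. quot_lift (mtensor A A 1) (\<lambda>(x, ys). tens A A x [hd ys \<otimes>\<^bsub>A\<^esub> b]) X)"

definition inner_bimodule ::
    "(complex, 'a) module \<Rightarrow> ('a, ('a \<times> 'a list \<Rightarrow> complex) set) bimodule" where
  "inner_bimodule A = with_actions (mtensor A A 1)
     (\<lambda>a. quot_lift (mtensor A A 1) (\<lambda>(x, ys). tens A A x [a \<otimes>\<^bsub>A\<^esub> hd ys]))
     (\<lambda>X b. quot_lift (mtensor A A 1) (\<lambda>(x, ys). tens A A (x \<otimes>\<^bsub>A\<^esub> b) [hd ys]) X)"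

definition derivations :: "(complex, 'a) module \<Rightarrow> ('a, 'm) bimodule \<Rightarrow> ('a \<Rightarrow> 'm) set" where
  "derivations A M = {d \<in> carrier A \<rightarrow>\<^sub>E carrier M.
     (\<forall>x \<in> carrier A. \<forall>y \<in> carrier A. d (x \<oplus>\<^bsub>A\<^esub> y) = d x \<oplus>\<^bsub>M\<^esub> d y) \<and>
     (\<forall>c. \<forall>x \<in> carrier A. d (c \<odot>\<^bsub>A\<^esub> x) = c \<odot>\<^bsub>M\<^esub> d x) \<and>
     (\<forall>x \<in> carrier A. \<forall>y \<in> carrier A. d (x \<otimes>\<^bsub>A\<^esub> y) = lact M x (d y) \<oplus>\<^bsub>M\<^esub> ract M (d x) y)}"

definition double_der ::
    "(complex, 'a) module \<Rightarrow> ('a, 'a \<Rightarrow> ('a \<times> 'a list \<Rightarrow> complex) set) bimodule" where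
  "double_der A = with_actions
     \<lparr>carrier = derivations A (outer_bimodule A), mult = undefined, one = undefined,
      zero = (\<lambda>x\<in>carrier A. \<zero>\<^bsub>mtensor A A 1\<^esub>),
      add = (\<lambda>d e. \<lambda>x\<in>carrier A. d x \<oplus>\<^bsub>mtensor A A 1\<^esub> e x),
      smult = (\<lambda>c d. \<lambda>x\<in>carrier A. c \<odot>\<^bsub>mtensor A A 1\<^esub> d x)\<rparr>
     (\<lambda>a d. \<lambda>x\<in>carrier A. lact (inner_bimodule A) a (d x))
     (\<lambda>d b. \<lambda>x\<in>carrier A. ract (inner_bimodule A) (d x) b)"

definition Delta :: "(complex, 'a) module \<Rightarrow> 'a \<Rightarrow> ('a \<times> 'a list \<Rightarrow> complex) set" where
  "Delta A = (\<lambda>x\<in>carrier A. tens A A x [\<one>\<^bsub>A\<^esub>] \<ominus>\<^bsub>mtensor A A 1\<^esub> tens A A \<one>\<^bsub>A\<^esub> [x])"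


section \<open>Tensor algebra of a bimodule\<close>

text \<open>The degree \<open>n\<close> part of the tensor algebra of an \<open>A\<close>-bimodule \<open>M\<close>
  is taken as \<open>A \<otimes>\<^sub>A M \<otimes>\<^sub>A \<dots> \<otimes>\<^sub>A M\<close> (with \<open>n\<close> factors \<open>M\<close>), which is
  \<open>A\<close> for \<open>n = 0\<close>. All degrees together form the free vector space on the words
  \<open>(a, [m\<^sub>1, \<dots>, m\<^sub>n])\<close>, standing for \<open>a \<otimes> m\<^sub>1 \<otimes> \<dots> \<otimes> m\<^sub>n\<close>, modulo the
  (degree-preserving) multilinearity and \<open>A\<close>-balancing relations. The product of
  \<open>a \<otimes> m\<^sub>1 \<otimes> \<dots> \<otimes> m\<^sub>k\<close> and \<open>b \<otimes> n\<^sub>1 \<otimes> \<dots> \<otimes> n\<^sub>l\<close> is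
  \<open>a \<otimes> m\<^sub>1 \<otimes> \<dots> \<otimes> m\<^sub>k b \<otimes> n\<^sub>1 \<otimes> \<dots> \<otimes> n\<^sub>l\<close>.\<close>

definition word_monoid ::
    "(complex, 'a) module \<Rightarrow> ('a, 'm) bimodule \<Rightarrow> ('a \<times> 'm list) monoid" where
  "word_monoid A M =
    \<lparr>carrier = carrier A \<times> lists (carrier M),
     mult = (\<lambda>(a, ms) (b, ns). if ms = [] then (a \<otimes>\<^bsub>A\<^esub> b, ns)
                               else (a, butlast ms @ ract M (last ms) b # ns)),
     one = (\<one>\<^bsub>A\<^esub>, [])\<rparr>"

definition monoid_calg :: "'w monoid \<Rightarrow> (complex, 'w \<Rightarrow> complex) module" where
  "monoid_calg W = (free_space (carrier W))
    \<lparr>mult := (\<lambda>f g w. \<Sum>u | f u \<noteq> 0. \<Sum>v | g v \<noteq> 0. if u \<otimes>\<^bsub>W\<^esub> v = w then f u * g v else 0),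
     one := delta \<one>\<^bsub>W\<^esub>\<rparr>"

definition balancing_rels ::
    "(complex, 'a) module \<Rightarrow> ('a, 'm) bimodule \<Rightarrow> ('a \<times> 'm list \<Rightarrow> complex) set" where
  "balancing_rels A M =
     {delta (a \<otimes>\<^bsub>A\<^esub> b, m # ms) - delta (a, lact M b m # ms) | a b m ms.
        a \<in> carrier A \<and> b \<in> carrier A \<and> m \<in> carrier M \<and> ms \<in> lists (carrier M)} \<union>
     {delta (a, us @ ract M m b # m' # vs) - delta (a, us @ m # lact M b m' # vs)
        | a b us m m' vs. a \<in> carrier A \<and> b \<in> carrier A \<and> m \<in> carrier M \<and> m' \<in> carrier M \<and>
            us \<in> lists (carrier M) \<and> vs \<in> lists (carrier M)}"

definition tensor_alg_rels ::
    "(complex, 'a) module \<Rightarrow> ('a, 'm) bimodule \<Rightarrow> ('a \<times> 'm list \<Rightarrow> complex) set" where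
  "tensor_alg_rels A M = lin_span (monoid_calg (word_monoid A M))
     ((\<Union>n. multilinear_rels A M n) \<union> balancing_rels A M)"

definition tensor_alg ::
    "(complex, 'a) module \<Rightarrow> ('a, 'm) bimodule \<Rightarrow> (complex, ('a \<times> 'm list \<Rightarrow> complex) set) module"
    where
  "tensor_alg A M = monoid_calg (word_monoid A M) QuotC tensor_alg_rels A M"

definition tensor_alg_elem ::
    "(complex, 'a) module \<Rightarrow> ('a, 'm) bimodule \<Rightarrow> 'a \<Rightarrow> 'm list \<Rightarrow> ('a \<times> 'm list \<Rightarrow> complex) set"
    where
  "tensor_alg_elem A M a ms =
     tensor_alg_rels A M +>\<^bsub>monoid_calg (word_monoid A M)\<^esub> delta (a, ms)"


section \<open>Deformed preprojective algebras\<close>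

type_synonym 'a dder_tensors = "('a \<times> ('a \<Rightarrow> ('a \<times> 'a list \<Rightarrow> complex) set) list \<Rightarrow> complex) set"

definition preproj_ideal :: "(complex, 'a) module \<Rightarrow> 'a \<Rightarrow> 'a dder_tensors set" where
  "preproj_ideal A lam = genideal (tensor_alg A (double_der A))
     {tensor_alg_elem A (double_der A) \<one>\<^bsub>A\<^esub> [Delta A]
        \<ominus>\<^bsub>tensor_alg A (double_der A)\<^esub> tensor_alg_elem A (double_der A) lam []}"

definition preproj_alg :: "(complex, 'a) module \<Rightarrow> 'a \<Rightarrow> (complex, 'a dder_tensors set) module" where
  "preproj_alg A lam = tensor_alg A (double_der A) QuotC preproj_ideal A lam"

definition preproj_map :: "(complex, 'a) module \<Rightarrow> 'a \<Rightarrow> 'a \<Rightarrow> 'a dder_tensors set" where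
  "preproj_map A lam a =
     preproj_ideal A lam +>\<^bsub>tensor_alg A (double_der A)\<^esub> tensor_alg_elem A (double_der A) a []"

definition is_preproj_extension ::
    "(complex, 'a) module \<Rightarrow> 'a \<Rightarrow> (complex, 'v) module \<Rightarrow> ('a \<Rightarrow> 'v \<Rightarrow> 'v) \<Rightarrow>
      ('a dder_tensors set \<Rightarrow> 'v \<Rightarrow> 'v) \<Rightarrow> bool" where
  "is_preproj_extension A lam V rho sigma \<longleftrightarrow>
     sigma \<in> calg_hom (preproj_alg A lam) (End_alg V) \<and>
     (\<forall>a \<in> carrier A. sigma (preproj_map A lam a) = rho a)"


section \<open>Hochschild homology\<close>

text \<open>The chains are \<open>C\<^sub>n = M \<otimes> A \<otimes> \<dots> \<otimes> A\<close> with \<open>n\<close> factors \<open>A\<close>; the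
  faces of \<open>m \<otimes> a\<^sub>1 \<otimes> \<dots> \<otimes> a\<^sub>n\<close> are
  \<open>m a\<^sub>1 \<otimes> a\<^sub>2 \<otimes> \<dots> \<otimes> a\<^sub>n\<close>, then
  \<open>m \<otimes> \<dots> \<otimes> a\<^sub>i a\<^sub>i\<^sub>+\<^sub>1 \<otimes> \<dots> \<otimes> a\<^sub>n\<close> for \<open>0 < i < n\<close>, and
  \<open>a\<^sub>n m \<otimes> a\<^sub>1 \<otimes> \<dots> \<otimes> a\<^sub>n\<^sub>-\<^sub>1\<close>.\<close>

definition hoch_face ::
    "(complex, 'a) module \<Rightarrow> ('a, 'm) bimodule \<Rightarrow> nat \<Rightarrow> 'm \<times> 'a list \<Rightarrow> 'm \<times> 'a list" where
  "hoch_face A M i = (\<lambda>(m, as).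
     if i = 0 then (ract M m (hd as), tl as)
     else if i < length as then
       (m, take (i - 1) as @ (as ! (i - 1) \<otimes>\<^bsub>A\<^esub> as ! i) # drop (i + 1) as)
     else (lact M (last as) m, butlast as))"

definition hoch_diff ::
    "(complex, 'a) module \<Rightarrow> ('a, 'm) bimodule \<Rightarrow> nat \<Rightarrow>
      ('m \<times> 'a list \<Rightarrow> complex) set \<Rightarrow> ('m \<times> 'a list \<Rightarrow> complex) set" where
  "hoch_diff A M n = (if n = 0 then (\<lambda>X. \<zero>\<^bsub>mtensor M A 0\<^esub>) else
     quot_lift (mtensor M A (n - 1))
       (\<lambda>w. \<Oplus>\<^bsub>mtensor M A (n - 1)\<^esub>i \<in> {0..n}.
              (- 1) ^ i \<odot>\<^bsub>mtensor M A (n - 1)\<^esub> case_prod (tens M A) (hoch_face A M i w)))"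

definition hoch_cycles ::
    "(complex, 'a) module \<Rightarrow> ('a, 'm) bimodule \<Rightarrow> nat \<Rightarrow> ('m \<times> 'a list \<Rightarrow> complex) set set" where
  "hoch_cycles A M n =
     {X \<in> carrier (mtensor M A n). hoch_diff A M n X = \<zero>\<^bsub>mtensor M A (n - 1)\<^esub>}"

definition hoch_boundaries ::
    "(complex, 'a) module \<Rightarrow> ('a, 'm) bimodule \<Rightarrow> nat \<Rightarrow> ('m \<times> 'a list \<Rightarrow> complex) set set" where
  "hoch_boundaries A M n = hoch_diff A M (n + 1) ` carrier (mtensor M A (n + 1))"

definition hoch_homology ::
    "(complex, 'a) module \<Rightarrow> ('a, 'm) bimodule \<Rightarrow> nat \<Rightarrow>
      (complex, ('m \<times> 'a list \<Rightarrow> complex) set set) module" where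
  "hoch_homology A M n =
     (mtensor M A n)\<lparr>carrier := hoch_cycles A M n\<rparr> QuotC hoch_boundaries A M n"

definition hoch_class0 ::
    "(complex, 'a) module \<Rightarrow> ('a, 'm) bimodule \<Rightarrow> 'm \<Rightarrow> ('m \<times> 'a list \<Rightarrow> complex) set set" where
  "hoch_class0 A M m = hoch_boundaries A M 0 +>\<^bsub>mtensor M A 0\<^esub> tens M A m []"

definition End_bimodule ::
    "(complex, 'v) module \<Rightarrow> ('a \<Rightarrow> 'v \<Rightarrow> 'v) \<Rightarrow> ('a, 'v \<Rightarrow> 'v) bimodule" where
  "End_bimodule V rho = with_actions (End_alg V)
     (\<lambda>a f. rho a \<otimes>\<^bsub>End_alg V\<^esub> f) (\<lambda>f a. f \<otimes>\<^bsub>End_alg V\<^esub> rho a)"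

definition commutator_space ::
    "(complex, 'a) module \<Rightarrow> (complex, 'v) module \<Rightarrow> ('a \<Rightarrow> 'v \<Rightarrow> 'v) \<Rightarrow> ('v \<Rightarrow> 'v) set" where
  "commutator_space A V rho = lin_span (End_alg V)
     {(rho a \<otimes>\<^bsub>End_alg V\<^esub> f) \<ominus>\<^bsub>End_alg V\<^esub> (f \<otimes>\<^bsub>End_alg V\<^esub> rho a) | a f.
        a \<in> carrier A \<and> f \<in> carrier (End_alg V)}"

end

theory Submission
  imports Defs
begin

text \<open>Throughout, \<open>D\<close> is the bimodule of double derivations, \<open>E = End V\<close> with its bimodule structure
coming from \<open>rho\<close>, and an element of \<open>A \<otimes> A\<close> is written \<open>T' \<otimes> T''\<close>. The proof describes
the extensions of \<open>rho\<close> in two steps.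

First, by the universal property of the tensor algebra, algebra homomorphisms \<open>T\<^sub>A D \<rightarrow> E\<close> restricting
to \<open>rho\<close> are the same as bimodule maps \<open>\<theta> : D \<rightarrow> E\<close>, and such a homomorphism kills
\<open>\<Delta> - lam\<close> exactly when \<open>\<theta> \<Delta> = rho lam\<close> (\<open>extension_bimod_hom\<close>,
\<open>bimod_hom_extension\<close>, \<open>extension_eqI\<close>).

Secondly, bimodule maps \<open>D \<rightarrow> E\<close> are Hochschild \<open>1\<close>-chains modulo boundaries. A chain
\<open>f \<otimes> a\<close> defines the map \<open>d \<mapsto> d(a)'' f d(a)'\<close>, which is a bimodule map because \<open>D\<close> carries the
inner structure; by the Leibniz rule boundaries define the zero map (\<open>pair_boundary\<close>), and the
value at \<open>\<Delta>\<close> is the Hochschild differential \<open>f a - a f\<close> (\<open>pair_Delta\<close>). Smoothness of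
\<open>A\<close> makes this correspondence bijective. It gives, for a finite generating set \<open>S\<close>, double
derivations \<open>\<delta>\<^sub>s\<close> with
  \<open>a \<otimes> 1 - 1 \<otimes> a = \<Sum>\<^sub>s \<delta>\<^sub>s(a)' (s \<otimes> 1 - 1 \<otimes> s) \<delta>\<^sub>s(a)''\<close>
(\<open>dual_basis\<close>), which is a coordinate form of the projectivity of \<open>\<Omega>\<^sup>1 A\<close>. Two linear maps on
\<open>A \<otimes> A\<close> are applied to this identity. The map \<open>x \<otimes> y \<mapsto> x d(y)\<close> turns it into
\<open>d = \<Sum>\<^sub>s d(s)'' \<delta>\<^sub>s d(s)'\<close>, so every \<open>\<theta>\<close> is the map defined by the chain
\<open>\<Sum>\<^sub>s \<theta>(\<delta>\<^sub>s) \<otimes> s\<close> (\<open>bimod_hom_is_pairing\<close>). The map sending \<open>x \<otimes> y\<close> to the class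
of \<open>f x \<otimes> y\<close> modulo boundaries shows that every chain is homologous to
\<open>\<Sum>\<^sub>s \<theta>(\<delta>\<^sub>s) \<otimes> s\<close>, where \<open>\<theta>\<close> is the map it defines, so a chain that defines
the zero map is a boundary (\<open>pairing_kernel\<close>).

Hence extensions of \<open>rho\<close> correspond to chains \<open>X\<close>, modulo boundaries, whose differential is
\<open>rho lam\<close>. They exist if and only if \<open>rho lam\<close> is a sum of commutators, and two of them differ by a
class in \<open>H\<^sub>1\<close>.

The derivations \<open>\<delta>\<^sub>s\<close> come from the lifting property. The bimodule map
\<open>\<mu> : (A \<otimes> A)\<^sup>S \<rightarrow> A \<otimes> A\<close> given by \<open>T \<mapsto> \<Sum>\<^sub>s T\<^sub>s' (s \<otimes> 1 - 1 \<otimes> s) T\<^sub>s''\<close> has all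
values of \<open>\<Delta>\<close> in its image, since the \<open>a\<close> with \<open>\<Delta> a\<close> in the image form a subalgebra
containing \<open>S\<close>. So \<open>a \<mapsto> (a, \<Delta> a)\<close> is a homomorphism from \<open>A\<close> to the quotient of the
square-zero extension \<open>A \<oplus> (A \<otimes> A)\<^sup>S\<close> by \<open>ker \<mu>\<close>, and a lift of it is a derivation
\<open>\<delta>\<close> with \<open>\<mu> \<delta> = \<Delta>\<close>.\<close>

section \<open>Linear algebra over the complex numbers\<close>

lemma complex_field_simps [simp]:
  "carrier complex_field = UNIV" "x \<otimes>\<^bsub>complex_field\<^esub> y = x * y"
  "x \<oplus>\<^bsub>complex_field\<^esub> y = x + y" "\<one>\<^bsub>complex_field\<^esub> = 1" "\<zero>\<^bsub>complex_field\<^esub> = 0"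
  by (simp_all add: complex_field_def)

lemma cring_complex_field: "cring complex_field"
  by (rule cringI, rule abelian_groupI, auto intro!: comm_monoidI exI[of _ "- x" for x] 
      simp: algebra_simps)

text \<open>Complex vector spaces. The algebraic operations of \<^const>\<open>complex_field\<close> are replaced by those
of \<^typ>\<open>complex\<close>, so that scalar identities can be rewritten by ordinary arithmetic.\<close>

locale cspace =
  fixes M :: "(complex, 'm, 'x) module_scheme" (structure)
  assumes is_module: "module complex_field M"
begin

sublocale abelian_group M
  by (rule module.axioms(2)[OF is_module])

lemma scale_closed [simp, intro]: "x \<in> carrier M \<Longrightarrow> c \<odot> x \<in> carrier M"
  using module.smult_closed[OF is_module] by simp

lemma scale_add_left: "x \<in> carrier M \<Longrightarrow> (c + d) \<odot> x = c \<odot> x \<oplus> d \<odot> x"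
  using module.smult_l_distr[OF is_module, of c d x] by simp

lemma scale_add_right:
  "x \<in> carrier M \<Longrightarrow> y \<in> carrier M \<Longrightarrow> c \<odot> (x \<oplus> y) = c \<odot> x \<oplus> c \<odot> y"
  using module.smult_r_distr[OF is_module, of c x y] by simp

lemma scale_scale: "x \<in> carrier M \<Longrightarrow> c \<odot> (d \<odot> x) = (c * d) \<odot> x"
  using module.smult_assoc1[OF is_module, of c d x] by simp

lemma scale_one [simp]: "x \<in> carrier M \<Longrightarrow> 1 \<odot> x = x"
  using module.smult_one[OF is_module, of x] by simp

lemma scale_zero_left [simp]: "x \<in> carrier M \<Longrightarrow> 0 \<odot> x = \<zero>"
  using module.smult_l_null[OF is_module, of x] by simp

lemma scale_zero_right [simp]: "c \<odot> \<zero> = \<zero>"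
  using module.smult_r_null[OF is_module, of c] by simp

lemma scale_minus_one: "x \<in> carrier M \<Longrightarrow> (- 1) \<odot> x = \<ominus> x"
  using scale_add_left[of x "-1" 1] by (simp add: minus_equality)

lemma minus_eq_zero_iff: "x \<in> carrier M \<Longrightarrow> y \<in> carrier M \<Longrightarrow> x \<ominus> y = \<zero> \<longleftrightarrow> x = y"
  by (metis a_minus_def a_inv_closed add.inv_equality minus_minus r_neg)

lemma minus_self [simp]: "x \<in> carrier M \<Longrightarrow> x \<ominus> x = \<zero>"
  by (simp add: a_minus_def r_neg)

lemma eq_minus_iff:
  "\<lbrakk>x \<in> carrier M; y \<in> carrier M; z \<in> carrier M\<rbrakk> \<Longrightarrow> x = y \<ominus> z \<longleftrightarrow> x \<oplus> z = y"
  by (metis a_minus_def a_inv_closed add.inv_solve_right)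

lemma add_diff_cancel_left: "x \<in> carrier M \<Longrightarrow> y \<in> carrier M \<Longrightarrow> (x \<oplus> y) \<ominus> x = y"
  using eq_minus_iff[of y "x \<oplus> y" x] by (simp add: a_comm)

lemma subspaceI:
  assumes "H \<subseteq> carrier M" "\<zero> \<in> H" "\<And>a b. \<lbrakk>a \<in> H; b \<in> H\<rbrakk> \<Longrightarrow> a \<oplus> b \<in> H"
    and "\<And>c x. x \<in> H \<Longrightarrow> c \<odot> x \<in> H"
  shows "submodule H complex_field M"
  using assms scale_minus_one by (intro module.submoduleI[OF is_module]) (auto, metis subsetD)

lemma subspaceD:
  assumes "submodule H complex_field M"
  shows "H \<subseteq> carrier M" "\<zero> \<in> H" "\<And>a b. \<lbrakk>a \<in> H; b \<in> H\<rbrakk> \<Longrightarrow> a \<oplus> b \<in> H"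
    "\<And>c x. x \<in> H \<Longrightarrow> c \<odot> x \<in> H" "\<And>a. a \<in> H \<Longrightarrow> \<ominus> a \<in> H"
    "\<And>a b. \<lbrakk>a \<in> H; b \<in> H\<rbrakk> \<Longrightarrow> a \<ominus> b \<in> H"
proof -
  note * = module.submoduleE[OF is_module assms]
  show sub: "H \<subseteq> carrier M" and "\<And>a b. \<lbrakk>a \<in> H; b \<in> H\<rbrakk> \<Longrightarrow> a \<oplus> b \<in> H"
    "\<And>c x. x \<in> H \<Longrightarrow> c \<odot> x \<in> H" "\<And>a. a \<in> H \<Longrightarrow> \<ominus> a \<in> H"
    "\<And>a b. \<lbrakk>a \<in> H; b \<in> H\<rbrakk> \<Longrightarrow> a \<ominus> b \<in> H"
    using * by (auto simp: a_minus_def)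
  obtain h where "h \<in> H"
    using *(2) by blast
  with *(4)[of 0 h] sub show "\<zero> \<in> H"
    by auto
qed

lemma lin_span_subspace:
  assumes "S \<subseteq> carrier M"
  shows "submodule (lin_span M S) complex_field M"
proof (rule subspaceI)
  have "carrier M \<in> {H. submodule H complex_field M \<and> S \<subseteq> H}"
    using assms module.carrier_is_submodule[OF is_module] by simp
  then show "lin_span M S \<subseteq> carrier M"
    unfolding lin_span_def by blast
qed (auto simp: lin_span_def subspaceD)

lemma lin_span_superset: "S \<subseteq> lin_span M S"
  by (auto simp: lin_span_def)

lemma lin_span_least: "submodule H complex_field M \<Longrightarrow> S \<subseteq> H \<Longrightarrow> lin_span M S \<subseteq> H"
  by (auto simp: lin_span_def)

end

definition lin_map ::
    "(complex, 'm, 'x) module_scheme \<Rightarrow> (complex, 'n, 'y) module_scheme \<Rightarrow> ('m \<Rightarrow> 'n) \<Rightarrow> bool" where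
  "lin_map M N f \<longleftrightarrow> (\<forall>x\<in>carrier M. f x \<in> carrier N) \<and>
     (\<forall>x\<in>carrier M. \<forall>y\<in>carrier M. f (x \<oplus>\<^bsub>M\<^esub> y) = f x \<oplus>\<^bsub>N\<^esub> f y) \<and>
     (\<forall>c. \<forall>x\<in>carrier M. f (c \<odot>\<^bsub>M\<^esub> x) = c \<odot>\<^bsub>N\<^esub> f x)"

lemma lin_mapI:
  assumes "\<And>x. x \<in> carrier M \<Longrightarrow> f x \<in> carrier N"
    and "\<And>x y. x \<in> carrier M \<Longrightarrow> y \<in> carrier M \<Longrightarrow> f (x \<oplus>\<^bsub>M\<^esub> y) = f x \<oplus>\<^bsub>N\<^esub> f y"
    and "\<And>c x. x \<in> carrier M \<Longrightarrow> f (c \<odot>\<^bsub>M\<^esub> x) = c \<odot>\<^bsub>N\<^esub> f x"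
  shows "lin_map M N f"
  using assms by (simp add: lin_map_def)

lemma lin_mapD:
  assumes "lin_map M N f"
  shows "x \<in> carrier M \<Longrightarrow> f x \<in> carrier N"
    and "x \<in> carrier M \<Longrightarrow> y \<in> carrier M \<Longrightarrow> f (x \<oplus>\<^bsub>M\<^esub> y) = f x \<oplus>\<^bsub>N\<^esub> f y"
    and "x \<in> carrier M \<Longrightarrow> f (c \<odot>\<^bsub>M\<^esub> x) = c \<odot>\<^bsub>N\<^esub> f x"
  using assms by (simp_all add: lin_map_def)

lemma lin_map_comp:
  "lin_map M N f \<Longrightarrow> lin_map N P g \<Longrightarrow> lin_map M P (\<lambda>x. g (f x))"
  by (simp add: lin_map_def)

lemma lin_map_cong:
  assumes "lin_map M N f" "\<And>x. x \<in> carrier M \<Longrightarrow> f x = g x" "cspace M"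
  shows "lin_map M N g"
proof -
  interpret cspace M by fact
  show ?thesis
    using assms by (simp add: lin_map_def)
qed

lemma lin_map_id: "lin_map M M (\<lambda>x. x)"
  by (simp add: lin_map_def)

lemma cspaceI:
  fixes M (structure)
  assumes "\<And>x y. \<lbrakk>x \<in> carrier M; y \<in> carrier M\<rbrakk> \<Longrightarrow> x \<oplus> y \<in> carrier M"
    and "\<zero> \<in> carrier M"
    and "\<And>x y z. \<lbrakk>x \<in> carrier M; y \<in> carrier M; z \<in> carrier M\<rbrakk> \<Longrightarrow> (x \<oplus> y) \<oplus> z = x \<oplus> (y \<oplus> z)"
    and "\<And>x y. \<lbrakk>x \<in> carrier M; y \<in> carrier M\<rbrakk> \<Longrightarrow> x \<oplus> y = y \<oplus> x"
    and "\<And>x. x \<in> carrier M \<Longrightarrow> \<zero> \<oplus> x = x"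
    and "\<And>c x. x \<in> carrier M \<Longrightarrow> c \<odot> x \<in> carrier M"
    and "\<And>c d x. x \<in> carrier M \<Longrightarrow> (c + d) \<odot> x = c \<odot> x \<oplus> d \<odot> x"
    and "\<And>c x y. \<lbrakk>x \<in> carrier M; y \<in> carrier M\<rbrakk> \<Longrightarrow> c \<odot> (x \<oplus> y) = c \<odot> x \<oplus> c \<odot> y"
    and "\<And>c d x. x \<in> carrier M \<Longrightarrow> (c * d) \<odot> x = c \<odot> (d \<odot> x)"
    and one: "\<And>x. x \<in> carrier M \<Longrightarrow> 1 \<odot> x = x"
    and zero: "\<And>x. x \<in> carrier M \<Longrightarrow> 0 \<odot> x = \<zero>"
  shows "cspace M"
proof (rule cspace.intro)
  have "\<exists>y\<in>carrier M. y \<oplus> x = \<zero>" if "x \<in> carrier M" for x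
    using assms(6)[OF that, of "-1"] assms(7)[OF that, of "-1" 1] one[OF that] zero[OF that]
    by (intro bexI[of _ "(-1) \<odot> x"]) auto
  then have "abelian_group M"
    by (intro abelian_groupI assms(1-5))
  then show "module complex_field M"
    by (intro moduleI cring_complex_field) (simp_all add: assms)
qed

locale lin = M: cspace M + N: cspace N
  for M :: "(complex, 'm, 'x) module_scheme" and N :: "(complex, 'n, 'y) module_scheme" +
  fixes f :: "'m \<Rightarrow> 'n"
  assumes lin: "lin_map M N f"
begin

lemmas closed [simp, intro] = lin_mapD(1)[OF lin]
lemmas add = lin_mapD(2)[OF lin]
lemmas scale = lin_mapD(3)[OF lin]

lemma zero [simp]: "f \<zero>\<^bsub>M\<^esub> = \<zero>\<^bsub>N\<^esub>"
  using scale[of "\<zero>\<^bsub>M\<^esub>" 0] closed[of "\<zero>\<^bsub>M\<^esub>"] by simp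

lemma minus: "x \<in> carrier M \<Longrightarrow> f (\<ominus>\<^bsub>M\<^esub> x) = \<ominus>\<^bsub>N\<^esub> f x"
  using scale[of x "-1"] by (simp add: M.scale_minus_one N.scale_minus_one)

lemma diff: "x \<in> carrier M \<Longrightarrow> y \<in> carrier M \<Longrightarrow> f (x \<ominus>\<^bsub>M\<^esub> y) = f x \<ominus>\<^bsub>N\<^esub> f y"
  by (simp add: a_minus_def add minus)

lemma sum: "finite T \<Longrightarrow> g \<in> T \<rightarrow> carrier M \<Longrightarrow> f (finsum M g T) = finsum N (\<lambda>t. f (g t)) T"
  by (induction T rule: finite_induct) (auto simp: add Pi_def)

lemma image_subspace:
  assumes "submodule H complex_field M"
  shows "submodule (f ` H) complex_field N"
proof (rule N.subspaceI)
  note H = M.subspaceD[OF assms]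
  show "f ` H \<subseteq> carrier N" "\<zero>\<^bsub>N\<^esub> \<in> f ` H"
    using H(1,2) zero by (auto, metis imageI)
  fix a b c
  assume "a \<in> f ` H"
  then obtain x where x: "x \<in> H" "a = f x" by blast
  then have "c \<odot>\<^bsub>N\<^esub> a = f (c \<odot>\<^bsub>M\<^esub> x)"
    using H(1) by (metis scale subsetD)
  then show "c \<odot>\<^bsub>N\<^esub> a \<in> f ` H"
    using H(4)[OF x(1)] by (simp only: imageI)
  assume "b \<in> f ` H"
  then obtain y where y: "y \<in> H" "b = f y" by blast
  then have "a \<oplus>\<^bsub>N\<^esub> b = f (x \<oplus>\<^bsub>M\<^esub> y)"
    by (simp add: x y add subsetD[OF H(1)])
  then show "a \<oplus>\<^bsub>N\<^esub> b \<in> f ` H"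
    using H(3)[OF x(1) y(1)] by (simp only: imageI)
qed

lemma vimage_subspace:
  assumes "submodule H complex_field N"
  shows "submodule {x \<in> carrier M. f x \<in> H} complex_field M"
proof (rule M.subspaceI)
  note H = N.subspaceD[OF assms]
  show "{x \<in> carrier M. f x \<in> H} \<subseteq> carrier M" "\<zero>\<^bsub>M\<^esub> \<in> {x \<in> carrier M. f x \<in> H}"
    using H(2) by auto
  fix a b c
  assume a: "a \<in> {x \<in> carrier M. f x \<in> H}"
  then show "c \<odot>\<^bsub>M\<^esub> a \<in> {x \<in> carrier M. f x \<in> H}"
    using H(4)[of "f a" c] by (simp add: scale)
  assume b: "b \<in> {x \<in> carrier M. f x \<in> H}"
  then show "a \<oplus>\<^bsub>M\<^esub> b \<in> {x \<in> carrier M. f x \<in> H}"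
    using H(3)[of "f a" "f b"] a by (simp add: add)
qed

lemma kernel_subspace: "submodule {x \<in> carrier M. f x = \<zero>\<^bsub>N\<^esub>} complex_field M"
  by (intro M.subspaceI) (auto simp: add scale)

end

lemma linI: "cspace M \<Longrightarrow> cspace N \<Longrightarrow> lin_map M N f \<Longrightarrow> lin M N f"
  by (simp add: lin_def lin_axioms_def)

lemma equalizer_subspace:
  assumes "lin M N f" "lin M N g"
  shows "submodule {x \<in> carrier M. f x = g x} complex_field M"
proof -
  interpret f: lin M N f by fact
  interpret g: lin M N g by fact
  show ?thesis
    by (intro f.M.subspaceI) (auto simp: f.add g.add f.scale g.scale)
qed

lemma lin_map_add:
  assumes "cspace M" "cspace N" "lin_map M N f" "lin_map M N g"
  shows "lin_map M N (\<lambda>x. f x \<oplus>\<^bsub>N\<^esub> g x)"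
proof -
  interpret f: lin M N f using assms by (simp add: linI)
  interpret g: lin M N g using assms by (simp add: linI)
  show ?thesis
    by (rule lin_mapI) (auto simp: f.add g.add f.scale g.scale f.N.scale_add_right f.N.a_ac)
qed

lemma lin_map_scale:
  assumes "cspace M" "cspace N" "lin_map M N f"
  shows "lin_map M N (\<lambda>x. c \<odot>\<^bsub>N\<^esub> f x)"
proof -
  interpret f: lin M N f using assms by (simp add: linI)
  show ?thesis
    by (rule lin_mapI) (auto simp: f.add f.scale f.N.scale_add_right f.N.scale_scale mult.commute)
qed

lemma lin_map_diff:
  assumes "cspace M" "cspace N" "lin_map M N f" "lin_map M N g"
  shows "lin_map M N (\<lambda>x. f x \<ominus>\<^bsub>N\<^esub> g x)"
proof -
  interpret N: cspace N by fact
  have "lin_map M N (\<lambda>x. f x \<oplus>\<^bsub>N\<^esub> (- 1) \<odot>\<^bsub>N\<^esub> g x)"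
    by (intro lin_map_add lin_map_scale assms)
  then show ?thesis
    by (rule lin_map_cong) (use assms in \<open>auto simp: N.scale_minus_one a_minus_def lin_mapD(1)\<close>)
qed

lemma lin_map_sum:
  assumes "cspace M" "cspace N" "finite T" "\<And>t. t \<in> T \<Longrightarrow> lin_map M N (f t)"
  shows "lin_map M N (\<lambda>x. finsum N (\<lambda>t. f t x) T)"
proof -
  interpret M: cspace M by fact
  interpret N: cspace N by fact
  show ?thesis
    using assms(3,4)
  proof (induction T rule: finite_induct)
    case empty
    then show ?case
      by (auto intro: lin_mapI)
  next
    case (insert t T)
    then have "lin_map M N (\<lambda>x. f t x \<oplus>\<^bsub>N\<^esub> finsum N (\<lambda>t. f t x) T)"
      by (intro lin_map_add assms(1,2)) auto
    then show ?case
    proof (rule lin_map_cong[OF _ _ assms(1)])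
      fix x assume "x \<in> carrier M"
      then have "f s x \<in> carrier N" if "s \<in> insert t T" for s
        using insert.prems[OF that] lin_mapD(1) by fast
      then show "f t x \<oplus>\<^bsub>N\<^esub> finsum N (\<lambda>t. f t x) T = finsum N (\<lambda>t. f t x) (insert t T)"
        using insert.hyps by (simp add: Pi_def)
    qed
  qed
qed


section \<open>Quotient spaces\<close>

text \<open>The quotient construction of the tensor products, of the tensor algebra, of the preprojective algebra
and of Hochschild homology, as far as the vector space structure is concerned.\<close>

locale quotient = cspace M for M :: "(complex, 'm, 'x) module_scheme" (structure) +
  fixes N
  assumes subspace: "submodule N complex_field M"
begin

lemma mem_coset_iff: "z \<in> N +> x \<longleftrightarrow> (\<exists>h\<in>N. z = h \<oplus> x)"
  by (simp add: a_r_coset_def')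

lemma mem_coset_iff_diff:
  assumes "x \<in> carrier M"
  shows "z \<in> N +> x \<longleftrightarrow> z \<in> carrier M \<and> z \<ominus> x \<in> N"
proof
  assume "z \<in> N +> x"
  then obtain h where h: "h \<in> N" "z = h \<oplus> x"
    unfolding mem_coset_iff ..
  then have "h \<in> carrier M"
    using subspaceD(1)[OF subspace] by blast
  then have "z \<in> carrier M" "z \<ominus> x = h"
    using h(2) assms eq_minus_iff[of h z x] by auto
  with h show "z \<in> carrier M \<and> z \<ominus> x \<in> N"
    by simp
next
  assume z: "z \<in> carrier M \<and> z \<ominus> x \<in> N"
  then have "z = (z \<ominus> x) \<oplus> x"
    using assms eq_minus_iff[of "z \<ominus> x" z x] by simp
  then show "z \<in> N +> x"
    using z unfolding mem_coset_iff by blast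
qed

lemma coset_self: "x \<in> carrier M \<Longrightarrow> x \<in> N +> x"
  using subspaceD(2)[OF subspace] by (simp add: mem_coset_iff_diff)

lemma coset_mem_carrier: "x \<in> carrier M \<Longrightarrow> y \<in> N +> x \<Longrightarrow> y \<in> carrier M"
  by (simp add: mem_coset_iff_diff)

lemma coset_eq_iff:
  assumes "x \<in> carrier M" "y \<in> carrier M"
  shows "N +> x = N +> y \<longleftrightarrow> x \<ominus> y \<in> N"
proof
  assume "N +> x = N +> y"
  with coset_self[OF assms(1)] have "x \<in> N +> y"
    by (simp only:)
  then show "x \<ominus> y \<in> N"
    using assms by (simp add: mem_coset_iff_diff)
next
  note N = subspaceD[OF subspace]
  assume xy: "x \<ominus> y \<in> N"
  have "z \<ominus> x \<in> N \<longleftrightarrow> z \<ominus> y \<in> N" if z: "z \<in> carrier M" for z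
  proof -
    have eq: "z \<ominus> y = (z \<ominus> x) \<oplus> (x \<ominus> y)"
      using z assms by (simp add: a_minus_def a_assoc r_neg1)
    then have "z \<ominus> x = (z \<ominus> y) \<ominus> (x \<ominus> y)"
      using z assms eq_minus_iff[of "z \<ominus> x" "z \<ominus> y" "x \<ominus> y"] by simp
    with eq xy N(3,6) show ?thesis
      by metis
  qed
  then show "N +> x = N +> y"
    using assms by (auto simp: mem_coset_iff_diff)
qed

lemma coset_mem_eq: "x \<in> carrier M \<Longrightarrow> y \<in> N +> x \<Longrightarrow> N +> y = N +> x"
  by (simp add: mem_coset_iff_diff coset_eq_iff)

lemma coset_zero: "N +> \<zero> = N"
proof -
  have "h \<oplus> \<zero> = h" if "h \<in> N" for h
    using subspaceD(1)[OF subspace] that by (meson r_zero subsetD)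
  then show ?thesis
    unfolding a_r_coset_def' by simp
qed

lemma coset_eq_N_iff: "x \<in> carrier M \<Longrightarrow> N +> x = N \<longleftrightarrow> x \<in> N"
  using coset_eq_iff[of x \<zero>] eq_minus_iff[of x x \<zero>] by (simp add: coset_zero)

lemma quot_carrier: "carrier (M QuotC N) = (\<lambda>x. N +> x) ` carrier M"
  by (auto simp: cquot_def A_RCOSETS_def')

lemma quot_zero: "\<zero>\<^bsub>M QuotC N\<^esub> = N"
  by (simp add: cquot_def)

lemma quot_add:
  assumes "x \<in> carrier M" "y \<in> carrier M"
  shows "(N +> x) \<oplus>\<^bsub>M QuotC N\<^esub> (N +> y) = N +> (x \<oplus> y)"
proof -
  interpret abelian_subgroup N M
    using subspace abelian_group_axioms
    by (intro abelian_subgroupI3 additive_subgroup.intro) (auto simp: submodule_def)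
  show ?thesis
    using a_rcos_sum assms by (simp add: cquot_def)
qed

lemma quot_scale:
  assumes "x \<in> carrier M"
  shows "c \<odot>\<^bsub>M QuotC N\<^esub> (N +> x) = N +> (c \<odot> x)"
proof -
  have "N +> (c \<odot> y) = N +> (c \<odot> x)" if "y \<in> N +> x" for y
  proof -
    have y: "y \<in> carrier M"
      using that assms coset_mem_carrier by blast
    then have "y \<ominus> x \<in> N"
      using that assms coset_mem_eq coset_eq_iff by blast
    moreover have "c \<odot> y \<ominus> c \<odot> x = c \<odot> (y \<ominus> x)"
      using y assms scale_scale[of x "-1" c] scale_scale[of x c "-1"]
      by (simp add: a_minus_def scale_add_right flip: scale_minus_one)
    ultimately show ?thesis
      using subspaceD(4)[OF subspace] coset_eq_iff y assms by simp
  qed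
  moreover have ne: "N +> x \<noteq> {}"
    using coset_self[OF assms] by blast
  ultimately have "(\<Union>y\<in>N +> x. N +> (c \<odot> y)) = (\<Union>y\<in>N +> x. N +> (c \<odot> x))"
    by (intro SUP_cong refl)
  also have "\<dots> = N +> (c \<odot> x)"
    using ne by (simp only: UN_constant if_False)
  finally show ?thesis
    unfolding cquot_def module.simps .
qed

lemma quot_cspace: "cspace (M QuotC N)"
proof (rule cspaceI)
  have zero: "\<zero>\<^bsub>M QuotC N\<^esub> = N +> \<zero>"
    by (simp add: quot_zero coset_zero)
  show "\<zero>\<^bsub>M QuotC N\<^esub> \<in> carrier (M QuotC N)"
    by (simp add: zero quot_carrier)
  fix X Y Z c d
  assume "X \<in> carrier (M QuotC N)"
  then obtain x where x: "x \<in> carrier M" "X = N +> x" by (auto simp: quot_carrier)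
  then show "\<zero>\<^bsub>M QuotC N\<^esub> \<oplus>\<^bsub>M QuotC N\<^esub> X = X" "c \<odot>\<^bsub>M QuotC N\<^esub> X \<in> carrier (M QuotC N)"
    "(c + d) \<odot>\<^bsub>M QuotC N\<^esub> X = c \<odot>\<^bsub>M QuotC N\<^esub> X \<oplus>\<^bsub>M QuotC N\<^esub> d \<odot>\<^bsub>M QuotC N\<^esub> X"
    "(c * d) \<odot>\<^bsub>M QuotC N\<^esub> X = c \<odot>\<^bsub>M QuotC N\<^esub> (d \<odot>\<^bsub>M QuotC N\<^esub> X)"
    "1 \<odot>\<^bsub>M QuotC N\<^esub> X = X" "0 \<odot>\<^bsub>M QuotC N\<^esub> X = \<zero>\<^bsub>M QuotC N\<^esub>"
    by (auto simp: zero quot_add quot_scale quot_carrier scale_add_left scale_scale)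
  assume "Y \<in> carrier (M QuotC N)"
  then obtain y where y: "y \<in> carrier M" "Y = N +> y" by (auto simp: quot_carrier)
  with x show "X \<oplus>\<^bsub>M QuotC N\<^esub> Y \<in> carrier (M QuotC N)"
    "c \<odot>\<^bsub>M QuotC N\<^esub> (X \<oplus>\<^bsub>M QuotC N\<^esub> Y) = c \<odot>\<^bsub>M QuotC N\<^esub> X \<oplus>\<^bsub>M QuotC N\<^esub> c \<odot>\<^bsub>M QuotC N\<^esub> Y"
    "X \<oplus>\<^bsub>M QuotC N\<^esub> Y = Y \<oplus>\<^bsub>M QuotC N\<^esub> X"
    by (auto simp: zero quot_add quot_scale quot_carrier scale_add_right a_comm)
  assume "Z \<in> carrier (M QuotC N)"
  then obtain z where "z \<in> carrier M" "Z = N +> z" by (auto simp: quot_carrier)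
  with x y show "X \<oplus>\<^bsub>M QuotC N\<^esub> Y \<oplus>\<^bsub>M QuotC N\<^esub> Z = X \<oplus>\<^bsub>M QuotC N\<^esub> (Y \<oplus>\<^bsub>M QuotC N\<^esub> Z)"
    by (auto simp: quot_add a_assoc)
qed

lemma lin_coset: "lin_map M (M QuotC N) (\<lambda>x. N +> x)"
  by (rule lin_mapI) (auto simp: quot_add quot_scale quot_carrier)

lemma lin_lift:
  assumes "cspace P" "lin_map M P f" "\<And>x. x \<in> N \<Longrightarrow> f x = \<zero>\<^bsub>P\<^esub>"
  shows "lin_map (M QuotC N) P (\<lambda>X. the_elem (f ` X))"
    and "\<And>x. x \<in> carrier M \<Longrightarrow> the_elem (f ` (N +> x)) = f x"
proof -
  interpret f: lin M P f
    using assms by (simp add: linI cspace_axioms)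
  show *: "the_elem (f ` (N +> x)) = f x" if x: "x \<in> carrier M" for x
  proof -
    have "f y = f x" if "y \<in> N +> x" for y
    proof -
      from that obtain h where "h \<in> N" "y = h \<oplus> x"
        by (auto simp: a_r_coset_def')
      then show ?thesis
        using x assms(3) subspaceD(1)[OF subspace] by (auto simp: f.add subset_iff)
    qed
    then have "f ` (N +> x) \<subseteq> {f x}"
      by (intro image_subsetI) simp
    moreover have "f x \<in> f ` (N +> x)"
      by (intro imageI coset_self x)
    ultimately have "f ` (N +> x) = {f x}"
      by blast
    then show ?thesis
      by simp
  qed
  show "lin_map (M QuotC N) P (\<lambda>X. the_elem (f ` X))"
    by (rule lin_mapI) (auto simp: quot_carrier quot_add quot_scale * f.add f.scale)
qed

end


section \<open>Spaces presented by generators and relations\<close>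

lemma free_space_simps [simp]:
  "\<zero>\<^bsub>free_space W\<^esub> = (\<lambda>w. 0)" "f \<oplus>\<^bsub>free_space W\<^esub> g = (\<lambda>w. f w + g w)"
  "c \<odot>\<^bsub>free_space W\<^esub> f = (\<lambda>w. c * f w)"
  "carrier (free_space W) = {f. finite {w. f w \<noteq> 0} \<and> {w. f w \<noteq> 0} \<subseteq> W}"
  by (simp_all add: free_space_def)

lemma cspace_free_space: "cspace (free_space W)"
proof -
  have add: "finite {w. f w + g w \<noteq> 0} \<and> {w. f w + g w \<noteq> 0} \<subseteq> W"
    if "finite {w. f w \<noteq> 0} \<and> {w. f w \<noteq> 0} \<subseteq> W" "finite {w. g w \<noteq> 0} \<and> {w. g w \<noteq> 0} \<subseteq> W"
    for f g :: "'a \<Rightarrow> complex"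
  proof -
    have "{w. f w + g w \<noteq> 0} \<subseteq> {w. f w \<noteq> 0} \<union> {w. g w \<noteq> 0}" by auto
    with that show ?thesis by (meson finite_UnI finite_subset le_supI order_trans)
  qed
  have scale: "finite {w. c * f w \<noteq> 0} \<and> {w. c * f w \<noteq> 0} \<subseteq> W"
    if "finite {w. f w \<noteq> 0} \<and> {w. f w \<noteq> 0} \<subseteq> W" for c and f :: "'a \<Rightarrow> complex"
    by (rule conjI, rule finite_subset[of _ "{w. f w \<noteq> 0}"]) (use that in auto)
  show ?thesis
    by (rule cspaceI) (use add scale in \<open>auto simp: algebra_simps\<close>)
qed

lemma delta_closed: "w \<in> W \<Longrightarrow> delta w \<in> carrier (free_space W)"
  by (auto simp: delta_def intro: finite_subset[of _ "{w}"])

lemma free_space_minus: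
  assumes "f \<in> carrier (free_space W)" "g \<in> carrier (free_space W)"
  shows "f \<ominus>\<^bsub>free_space W\<^esub> g = f - g"
proof -
  interpret cspace "free_space W" by (rule cspace_free_space)
  have "f - g = f \<oplus>\<^bsub>free_space W\<^esub> (-1) \<odot>\<^bsub>free_space W\<^esub> g"
    by (simp add: fun_eq_iff)
  also have "\<dots> = f \<ominus>\<^bsub>free_space W\<^esub> g"
    using scale_minus_one assms(2) unfolding a_minus_def by metis
  finally show ?thesis by simp
qed

text \<open>The finitely supported functions are the span of the basis words, so a subspace containing the latter
is everything. Linear maps on all presented spaces below are compared on generators by this principle.\<close>

lemma free_space_induct:
  assumes "submodule H complex_field (free_space W)" "\<And>w. w \<in> W \<Longrightarrow> delta w \<in> H"
    and v: "v \<in> carrier (free_space W)"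
  shows "v \<in> H"
proof -
  interpret cspace "free_space W" by (rule cspace_free_space)
  note H = subspaceD[OF assms(1)]
  have "v \<in> H" if "finite T" "{w. v w \<noteq> 0} \<subseteq> T" "T \<subseteq> W" for T v
    using that
  proof (induction T arbitrary: v rule: finite_induct)
    case empty
    then have "v = \<zero>\<^bsub>free_space W\<^esub>" by auto
    then show ?case using H(2) by metis
  next
    case (insert t T)
    have "v(t := 0) \<in> H"
      using insert by (intro insert.IH) auto
    moreover have "v t \<odot>\<^bsub>free_space W\<^esub> delta t \<in> H"
      using insert assms(2) H(4) by blast
    moreover have "v = v(t := 0) \<oplus>\<^bsub>free_space W\<^esub> v t \<odot>\<^bsub>free_space W\<^esub> delta t"
      by (auto simp: delta_def)
    ultimately show ?case
      using H(3) by metis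
  qed
  with v show ?thesis by auto
qed

lemma lin_ext_superset:
  assumes "cspace M" "g \<in> W \<rightarrow> carrier M" "finite T" "{w. v w \<noteq> 0} \<subseteq> T" "T \<subseteq> W"
  shows "lin_ext M g v = (\<Oplus>\<^bsub>M\<^esub>w\<in>T. v w \<odot>\<^bsub>M\<^esub> g w)"
proof -
  interpret cspace M by fact
  show ?thesis
    unfolding lin_ext_def
    by (rule add.finprod_mono_neutral_cong_left) (use assms in \<open>auto intro!: scale_zero_left\<close>)
qed

lemma lin_ext_delta:
  assumes "cspace M" "g \<in> W \<rightarrow> carrier M" "w \<in> W"
  shows "lin_ext M g (delta w) = g w"
proof -
  interpret cspace M by fact
  have "g w \<in> carrier M" using assms by auto
  moreover have "{u. delta w u \<noteq> 0} = {w}" by (auto simp: delta_def)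
  ultimately show ?thesis
    by (simp add: lin_ext_def delta_def)
qed

lemma lin_lin_ext:
  fixes M (structure)
  assumes "cspace M" "g \<in> W \<rightarrow> carrier M"
  shows "lin_map (free_space W) M (lin_ext M g)"
proof -
  interpret cspace M by fact
  interpret F: cspace "free_space W" by (rule cspace_free_space)
  show ?thesis
  proof (rule lin_mapI)
    fix x y c
    assume x: "x \<in> carrier (free_space W)"
    then show "lin_ext M g x \<in> carrier M"
      using assms(2) unfolding lin_ext_def by (intro finsum_closed) auto
    have gx: "g w \<in> carrier M" if "x w \<noteq> 0" for w
      using x assms(2) that by auto
    have "lin_ext M g (c \<odot>\<^bsub>free_space W\<^esub> x) = (\<Oplus>w\<in>{w. x w \<noteq> 0}. (c * x w) \<odot> g w)"
      using x by (subst lin_ext_superset[OF assms, of "{w. x w \<noteq> 0}"]) auto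
    also have "\<dots> = (\<Oplus>w\<in>{w. x w \<noteq> 0}. c \<odot> (x w \<odot> g w))"
      using gx by (intro finsum_cong') (auto simp: scale_scale)
    also have "\<dots> = c \<odot> lin_ext M g x"
      unfolding lin_ext_def using x assms(2)
      by (subst module.finsum_smult_ldistr[OF is_module]) auto
    finally show "lin_ext M g (c \<odot>\<^bsub>free_space W\<^esub> x) = c \<odot> lin_ext M g x" .
    assume y: "y \<in> carrier (free_space W)"
    let ?T = "{w. x w \<noteq> 0} \<union> {w. y w \<noteq> 0}"
    have T: "finite ?T" "?T \<subseteq> W" using x y by auto
    then have gT: "g w \<in> carrier M" if "w \<in> ?T" for w using assms(2) that by blast
    have "lin_ext M g (x \<oplus>\<^bsub>free_space W\<^esub> y) = (\<Oplus>w\<in>?T. (x w + y w) \<odot> g w)"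
      using T by (subst lin_ext_superset[OF assms, of ?T]) auto
    also have "\<dots> = (\<Oplus>w\<in>?T. x w \<odot> g w \<oplus> y w \<odot> g w)"
      using gT by (intro finsum_cong') (auto simp: scale_add_left)
    also have "\<dots> = (\<Oplus>w\<in>?T. x w \<odot> g w) \<oplus> (\<Oplus>w\<in>?T. y w \<odot> g w)"
      using gT by (intro finsum_addf) auto
    also have "\<dots> = lin_ext M g x \<oplus> lin_ext M g y"
      using T by (subst (1 2) lin_ext_superset[OF assms, of ?T]) auto
    finally show "lin_ext M g (x \<oplus>\<^bsub>free_space W\<^esub> y) = lin_ext M g x \<oplus> lin_ext M g y" .
  qed
qed


lemma lin_map_free_eq:
  assumes "cspace M" "lin_map (free_space W) M f" "lin_map (free_space W) M g"
    and "\<And>w. w \<in> W \<Longrightarrow> f (delta w) = g (delta w)" "v \<in> carrier (free_space W)"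
  shows "f v = g v"
proof -
  have "submodule {x \<in> carrier (free_space W). f x = g x} complex_field (free_space W)"
    by (intro equalizer_subspace[where N = M] linI cspace_free_space assms)
  then have "v \<in> {x \<in> carrier (free_space W). f x = g x}"
    by (rule free_space_induct[OF _ _ assms(5)], intro CollectI conjI assms(4) delta_closed)
  then show ?thesis
    by blast
qed

locale presentation =
  fixes W :: "'w set" and R :: "('w \<Rightarrow> complex) set"
  assumes rels: "R \<subseteq> carrier (free_space W)"
begin

abbreviation "relspace \<equiv> lin_span (free_space W) R"
abbreviation "Q \<equiv> free_space W QuotC relspace"
abbreviation "cls w \<equiv> relspace +>\<^bsub>free_space W\<^esub> delta w"

sublocale quotient "free_space W" relspace
  using cspace_free_space cspace.lin_span_subspace[OF cspace_free_space rels]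
  by (simp add: quotient_def quotient_axioms_def)

lemma cls_closed: "w \<in> W \<Longrightarrow> cls w \<in> carrier Q"
  unfolding quot_carrier by (intro imageI delta_closed)

lemma quot_induct:
  assumes "submodule H complex_field Q" "\<And>w. w \<in> W \<Longrightarrow> cls w \<in> H" "X \<in> carrier Q"
  shows "X \<in> H"
proof -
  interpret p: lin "free_space W" Q "\<lambda>x. relspace +>\<^bsub>free_space W\<^esub> x"
    by (intro linI cspace_free_space quot_cspace lin_coset)
  obtain x where x: "x \<in> carrier (free_space W)" "X = relspace +>\<^bsub>free_space W\<^esub> x"
    using assms(3) unfolding quot_carrier by blast
  have "x \<in> {x \<in> carrier (free_space W). relspace +>\<^bsub>free_space W\<^esub> x \<in> H}"
    by (rule free_space_induct[OF p.vimage_subspace[OF assms(1)] _ x(1)],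
        rule CollectI, intro conjI assms(2) delta_closed)
  with x(2) show ?thesis
    by blast
qed

lemma quot_lift:
  assumes "cspace M" "g \<in> W \<rightarrow> carrier M" "\<And>r. r \<in> R \<Longrightarrow> lin_ext M g r = \<zero>\<^bsub>M\<^esub>"
  shows "lin_map Q M (quot_lift M g)"
    and "x \<in> carrier (free_space W) \<Longrightarrow>
      quot_lift M g (relspace +>\<^bsub>free_space W\<^esub> x) = lin_ext M g x"
    and "w \<in> W \<Longrightarrow> quot_lift M g (cls w) = g w"
proof -
  interpret l: lin "free_space W" M "lin_ext M g"
    by (intro linI cspace_free_space lin_lin_ext assms)
  have "relspace \<subseteq> {x \<in> carrier (free_space W). lin_ext M g x = \<zero>\<^bsub>M\<^esub>}"
    by (rule lin_span_least[OF l.kernel_subspace]) (use rels assms(3) in blast)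
  then have ker: "lin_ext M g x = \<zero>\<^bsub>M\<^esub>" if "x \<in> relspace" for x
    using that by blast
  note * = lin_lift[OF assms(1) l.lin ker, folded quot_lift_def]
  show "lin_map Q M (quot_lift M g)"
    by (rule *(1))
  show 1: "x \<in> carrier (free_space W) \<Longrightarrow>
      quot_lift M g (relspace +>\<^bsub>free_space W\<^esub> x) = lin_ext M g x" for x
    by (rule *(2))
  show "w \<in> W \<Longrightarrow> quot_lift M g (cls w) = g w"
    using 1[OF delta_closed] lin_ext_delta[OF assms(1,2)] by simp
qed

lemma lin_map_eq:
  assumes "cspace M" "lin_map Q M f" "lin_map Q M g"
    and "\<And>w. w \<in> W \<Longrightarrow> f (cls w) = g (cls w)" "X \<in> carrier Q"
  shows "f X = g X"
proof -
  have "submodule {x \<in> carrier Q. f x = g x} complex_field Q"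
    by (intro equalizer_subspace[where N = M] linI quot_cspace assms)
  then have "X \<in> {x \<in> carrier Q. f x = g x}"
    by (rule quot_induct[OF _ _ assms(5)], intro CollectI conjI assms(4) cls_closed)
  then show ?thesis
    by blast
qed

end

lemma free_space_rel_closed:
  assumes "u \<in> W" "v \<in> W"
  shows "w \<in> W \<Longrightarrow> delta u - delta v - delta w \<in> carrier (free_space W)"
    and "delta u - (\<lambda>x. c * delta v x) \<in> carrier (free_space W)"
    and "delta u - delta v \<in> carrier (free_space W)"
proof -
  interpret cspace "free_space W" by (rule cspace_free_space)
  note d = delta_closed[OF assms(1)] delta_closed[OF assms(2)]
  have "c \<odot>\<^bsub>free_space W\<^esub> delta v = (\<lambda>x. c * delta v x)"
    by simp
  then show "delta u - (\<lambda>x. c * delta v x) \<in> carrier (free_space W)"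
    using minus_closed[OF d(1) scale_closed[OF d(2), of c]]
      free_space_minus[OF d(1) scale_closed[OF d(2), of c]] by (simp only:)
  show 1: "delta u - delta v \<in> carrier (free_space W)"
    using minus_closed[OF d] free_space_minus[OF d] by (simp only:)
  show "delta u - delta v - delta w \<in> carrier (free_space W)" if "w \<in> W"
    using minus_closed[OF 1 delta_closed[OF that]] free_space_minus[OF 1 delta_closed[OF that]]
    by (simp only:)
qed

text \<open>All relations in the constructions below have one of the shapes \<open>u = v + w\<close>,
  \<open>u = c v\<close> and \<open>u = v\<close> for basis words. A linear extension kills such a relation as soon as
  its values on words satisfy it.\<close>

lemma lin_ext_add_rel:
  assumes "cspace M" "g \<in> W \<rightarrow> carrier M" "u \<in> W" "v \<in> W" "w \<in> W"
    and "g u = g v \<oplus>\<^bsub>M\<^esub> g w"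
  shows "lin_ext M g (delta u - delta v - delta w) = \<zero>\<^bsub>M\<^esub>"
proof -
  interpret l: lin "free_space W" M "lin_ext M g"
    by (intro linI cspace_free_space lin_lin_ext assms)
  note d = delta_closed[OF assms(3)] delta_closed[OF assms(4)] delta_closed[OF assms(5)]
  have gc: "g u \<in> carrier M" "g v \<in> carrier M" "g w \<in> carrier M"
    using assms(2-5) by auto
  have "delta u - delta v - delta w =
      delta u \<ominus>\<^bsub>free_space W\<^esub> delta v \<ominus>\<^bsub>free_space W\<^esub> delta w"
    using d l.M.minus_closed[OF d(1,2)] by (simp only: free_space_minus)
  then have "lin_ext M g (delta u - delta v - delta w) = g u \<ominus>\<^bsub>M\<^esub> g v \<ominus>\<^bsub>M\<^esub> g w"
    using d l.M.minus_closed[OF d(1,2)] lin_ext_delta[OF assms(1,2)] assms(3-5)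
    by (simp only: l.diff)
  also have "\<dots> = \<zero>\<^bsub>M\<^esub>"
    using gc by (simp add: assms(6) l.N.add_diff_cancel_left)
  finally show ?thesis .
qed

lemma lin_ext_scale_rel:
  assumes "cspace M" "g \<in> W \<rightarrow> carrier M" "u \<in> W" "v \<in> W" "g u = c \<odot>\<^bsub>M\<^esub> g v"
  shows "lin_ext M g (delta u - (\<lambda>x. c * delta v x)) = \<zero>\<^bsub>M\<^esub>"
proof -
  interpret l: lin "free_space W" M "lin_ext M g"
    by (intro linI cspace_free_space lin_lin_ext assms)
  note d = delta_closed[OF assms(3)] delta_closed[OF assms(4)]
  have gc: "g u \<in> carrier M" "g v \<in> carrier M"
    using assms(2-4) by auto
  have "delta u - (\<lambda>x. c * delta v x) = delta u \<ominus>\<^bsub>free_space W\<^esub> c \<odot>\<^bsub>free_space W\<^esub> delta v"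
    using free_space_minus[OF d(1) l.M.scale_closed[OF d(2)]] by simp
  then have "lin_ext M g (delta u - (\<lambda>x. c * delta v x)) = g u \<ominus>\<^bsub>M\<^esub> c \<odot>\<^bsub>M\<^esub> g v"
    using d l.M.scale_closed[OF d(2)] lin_ext_delta[OF assms(1,2)] assms(3-4)
    by (simp only: l.diff l.scale)
  with assms(5) gc show ?thesis
    by simp
qed

lemma lin_ext_eq_rel:
  assumes "cspace M" "g \<in> W \<rightarrow> carrier M" "u \<in> W" "v \<in> W" "g u = g v"
  shows "lin_ext M g (delta u - delta v) = \<zero>\<^bsub>M\<^esub>"
proof -
  interpret M: cspace M by fact
  have "g v \<in> carrier M" using assms by auto
  then show ?thesis
    using lin_ext_scale_rel[OF assms(1-4), of 1] assms(5) by simp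
qed

context presentation
begin

lemma cls_add_rel:
  assumes "delta u - delta v - delta w \<in> R" "u \<in> W" "v \<in> W" "w \<in> W"
  shows "cls u = cls v \<oplus>\<^bsub>Q\<^esub> cls w"
proof -
  have d: "delta u \<in> carrier (free_space W)" "delta v \<in> carrier (free_space W)"
    "delta w \<in> carrier (free_space W)"
    by (simp_all only: delta_closed assms(2-4))
  have vw: "delta v \<oplus>\<^bsub>free_space W\<^esub> delta w \<in> carrier (free_space W)"
    using d by (simp only: a_closed)
  have "delta u \<ominus>\<^bsub>free_space W\<^esub> (delta v \<oplus>\<^bsub>free_space W\<^esub> delta w) = delta u - delta v - delta w"
    using free_space_minus[OF d(1) vw] by (simp add: fun_eq_iff)
  then show ?thesis
    using coset_eq_iff[OF d(1) vw] assms(1) lin_span_superset[of R] quot_add[OF d(2,3)] by auto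
qed

lemma cls_scale_rel:
  assumes "delta u - (\<lambda>x. c * delta v x) \<in> R" "u \<in> W" "v \<in> W"
  shows "cls u = c \<odot>\<^bsub>Q\<^esub> cls v"
proof -
  have d: "delta u \<in> carrier (free_space W)" "delta v \<in> carrier (free_space W)"
    by (simp_all only: delta_closed assms(2-3))
  have v: "c \<odot>\<^bsub>free_space W\<^esub> delta v \<in> carrier (free_space W)"
    using d by (simp only: scale_closed)
  have "delta u \<ominus>\<^bsub>free_space W\<^esub> (c \<odot>\<^bsub>free_space W\<^esub> delta v) = delta u - (\<lambda>x. c * delta v x)"
    using free_space_minus[OF d(1) v] by simp
  then show ?thesis
    using coset_eq_iff[OF d(1) v] assms(1) lin_span_superset[of R] quot_scale[OF d(2)] by auto
qed

lemma cls_eq_rel: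
  assumes "delta u - delta v \<in> R" "u \<in> W" "v \<in> W"
  shows "cls u = cls v"
proof -
  have d: "delta u \<in> carrier (free_space W)" "delta v \<in> carrier (free_space W)"
    by (simp_all only: delta_closed assms(2-3))
  then show ?thesis
    using coset_eq_iff[OF d] free_space_minus[OF d] assms(1) lin_span_superset[of R] by auto
qed

end


section \<open>Multilinear maps and tensor products\<close>

\<comment> \<open>Keeps the term \<open>mtensor A A 1\<close> in one form under simplification.\<close>
declare One_nat_def [simp del]

text \<open>Additivity and homogeneity in each argument separately. A word has \<open>n\<close> letters in addition to its
first entry, so varying one of them leaves \<open>n - 1\<close> letters in \<open>us\<close> and \<open>vs\<close> together.\<close>

definition multilinear ::
    "(complex, 'p, 'x) module_scheme \<Rightarrow> (complex, 'q, 'y) module_scheme \<Rightarrow> nat \<Rightarrow>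
      (complex, 'm, 'z) module_scheme \<Rightarrow> ('p \<times> 'q list \<Rightarrow> 'm) \<Rightarrow> bool" where
  "multilinear P Q n M g \<longleftrightarrow>
     (\<forall>qs. set qs \<subseteq> carrier Q \<and> length qs = n \<longrightarrow> lin_map P M (\<lambda>p. g (p, qs))) \<and>
     (\<forall>p us vs. p \<in> carrier P \<and> set us \<subseteq> carrier Q \<and> set vs \<subseteq> carrier Q \<and>
        n = length us + length vs + 1 \<longrightarrow> lin_map Q M (\<lambda>q. g (p, us @ q # vs)))"

definition bilinear ::
    "(complex, 'p, 'x) module_scheme \<Rightarrow> (complex, 'q, 'y) module_scheme \<Rightarrow>
      (complex, 'm, 'z) module_scheme \<Rightarrow> ('p \<Rightarrow> 'q \<Rightarrow> 'm) \<Rightarrow> bool" where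
  "bilinear P Q M b \<longleftrightarrow>
     (\<forall>p\<in>carrier P. lin_map Q M (b p)) \<and> (\<forall>q\<in>carrier Q. lin_map P M (\<lambda>p. b p q))"

lemma bilinearI:
  "\<lbrakk>\<And>p. p \<in> carrier P \<Longrightarrow> lin_map Q M (b p); \<And>q. q \<in> carrier Q \<Longrightarrow> lin_map P M (\<lambda>p. b p q)\<rbrakk>
    \<Longrightarrow> bilinear P Q M b"
  by (simp add: bilinear_def)

lemma bilinearD:
  assumes "bilinear P Q M b"
  shows "p \<in> carrier P \<Longrightarrow> lin_map Q M (b p)" "q \<in> carrier Q \<Longrightarrow> lin_map P M (\<lambda>p. b p q)"
  using assms by (simp_all add: bilinear_def)

lemma bilinear_cong:
  assumes "bilinear P Q M b" "\<And>p q. p \<in> carrier P \<Longrightarrow> q \<in> carrier Q \<Longrightarrow> b p q = b' p q"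
    and "cspace P" "cspace Q"
  shows "bilinear P Q M b'"
proof (rule bilinearI)
  fix p assume p: "p \<in> carrier P"
  show "lin_map Q M (b' p)"
    by (rule lin_map_cong[OF bilinearD(1)[OF assms(1) p] assms(2)[OF p] assms(4)])
next
  fix q assume q: "q \<in> carrier Q"
  show "lin_map P M (\<lambda>p. b' p q)"
    by (rule lin_map_cong[OF bilinearD(2)[OF assms(1) q] assms(2)[OF _ q] assms(3)])
qed

lemma words_iff: "(p, qs) \<in> words P Q n \<longleftrightarrow> p \<in> carrier P \<and> set qs \<subseteq> carrier Q \<and> length qs = n"
  by (auto simp: words_def)

lemma multilinearD:
  assumes "multilinear P Q n M g"
  shows "w \<in> words P Q n \<Longrightarrow> g w \<in> carrier M"
    and "(p, qs) \<in> words P Q n \<Longrightarrow> p' \<in> carrier P \<Longrightarrow>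
      g (p \<oplus>\<^bsub>P\<^esub> p', qs) = g (p, qs) \<oplus>\<^bsub>M\<^esub> g (p', qs)"
    and "(p, qs) \<in> words P Q n \<Longrightarrow> g (c \<odot>\<^bsub>P\<^esub> p, qs) = c \<odot>\<^bsub>M\<^esub> g (p, qs)"
    and "(p, us @ q # vs) \<in> words P Q n \<Longrightarrow> q' \<in> carrier Q \<Longrightarrow>
      g (p, us @ (q \<oplus>\<^bsub>Q\<^esub> q') # vs) = g (p, us @ q # vs) \<oplus>\<^bsub>M\<^esub> g (p, us @ q' # vs)"
    and "(p, us @ q # vs) \<in> words P Q n \<Longrightarrow>
      g (p, us @ (c \<odot>\<^bsub>Q\<^esub> q) # vs) = c \<odot>\<^bsub>M\<^esub> g (p, us @ q # vs)"
  using assms by (cases w; simp add: multilinear_def words_iff lin_map_def)+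

lemma multilinear_0I: "lin_map P M (\<lambda>p. g (p, [])) \<Longrightarrow> multilinear P Q 0 M g"
  by (simp add: multilinear_def)

lemma multilinear_1I:
  assumes "bilinear P Q M (\<lambda>p q. g (p, [q]))"
  shows "multilinear P Q 1 M g"
  using bilinearD[OF assms] by (auto simp: multilinear_def One_nat_def length_Suc_conv)

lemma multilinear_2I:
  assumes "\<And>q r. q \<in> carrier Q \<Longrightarrow> r \<in> carrier Q \<Longrightarrow> lin_map P M (\<lambda>p. g (p, [q, r]))"
    and "\<And>p r. p \<in> carrier P \<Longrightarrow> r \<in> carrier Q \<Longrightarrow> lin_map Q M (\<lambda>q. g (p, [q, r]))"
    and "\<And>p q. p \<in> carrier P \<Longrightarrow> q \<in> carrier Q \<Longrightarrow> lin_map Q M (\<lambda>r. g (p, [q, r]))"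
  shows "multilinear P Q 2 M g"
  unfolding multilinear_def
proof (intro conjI allI impI)
  fix qs assume "set qs \<subseteq> carrier Q \<and> length qs = 2"
  then show "lin_map P M (\<lambda>p. g (p, qs))"
    using assms(1) by (auto simp: numeral_2_eq_2 length_Suc_conv)
next
  fix p us vs
  assume "p \<in> carrier P \<and> set us \<subseteq> carrier Q \<and> set vs \<subseteq> carrier Q \<and> 2 = length us + length vs + 1"
  then show "lin_map Q M (\<lambda>q. g (p, us @ q # vs))"
    using assms(2,3) by (cases us; cases vs) auto
qed

locale tensor = P: cspace P + Q: cspace Q
  for P :: "(complex, 'p, 'x) module_scheme" and Q :: "(complex, 'q, 'y) module_scheme"
begin

lemma words_closed:
  "(p, qs) \<in> words P Q n \<Longrightarrow> p' \<in> carrier P \<Longrightarrow> (p \<oplus>\<^bsub>P\<^esub> p', qs) \<in> words P Q n"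
  "(p, qs) \<in> words P Q n \<Longrightarrow> p' \<in> carrier P \<Longrightarrow> (p', qs) \<in> words P Q n"
  "(p, qs) \<in> words P Q n \<Longrightarrow> (c \<odot>\<^bsub>P\<^esub> p, qs) \<in> words P Q n"
  "(p, us @ q # vs) \<in> words P Q n \<Longrightarrow> q' \<in> carrier Q \<Longrightarrow> (p, us @ (q \<oplus>\<^bsub>Q\<^esub> q') # vs) \<in> words P Q n"
  "(p, us @ q # vs) \<in> words P Q n \<Longrightarrow> q' \<in> carrier Q \<Longrightarrow> (p, us @ q' # vs) \<in> words P Q n"
  "(p, us @ q # vs) \<in> words P Q n \<Longrightarrow> (p, us @ (c \<odot>\<^bsub>Q\<^esub> q) # vs) \<in> words P Q n"
  by (auto simp: words_iff)

lemma rels_cases: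
  assumes "r \<in> multilinear_rels P Q n"
  obtains p p' qs where "r = delta (p \<oplus>\<^bsub>P\<^esub> p', qs) - delta (p, qs) - delta (p', qs)"
      "(p, qs) \<in> words P Q n" "p' \<in> carrier P"
  | c p qs where "r = delta (c \<odot>\<^bsub>P\<^esub> p, qs) - (\<lambda>w. c * delta (p, qs) w)" "(p, qs) \<in> words P Q n"
  | p us q q' vs where
      "r = delta (p, us @ (q \<oplus>\<^bsub>Q\<^esub> q') # vs) - delta (p, us @ q # vs) - delta (p, us @ q' # vs)"
      "(p, us @ q # vs) \<in> words P Q n" "q' \<in> carrier Q"
  | c p us q vs where
      "r = delta (p, us @ (c \<odot>\<^bsub>Q\<^esub> q) # vs) - (\<lambda>w. c * delta (p, us @ q # vs) w)"
      "(p, us @ q # vs) \<in> words P Q n"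
  using assms unfolding multilinear_rels_def by blast

lemma multilinear_rels_closed:
  assumes "words P Q n \<subseteq> W"
  shows "multilinear_rels P Q n \<subseteq> carrier (free_space W)"
proof
  fix r assume "r \<in> multilinear_rels P Q n"
  then show "r \<in> carrier (free_space W)"
  proof (cases rule: rels_cases)
    case 1
    show ?thesis unfolding 1(1)
      by (intro free_space_rel_closed subsetD[OF assms] 1 words_closed(1,2)[OF 1(2,3)])
  next
    case 2
    show ?thesis unfolding 2(1)
      by (intro free_space_rel_closed subsetD[OF assms] 2 words_closed(3)[OF 2(2)])
  next
    case 3
    show ?thesis unfolding 3(1)
      by (intro free_space_rel_closed subsetD[OF assms] 3 words_closed(4,5)[OF 3(2,3)])
  next
    case 4
    show ?thesis unfolding 4(1)
      by (intro free_space_rel_closed subsetD[OF assms] 4 words_closed(6)[OF 4(2)])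
  qed
qed

lemma lin_ext_multilinear_rels:
  assumes "multilinear P Q n M g" "cspace M" "g \<in> W \<rightarrow> carrier M" "words P Q n \<subseteq> W"
    and "r \<in> multilinear_rels P Q n"
  shows "lin_ext M g r = \<zero>\<^bsub>M\<^esub>"
proof -
  note W = subsetD[OF assms(4)] and ml = multilinearD[OF assms(1)]
  from assms(5) show ?thesis
  proof (cases rule: rels_cases)
    case 1
    show ?thesis unfolding 1(1)
      by (intro lin_ext_add_rel[OF assms(2,3)] W 1 words_closed(1,2)[OF 1(2,3)] ml)
  next
    case 2
    show ?thesis unfolding 2(1)
      by (intro lin_ext_scale_rel[OF assms(2,3)] W 2 words_closed(3)[OF 2(2)] ml)
  next
    case 3
    show ?thesis unfolding 3(1)
      by (intro lin_ext_add_rel[OF assms(2,3)] W 3 words_closed(4,5)[OF 3(2,3)] ml)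
  next
    case 4
    show ?thesis unfolding 4(1)
      by (intro lin_ext_scale_rel[OF assms(2,3)] W 4 words_closed(6)[OF 4(2)] ml)
  qed
qed

lemma pres: "presentation (words P Q n) (multilinear_rels P Q n)"
  by (rule presentation.intro, rule multilinear_rels_closed, rule order_refl)

lemma cspace_mtensor: "cspace (mtensor P Q n)"
proof -
  interpret presentation "words P Q n" "multilinear_rels P Q n" by (rule pres)
  show ?thesis
    unfolding mtensor_def by (rule quot_cspace)
qed

lemma tens_eq: "(p, qs) \<in> words P Q n \<Longrightarrow> tens P Q p qs =
    lin_span (free_space (words P Q n)) (multilinear_rels P Q n) +>\<^bsub>free_space (words P Q n)\<^esub> delta (p, qs)"
  by (simp add: tens_def words_iff)

lemma tens_closed: "(p, qs) \<in> words P Q n \<Longrightarrow> tens P Q p qs \<in> carrier (mtensor P Q n)"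
proof -
  interpret presentation "words P Q n" "multilinear_rels P Q n" by (rule pres)
  show "(p, qs) \<in> words P Q n \<Longrightarrow> ?thesis"
    unfolding mtensor_def by (simp only: tens_eq cls_closed)
qed

lemma mtensor_induct:
  assumes "submodule H complex_field (mtensor P Q n)"
    "\<And>p qs. (p, qs) \<in> words P Q n \<Longrightarrow> tens P Q p qs \<in> H" "X \<in> carrier (mtensor P Q n)"
  shows "X \<in> H"
proof -
  interpret presentation "words P Q n" "multilinear_rels P Q n" by (rule pres)
  have "cls w \<in> H" if "w \<in> words P Q n" for w
    using that assms(2) tens_eq by (cases w) simp
  then show ?thesis
    using quot_induct[OF assms(1)[unfolded mtensor_def] _ assms(3)[unfolded mtensor_def]] by blast
qed

lemma mtensor_lift:
  assumes "cspace M" "multilinear P Q n M g"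
  shows "lin_map (mtensor P Q n) M (quot_lift M g)"
    and "(p, qs) \<in> words P Q n \<Longrightarrow> quot_lift M g (tens P Q p qs) = g (p, qs)"
proof -
  interpret presentation "words P Q n" "multilinear_rels P Q n" by (rule pres)
  have g: "g \<in> words P Q n \<rightarrow> carrier M"
    using multilinearD(1)[OF assms(2)] by blast
  note * = quot_lift[OF assms(1) g lin_ext_multilinear_rels[OF assms(2,1) g order_refl]]
  show "lin_map (mtensor P Q n) M (quot_lift M g)"
    unfolding mtensor_def by (rule *(1))
  show "(p, qs) \<in> words P Q n \<Longrightarrow> quot_lift M g (tens P Q p qs) = g (p, qs)"
    using *(3) by (simp only: tens_eq)
qed

lemma mtensor_lin_map_eq:
  assumes "cspace M" "lin_map (mtensor P Q n) M f" "lin_map (mtensor P Q n) M g"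
    and "\<And>p qs. (p, qs) \<in> words P Q n \<Longrightarrow> f (tens P Q p qs) = g (tens P Q p qs)"
    and "X \<in> carrier (mtensor P Q n)"
  shows "f X = g X"
proof -
  have "submodule {x \<in> carrier (mtensor P Q n). f x = g x} complex_field (mtensor P Q n)"
    by (intro equalizer_subspace[where N = M] linI cspace_mtensor assms)
  then have "X \<in> {x \<in> carrier (mtensor P Q n). f x = g x}"
    by (rule mtensor_induct[OF _ _ assms(5)]) (simp add: tens_closed assms(4))
  then show ?thesis
    by blast
qed

text \<open>Stated for any space in which the multilinear relations hold, because it is needed both for the tensor
products themselves and, one degree at a time, for the tensor algebra.\<close>

lemma multilinear_cls:
  assumes "presentation W R" "words P Q n \<subseteq> W" "multilinear_rels P Q n \<subseteq> R"
  shows "multilinear P Q n (free_space W QuotC lin_span (free_space W) R)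
    (\<lambda>w. lin_span (free_space W) R +>\<^bsub>free_space W\<^esub> delta w)"
proof -
  interpret presentation W R by fact
  let ?Q = "free_space W QuotC relspace"
  note W = subsetD[OF assms(2)] and R = subsetD[OF assms(3)]
  show ?thesis
    unfolding multilinear_def
  proof (intro conjI allI impI lin_mapI)
    fix qs p p' c assume qs: "set qs \<subseteq> carrier Q \<and> length qs = n" and p: "p \<in> carrier P"
    then have w: "(p, qs) \<in> words P Q n"
      by (simp add: words_iff)
    show "cls (p, qs) \<in> carrier ?Q"
      by (intro cls_closed W w)
    have "delta (c \<odot>\<^bsub>P\<^esub> p, qs) - (\<lambda>w. c * delta (p, qs) w) \<in> multilinear_rels P Q n"
      unfolding multilinear_rels_def using w by blast
    then show "cls (c \<odot>\<^bsub>P\<^esub> p, qs) = c \<odot>\<^bsub>?Q\<^esub> cls (p, qs)"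
      by (intro cls_scale_rel R W w words_closed(3))
    assume p': "p' \<in> carrier P"
    have "delta (p \<oplus>\<^bsub>P\<^esub> p', qs) - delta (p, qs) - delta (p', qs) \<in> multilinear_rels P Q n"
      unfolding multilinear_rels_def using w p' by blast
    then show "cls (p \<oplus>\<^bsub>P\<^esub> p', qs) = cls (p, qs) \<oplus>\<^bsub>?Q\<^esub> cls (p', qs)"
      by (intro cls_add_rel R W w words_closed(1,2)[OF w p'])
  next
    fix p us vs q q' c
    assume *: "p \<in> carrier P \<and> set us \<subseteq> carrier Q \<and> set vs \<subseteq> carrier Q \<and> n = length us + length vs + 1"
      and q: "q \<in> carrier Q"
    then have w: "(p, us @ q # vs) \<in> words P Q n"
      by (simp add: words_iff)
    show "cls (p, us @ q # vs) \<in> carrier ?Q"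
      by (intro cls_closed W w)
    have "delta (p, us @ (c \<odot>\<^bsub>Q\<^esub> q) # vs) - (\<lambda>w. c * delta (p, us @ q # vs) w) \<in> multilinear_rels P Q n"
      unfolding multilinear_rels_def using w by blast
    then show "cls (p, us @ (c \<odot>\<^bsub>Q\<^esub> q) # vs) = c \<odot>\<^bsub>?Q\<^esub> cls (p, us @ q # vs)"
      by (intro cls_scale_rel R W w words_closed(6))
    assume q': "q' \<in> carrier Q"
    have "delta (p, us @ (q \<oplus>\<^bsub>Q\<^esub> q') # vs) - delta (p, us @ q # vs) - delta (p, us @ q' # vs)
        \<in> multilinear_rels P Q n"
      unfolding multilinear_rels_def using w q' by blast
    then show "cls (p, us @ (q \<oplus>\<^bsub>Q\<^esub> q') # vs) = cls (p, us @ q # vs) \<oplus>\<^bsub>?Q\<^esub> cls (p, us @ q' # vs)"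
      by (intro cls_add_rel R W w words_closed(4,5)[OF w q'])
  qed
qed

lemma multilinear_cong:
  assumes "multilinear P Q n M g" "\<And>p qs. (p, qs) \<in> words P Q n \<Longrightarrow> g (p, qs) = g' (p, qs)"
  shows "multilinear P Q n M g'"
  unfolding multilinear_def
proof (intro conjI allI impI)
  fix qs assume qs: "set qs \<subseteq> carrier Q \<and> length qs = n"
  then have "lin_map P M (\<lambda>p. g (p, qs))"
    using assms(1) unfolding multilinear_def by blast
  then show "lin_map P M (\<lambda>p. g' (p, qs))"
    by (rule lin_map_cong) (use assms(2) qs P.cspace_axioms in \<open>simp_all add: words_iff\<close>)
next
  fix p us vs
  assume *: "p \<in> carrier P \<and> set us \<subseteq> carrier Q \<and> set vs \<subseteq> carrier Q \<and> n = length us + length vs + 1"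
  then have "lin_map Q M (\<lambda>q. g (p, us @ q # vs))"
    using assms(1) unfolding multilinear_def by blast
  then show "lin_map Q M (\<lambda>q. g' (p, us @ q # vs))"
    by (rule lin_map_cong) (use assms(2) * Q.cspace_axioms in \<open>simp_all add: words_iff\<close>)
qed

lemma multilinear_tens: "multilinear P Q n (mtensor P Q n) (\<lambda>(p, qs). tens P Q p qs)"
  unfolding mtensor_def
  by (rule multilinear_cong[OF multilinear_cls[OF pres]]) (simp_all add: tens_eq)

lemma words_1: "(p, qs) \<in> words P Q 1 \<longleftrightarrow> p \<in> carrier P \<and> (\<exists>q\<in>carrier Q. qs = [q])"
  by (auto simp: words_iff length_Suc_conv One_nat_def)

lemma tens_1_closed [simp, intro]:
  "p \<in> carrier P \<Longrightarrow> q \<in> carrier Q \<Longrightarrow> tens P Q p [q] \<in> carrier (mtensor P Q 1)"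
  by (rule tens_closed) (simp add: words_iff)

lemma tens_bilinear: "bilinear P Q (mtensor P Q 1) (\<lambda>p q. tens P Q p [q])"
proof (rule bilinearI)
  note * = multilinear_tens[of 1, unfolded multilinear_def split_conv]
  show "lin_map P (mtensor P Q 1) (\<lambda>p. tens P Q p [q])" if "q \<in> carrier Q" for q
    using conjunct1[OF *, rule_format, of "[q]"] that by simp
  show "lin_map Q (mtensor P Q 1) (\<lambda>q. tens P Q p [q])" if "p \<in> carrier P" for p
    using conjunct2[OF *, rule_format, of p "[]" "[]"] that by simp
qed

lemma lift_1:
  assumes "cspace M" "bilinear P Q M (\<lambda>p q. g (p, [q]))"
  shows "lin_map (mtensor P Q 1) M (quot_lift M g)"
    and "p \<in> carrier P \<Longrightarrow> q \<in> carrier Q \<Longrightarrow> quot_lift M g (tens P Q p [q]) = g (p, [q])"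
  using mtensor_lift[OF assms(1) multilinear_1I[OF assms(2)]] by (simp_all add: words_1)

lemma lin_map_eq_1:
  assumes "cspace M" "lin_map (mtensor P Q 1) M f" "lin_map (mtensor P Q 1) M g"
    and "\<And>p q. p \<in> carrier P \<Longrightarrow> q \<in> carrier Q \<Longrightarrow> f (tens P Q p [q]) = g (tens P Q p [q])"
    and "X \<in> carrier (mtensor P Q 1)"
  shows "f X = g X"
  by (rule mtensor_lin_map_eq[OF assms(1-3) _ assms(5)]) (auto simp only: words_1 assms(4))

end


section \<open>Bimodules\<close>

sublocale calgebra \<subseteq> cspace A
  by unfold_locales

lemma with_actions_simps [simp]:
  "carrier (with_actions M l r) = carrier M" "zero (with_actions M l r) = zero M"
  "add (with_actions M l r) = add M" "smult (with_actions M l r) = smult M"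
  "lact (with_actions M l r) = l" "ract (with_actions M l r) = r"
  by (cases M; simp add: with_actions_def module.extend_def bimodule.fields_def)+

lemma cspace_cong:
  assumes "cspace M" "carrier N = carrier M" "add N = add M" "zero N = zero M" "smult N = smult M"
  shows "cspace N"
proof -
  interpret cspace M by fact
  show ?thesis
    by (rule cspaceI)
      (simp_all add: assms a_ac scale_add_left scale_add_right scale_scale)
qed

lemma cspace_with_actions: "cspace M \<Longrightarrow> cspace (with_actions M l r)"
  by (erule cspace_cong) simp_all

lemma lin_map_with_actions [simp]:
  "lin_map (with_actions M l r) N f \<longleftrightarrow> lin_map M N f"
  "lin_map N' (with_actions M l r) g \<longleftrightarrow> lin_map N' M g"
  by (simp_all add: lin_map_def)

lemma bilinear_with_actions [simp]:
  "bilinear (with_actions M l r) N P f \<longleftrightarrow> bilinear M N P f"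
  "bilinear N' (with_actions M l r) P' g \<longleftrightarrow> bilinear N' M P' g"
  "bilinear N'' P'' (with_actions M l r) h \<longleftrightarrow> bilinear N'' P'' M h"
  by (simp_all add: bilinear_def)

lemma a_minus_with_actions [simp]: "a_minus (with_actions M l r) = a_minus M"
  by (simp add: a_minus_def a_inv_def m_inv_def fun_eq_iff)

lemma (in calgebra) lin_mult:
  "a \<in> carrier A \<Longrightarrow> lin_map A A (\<lambda>x. a \<otimes> x)" "a \<in> carrier A \<Longrightarrow> lin_map A A (\<lambda>x. x \<otimes> a)"
  by (simp_all add: lin_map_def l_distr r_distr smult_mult_left smult_mult_right)

lemma (in calgebra) bilinear_mult: "bilinear A A A (\<otimes>)"
  by (simp add: bilinear_def lin_mult)

text \<open>The constructions of double derivations and of the tensor algebra take records without further fields.\<close>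

locale calg = calgebra A for A :: "(complex, 'a) module" (structure)

locale cbimod = A: calg A + M: cspace M
  for A :: "(complex, 'a) module" and M :: "('a, 'm) bimodule" +
  assumes lact_bilinear: "bilinear A M M (lact M)"
    and ract_bilinear: "bilinear M A M (ract M)"
    and lact_mult: "\<lbrakk>a \<in> carrier A; b \<in> carrier A; m \<in> carrier M\<rbrakk> \<Longrightarrow>
      lact M (a \<otimes>\<^bsub>A\<^esub> b) m = lact M a (lact M b m)"
    and lact_one: "m \<in> carrier M \<Longrightarrow> lact M \<one>\<^bsub>A\<^esub> m = m"
    and ract_mult: "\<lbrakk>a \<in> carrier A; b \<in> carrier A; m \<in> carrier M\<rbrakk> \<Longrightarrow>
      ract M m (a \<otimes>\<^bsub>A\<^esub> b) = ract M (ract M m a) b"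
    and ract_one: "m \<in> carrier M \<Longrightarrow> ract M m \<one>\<^bsub>A\<^esub> = m"
    and lact_ract: "\<lbrakk>a \<in> carrier A; b \<in> carrier A; m \<in> carrier M\<rbrakk> \<Longrightarrow>
      lact M a (ract M m b) = ract M (lact M a m) b"
begin

lemmas lin_lact = bilinearD(1)[OF lact_bilinear] and lin_lact' = bilinearD(2)[OF lact_bilinear]
lemmas lin_ract = bilinearD(2)[OF ract_bilinear] and lin_ract' = bilinearD(1)[OF ract_bilinear]

lemma lact_simps:
  assumes "a \<in> carrier A" "m \<in> carrier M"
  shows "lact M a m \<in> carrier M"
    "n \<in> carrier M \<Longrightarrow> lact M a (m \<oplus>\<^bsub>M\<^esub> n) = lact M a m \<oplus>\<^bsub>M\<^esub> lact M a n"
    "lact M a (c \<odot>\<^bsub>M\<^esub> m) = c \<odot>\<^bsub>M\<^esub> lact M a m"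
    "b \<in> carrier A \<Longrightarrow> lact M (a \<oplus>\<^bsub>A\<^esub> b) m = lact M a m \<oplus>\<^bsub>M\<^esub> lact M b m"
    "lact M (c \<odot>\<^bsub>A\<^esub> a) m = c \<odot>\<^bsub>M\<^esub> lact M a m"
  using lin_mapD[OF lin_lact[OF assms(1)]] lin_mapD[OF lin_lact'[OF assms(2)]] assms by simp_all

lemma ract_simps:
  assumes "a \<in> carrier A" "m \<in> carrier M"
  shows "ract M m a \<in> carrier M"
    "n \<in> carrier M \<Longrightarrow> ract M (m \<oplus>\<^bsub>M\<^esub> n) a = ract M m a \<oplus>\<^bsub>M\<^esub> ract M n a"
    "ract M (c \<odot>\<^bsub>M\<^esub> m) a = c \<odot>\<^bsub>M\<^esub> ract M m a"
    "b \<in> carrier A \<Longrightarrow> ract M m (a \<oplus>\<^bsub>A\<^esub> b) = ract M m a \<oplus>\<^bsub>M\<^esub> ract M m b"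
    "ract M m (c \<odot>\<^bsub>A\<^esub> a) = c \<odot>\<^bsub>M\<^esub> ract M m a"
  using lin_mapD[OF lin_ract[OF assms(1)]] lin_mapD[OF lin_ract'[OF assms(2)]] assms by simp_all

end

lemma cbimodI:
  assumes "calgebra A" "cspace M" "bilinear A M M (lact M)" "bilinear M A M (ract M)"
    and "\<And>a b m. \<lbrakk>a \<in> carrier A; b \<in> carrier A; m \<in> carrier M\<rbrakk> \<Longrightarrow>
      lact M (a \<otimes>\<^bsub>A\<^esub> b) m = lact M a (lact M b m)"
    and "\<And>m. m \<in> carrier M \<Longrightarrow> lact M \<one>\<^bsub>A\<^esub> m = m"
    and "\<And>a b m. \<lbrakk>a \<in> carrier A; b \<in> carrier A; m \<in> carrier M\<rbrakk> \<Longrightarrow>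
      ract M m (a \<otimes>\<^bsub>A\<^esub> b) = ract M (ract M m a) b"
    and "\<And>m. m \<in> carrier M \<Longrightarrow> ract M m \<one>\<^bsub>A\<^esub> = m"
    and "\<And>a b m. \<lbrakk>a \<in> carrier A; b \<in> carrier A; m \<in> carrier M\<rbrakk> \<Longrightarrow>
      lact M a (ract M m b) = ract M (lact M a m) b"
  shows "cbimod A M"
  using assms by (simp add: cbimod_def cbimod_axioms_def calg_def)

definition bimod_hom ::
    "(complex, 'a) module \<Rightarrow> ('a, 'm) bimodule \<Rightarrow> ('a, 'n) bimodule \<Rightarrow> ('m \<Rightarrow> 'n) \<Rightarrow> bool" where
  "bimod_hom A M N f \<longleftrightarrow> lin_map M N f \<and>
     (\<forall>a\<in>carrier A. \<forall>m\<in>carrier M. f (lact M a m) = lact N a (f m)) \<and>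
     (\<forall>a\<in>carrier A. \<forall>m\<in>carrier M. f (ract M m a) = ract N (f m) a)"

lemma bimod_homI:
  assumes "lin_map M N f"
    and "\<And>a m. a \<in> carrier A \<Longrightarrow> m \<in> carrier M \<Longrightarrow> f (lact M a m) = lact N a (f m)"
    and "\<And>a m. a \<in> carrier A \<Longrightarrow> m \<in> carrier M \<Longrightarrow> f (ract M m a) = ract N (f m) a"
  shows "bimod_hom A M N f"
  using assms by (simp add: bimod_hom_def)

lemma bimod_homD:
  assumes "bimod_hom A M N f"
  shows "lin_map M N f"
    and "a \<in> carrier A \<Longrightarrow> m \<in> carrier M \<Longrightarrow> f (lact M a m) = lact N a (f m)"
    and "a \<in> carrier A \<Longrightarrow> m \<in> carrier M \<Longrightarrow> f (ract M m a) = ract N (f m) a"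
  using assms by (simp_all add: bimod_hom_def)


section \<open>The two bimodule structures on A \<otimes> A\<close>

context calg
begin

sublocale AA: tensor A A
  by (simp add: tensor_def cspace_axioms)

abbreviation "A2 \<equiv> mtensor A A 1"
abbreviation tens2 (infix "\<otimes>\<otimes>" 75) where "x \<otimes>\<otimes> y \<equiv> tens A A x [y]"

sublocale A2: cspace A2
  by (rule AA.cspace_mtensor)

text \<open>The endomorphism \<open>f \<otimes> g\<close> of \<open>A \<otimes> A\<close>. All four one-sided actions on \<open>A \<otimes> A\<close> are of this
form, and so their axioms and the commutation of the inner with the outer structure follow from
\<open>tmap_comp_eq\<close> and \<open>tmap_comm\<close>.\<close>

definition tmap :: "('a \<Rightarrow> 'a) \<Rightarrow> ('a \<Rightarrow> 'a) \<Rightarrow>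
    ('a \<times> 'a list \<Rightarrow> complex) set \<Rightarrow> ('a \<times> 'a list \<Rightarrow> complex) set" where
  "tmap f g = quot_lift A2 (\<lambda>(x, ys). f x \<otimes>\<otimes> g (hd ys))"

lemma tmap:
  assumes "lin_map A A f" "lin_map A A g"
  shows "lin_map A2 A2 (tmap f g)"
    and "x \<in> carrier A \<Longrightarrow> y \<in> carrier A \<Longrightarrow> tmap f g (x \<otimes>\<otimes> y) = f x \<otimes>\<otimes> g y"
proof -
  have b: "bilinear A A A2 (\<lambda>x y. f x \<otimes>\<otimes> g y)"
    by (intro bilinearI lin_map_comp[OF assms(1) bilinearD(2)[OF AA.tens_bilinear]]
        lin_map_comp[OF assms(2) bilinearD(1)[OF AA.tens_bilinear]]
        lin_mapD(1)[OF assms(1)] lin_mapD(1)[OF assms(2)])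
  show "lin_map A2 A2 (tmap f g)"
    "x \<in> carrier A \<Longrightarrow> y \<in> carrier A \<Longrightarrow> tmap f g (x \<otimes>\<otimes> y) = f x \<otimes>\<otimes> g y"
    unfolding tmap_def using AA.lift_1[OF A2.cspace_axioms, of "\<lambda>(x, ys). f x \<otimes>\<otimes> g (hd ys)"] b
    by simp_all
qed

lemma tmap_comp:
  assumes "lin_map A A f" "lin_map A A g" "lin_map A A f'" "lin_map A A g'" "X \<in> carrier A2"
  shows "tmap f g (tmap f' g' X) = tmap (\<lambda>x. f (f' x)) (\<lambda>x. g (g' x)) X"
proof (rule AA.lin_map_eq_1[OF A2.cspace_axioms _ _ _ assms(5)])
  note comp = lin_map_comp[OF assms(3,1)] lin_map_comp[OF assms(4,2)]
  show "lin_map A2 A2 (\<lambda>X. tmap f g (tmap f' g' X))"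
    by (rule lin_map_comp[OF tmap(1)[OF assms(3,4)] tmap(1)[OF assms(1,2)]])
  show "lin_map A2 A2 (tmap (\<lambda>x. f (f' x)) (\<lambda>x. g (g' x)))"
    by (rule tmap(1)[OF comp])
  fix x y assume "x \<in> carrier A" "y \<in> carrier A"
  then show "tmap f g (tmap f' g' (x \<otimes>\<otimes> y)) = tmap (\<lambda>x. f (f' x)) (\<lambda>x. g (g' x)) (x \<otimes>\<otimes> y)"
    by (simp add: tmap(2)[OF comp] tmap(2)[OF assms(1,2)] tmap(2)[OF assms(3,4)]
        lin_mapD(1)[OF assms(3)] lin_mapD(1)[OF assms(4)])
qed

lemma tmap_id:
  assumes "X \<in> carrier A2" "\<And>x. x \<in> carrier A \<Longrightarrow> f x = x" "\<And>x. x \<in> carrier A \<Longrightarrow> g x = x"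
  shows "tmap f g X = X"
proof -
  have fg: "lin_map A A f" "lin_map A A g"
    using assms(2,3) by (simp_all add: lin_map_def)
  show ?thesis
    by (rule AA.lin_map_eq_1[OF A2.cspace_axioms _ _ _ assms(1)])
      (simp_all add: tmap fg lin_map_id assms)
qed

lemma tmap_cong:
  assumes "X \<in> carrier A2" "lin_map A A f" "lin_map A A g"
    and "\<And>x. x \<in> carrier A \<Longrightarrow> f x = f' x" "\<And>x. x \<in> carrier A \<Longrightarrow> g x = g' x"
  shows "tmap f g X = tmap f' g' X"
proof -
  have fg: "lin_map A A f'" "lin_map A A g'"
    using lin_map_cong[OF assms(2)] lin_map_cong[OF assms(3)] assms(4,5) cspace_axioms by auto
  show ?thesis
    by (rule AA.lin_map_eq_1[OF A2.cspace_axioms _ _ _ assms(1)])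
      (simp_all add: tmap fg assms(2-5))
qed

lemma tmap_comp_eq:
  assumes "lin_map A A f" "lin_map A A g" "lin_map A A f'" "lin_map A A g'" "X \<in> carrier A2"
    and "\<And>x. x \<in> carrier A \<Longrightarrow> f (f' x) = h x" "\<And>x. x \<in> carrier A \<Longrightarrow> g (g' x) = k x"
  shows "tmap f g (tmap f' g' X) = tmap h k X"
  unfolding tmap_comp[OF assms(1-5)]
  by (rule tmap_cong[OF assms(5)]) (auto intro: lin_map_comp[OF assms(3,1)]
      lin_map_comp[OF assms(4,2)] assms(6,7))

lemma tmap_comm:
  assumes "lin_map A A f" "lin_map A A g" "lin_map A A f'" "lin_map A A g'" "X \<in> carrier A2"
    and "\<And>x. x \<in> carrier A \<Longrightarrow> f (f' x) = f' (f x)" "\<And>x. x \<in> carrier A \<Longrightarrow> g (g' x) = g' (g x)"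
  shows "tmap f g (tmap f' g' X) = tmap f' g' (tmap f g X)"
  unfolding tmap_comp[OF assms(3,4,1,2,5)] 
  by (rule tmap_comp_eq[OF assms(1-5)]; rule assms(6,7), assumption)

lemma bilinear_tmap_left:
  assumes "bilinear A A A b" "lin_map A A g"
  shows "bilinear A A2 A2 (\<lambda>a. tmap (b a) g)"
proof (rule bilinearI)
  fix a assume "a \<in> carrier A"
  then show "lin_map A2 A2 (tmap (b a) g)"
    by (intro tmap(1) bilinearD(1)[OF assms(1)] assms(2))
next
  fix X assume X: "X \<in> carrier A2"
  have l: "lin_map A2 A2 (tmap (b a) g)" if "a \<in> carrier A" for a
    by (intro tmap(1) bilinearD(1)[OF assms(1)] assms(2) that)
  note tens = bilinearD(2)[OF AA.tens_bilinear] and bl = bilinearD[OF assms(1)]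
  note tens_add = lin_mapD(2)[OF tens] and tens_scale = lin_mapD(3)[OF tens]
  note b_add = lin_mapD(2)[OF bl(2)] and b_scale = lin_mapD(3)[OF bl(2)]
  note b_closed = lin_mapD(1)[OF bl(1)] and g_closed = lin_mapD(1)[OF assms(2)]
  show "lin_map A A2 (\<lambda>a. tmap (b a) g X)"
  proof (rule lin_mapI)
    fix a assume a: "a \<in> carrier A"
    then show "tmap (b a) g X \<in> carrier A2"
      by (rule lin_mapD(1)[OF l X])
    show "tmap (b (c \<odot> a)) g X = c \<odot>\<^bsub>A2\<^esub> tmap (b a) g X" for c
      by (rule AA.lin_map_eq_1[OF A2.cspace_axioms _ _ _ X])
        (use a in \<open>simp_all add: l lin_map_scale A2.cspace_axioms tmap(2)[OF bl(1) assms(2)] b_scale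
          tens_scale b_closed g_closed\<close>)
    fix a' assume a': "a' \<in> carrier A"
    show "tmap (b (a \<oplus> a')) g X = tmap (b a) g X \<oplus>\<^bsub>A2\<^esub> tmap (b a') g X"
      by (rule AA.lin_map_eq_1[OF A2.cspace_axioms _ _ _ X])
        (use a a' in \<open>simp_all add: l lin_map_add A2.cspace_axioms tmap(2)[OF bl(1) assms(2)] b_add
          tens_add b_closed g_closed\<close>)
  qed
qed

lemma bilinear_tmap_right:
  assumes "bilinear A A A b" "lin_map A A g"
  shows "bilinear A A2 A2 (\<lambda>a. tmap g (b a))"
proof (rule bilinearI)
  fix a assume "a \<in> carrier A"
  then show "lin_map A2 A2 (tmap g (b a))"
    by (intro tmap(1) bilinearD(1)[OF assms(1)] assms(2))
next
  fix X assume X: "X \<in> carrier A2"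
  have l: "lin_map A2 A2 (tmap g (b a))" if "a \<in> carrier A" for a
    by (intro tmap(1) bilinearD(1)[OF assms(1)] assms(2) that)
  note tens = bilinearD(1)[OF AA.tens_bilinear] and bl = bilinearD[OF assms(1)]
  note tens_add = lin_mapD(2)[OF tens] and tens_scale = lin_mapD(3)[OF tens]
  note b_add = lin_mapD(2)[OF bl(2)] and b_scale = lin_mapD(3)[OF bl(2)]
  note b_closed = lin_mapD(1)[OF bl(1)] and g_closed = lin_mapD(1)[OF assms(2)]
  show "lin_map A A2 (\<lambda>a. tmap g (b a) X)"
  proof (rule lin_mapI)
    fix a assume a: "a \<in> carrier A"
    then show "tmap g (b a) X \<in> carrier A2"
      by (rule lin_mapD(1)[OF l X])
    show "tmap g (b (c \<odot> a)) X = c \<odot>\<^bsub>A2\<^esub> tmap g (b a) X" for c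
      by (rule AA.lin_map_eq_1[OF A2.cspace_axioms _ _ _ X])
        (use a in \<open>simp_all add: l lin_map_scale A2.cspace_axioms tmap(2)[OF assms(2) bl(1)] b_scale
          tens_scale b_closed g_closed\<close>)
    fix a' assume a': "a' \<in> carrier A"
    show "tmap g (b (a \<oplus> a')) X = tmap g (b a) X \<oplus>\<^bsub>A2\<^esub> tmap g (b a') X"
      by (rule AA.lin_map_eq_1[OF A2.cspace_axioms _ _ _ X])
        (use a a' in \<open>simp_all add: l lin_map_add A2.cspace_axioms tmap(2)[OF assms(2) bl(1)] b_add
          tens_add b_closed g_closed\<close>)
  qed
qed

lemma bilinear_swap: "bilinear P Q M b \<Longrightarrow> bilinear Q P M (\<lambda>q p. b p q)"
  by (simp add: bilinear_def)

lemma outer_simps: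
  "lact (outer_bimodule A) a = tmap (\<lambda>x. a \<otimes> x) (\<lambda>y. y)"
  "ract (outer_bimodule A) X a = tmap (\<lambda>x. x) (\<lambda>y. y \<otimes> a) X"
  by (simp_all add: outer_bimodule_def tmap_def)

lemma inner_simps:
  "lact (inner_bimodule A) a = tmap (\<lambda>x. x) (\<lambda>y. a \<otimes> y)"
  "ract (inner_bimodule A) X a = tmap (\<lambda>x. x \<otimes> a) (\<lambda>y. y) X"
  by (simp_all add: inner_bimodule_def tmap_def)

lemma outer_inner_fields [simp]:
  "carrier (outer_bimodule A) = carrier A2" "carrier (inner_bimodule A) = carrier A2"
  "zero (outer_bimodule A) = zero A2" "zero (inner_bimodule A) = zero A2"
  "add (outer_bimodule A) = add A2" "add (inner_bimodule A) = add A2"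
  "smult (outer_bimodule A) = smult A2" "smult (inner_bimodule A) = smult A2"
  by (simp_all add: outer_bimodule_def inner_bimodule_def)

lemma cbimod_outer: "cbimod A (outer_bimodule A)"
proof (rule cbimodI)
  note lin = lin_mult lin_map_id
  have [simp]: "bilinear A (outer_bimodule A) (outer_bimodule A) f = bilinear A A2 A2 f"
    "bilinear (outer_bimodule A) A (outer_bimodule A) g = bilinear A2 A A2 g" for f g
    by (simp_all add: outer_bimodule_def)
  show "calgebra A" "cspace (outer_bimodule A)"
    using calgebra_axioms cspace_with_actions[OF A2.cspace_axioms]
    by (simp_all add: outer_bimodule_def)
  show "bilinear A (outer_bimodule A) (outer_bimodule A) (lact (outer_bimodule A))"
    unfolding outer_simps using bilinear_tmap_left[OF bilinear_mult lin_map_id] by simp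
  show "bilinear (outer_bimodule A) A (outer_bimodule A) (ract (outer_bimodule A))"
    using bilinear_swap[OF bilinear_tmap_right[OF bilinear_swap[OF bilinear_mult] lin_map_id]]
    by (simp add: outer_simps[abs_def] flip: eta_contract_eq)
  fix a b X assume a: "a \<in> carrier A" "b \<in> carrier A" and "X \<in> carrier (outer_bimodule A)"
  then have X: "X \<in> carrier A2" by simp
  show "lact (outer_bimodule A) (a \<otimes> b) X = lact (outer_bimodule A) a (lact (outer_bimodule A) b X)"
    unfolding outer_simps using a X
    by (intro tmap_comp_eq[symmetric]) (simp_all add: lin m_assoc)
  show "ract (outer_bimodule A) X (a \<otimes> b) = ract (outer_bimodule A) (ract (outer_bimodule A) X a) b"
    unfolding outer_simps using a X
    by (intro tmap_comp_eq[symmetric]) (simp_all add: lin m_assoc)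
  show "lact (outer_bimodule A) a (ract (outer_bimodule A) X b) =
      ract (outer_bimodule A) (lact (outer_bimodule A) a X) b"
    unfolding outer_simps using a X by (intro tmap_comm) (simp_all add: lin)
next
  fix X assume "X \<in> carrier (outer_bimodule A)"
  then show "lact (outer_bimodule A) \<one> X = X" "ract (outer_bimodule A) X \<one> = X"
    unfolding outer_simps by (intro tmap_id; simp)+
qed

lemma cbimod_inner: "cbimod A (inner_bimodule A)"
proof (rule cbimodI)
  note lin = lin_mult lin_map_id
  have [simp]: "bilinear A (inner_bimodule A) (inner_bimodule A) f = bilinear A A2 A2 f"
    "bilinear (inner_bimodule A) A (inner_bimodule A) g = bilinear A2 A A2 g" for f g
    by (simp_all add: inner_bimodule_def)
  show "calgebra A" "cspace (inner_bimodule A)"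
    using calgebra_axioms cspace_with_actions[OF A2.cspace_axioms]
    by (simp_all add: inner_bimodule_def)
  show "bilinear A (inner_bimodule A) (inner_bimodule A) (lact (inner_bimodule A))"
    unfolding inner_simps using bilinear_tmap_right[OF bilinear_mult lin_map_id] by simp
  show "bilinear (inner_bimodule A) A (inner_bimodule A) (ract (inner_bimodule A))"
    using bilinear_swap[OF bilinear_tmap_left[OF bilinear_swap[OF bilinear_mult] lin_map_id]]
    by (simp add: inner_simps[abs_def])
  fix a b X assume a: "a \<in> carrier A" "b \<in> carrier A" and "X \<in> carrier (inner_bimodule A)"
  then have X: "X \<in> carrier A2" by simp
  show "lact (inner_bimodule A) (a \<otimes> b) X = lact (inner_bimodule A) a (lact (inner_bimodule A) b X)"
    unfolding inner_simps using a X
    by (intro tmap_comp_eq[symmetric]) (simp_all add: lin m_assoc)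
  show "ract (inner_bimodule A) X (a \<otimes> b) = ract (inner_bimodule A) (ract (inner_bimodule A) X a) b"
    unfolding inner_simps using a X
    by (intro tmap_comp_eq[symmetric]) (simp_all add: lin m_assoc)
  show "lact (inner_bimodule A) a (ract (inner_bimodule A) X b) =
      ract (inner_bimodule A) (lact (inner_bimodule A) a X) b"
    unfolding inner_simps using a X by (intro tmap_comm) (simp_all add: lin)
next
  fix X assume "X \<in> carrier (inner_bimodule A)"
  then show "lact (inner_bimodule A) \<one> X = X" "ract (inner_bimodule A) X \<one> = X"
    unfolding inner_simps by (intro tmap_id; simp)+
qed

lemma inner_outer_commute:
  assumes "a \<in> carrier A" "b \<in> carrier A" "X \<in> carrier A2"
  shows "lact (inner_bimodule A) a (lact (outer_bimodule A) b X) =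
      lact (outer_bimodule A) b (lact (inner_bimodule A) a X)"
    "lact (inner_bimodule A) a (ract (outer_bimodule A) X b) =
      ract (outer_bimodule A) (lact (inner_bimodule A) a X) b"
    "ract (inner_bimodule A) (lact (outer_bimodule A) b X) a =
      lact (outer_bimodule A) b (ract (inner_bimodule A) X a)"
    "ract (inner_bimodule A) (ract (outer_bimodule A) X b) a =
      ract (outer_bimodule A) (ract (inner_bimodule A) X a) b"
  unfolding inner_simps outer_simps using assms
  by (intro tmap_comm; simp add: lin_mult lin_map_id m_assoc)+

end


section \<open>Double derivations\<close>

lemma mem_derivations_iff:
  "d \<in> derivations A M \<longleftrightarrow> d \<in> extensional (carrier A) \<and> lin_map A M d \<and>
    (\<forall>x\<in>carrier A. \<forall>y\<in>carrier A. d (x \<otimes>\<^bsub>A\<^esub> y) = lact M x (d y) \<oplus>\<^bsub>M\<^esub> ract M (d x) y)"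
  by (auto simp: derivations_def lin_map_def PiE_iff)

lemma derivations_eqI:
  assumes "d \<in> derivations A M" "e \<in> derivations A M" "\<And>x. x \<in> carrier A \<Longrightarrow> d x = e x"
  shows "d = e"
  using assms by (intro extensionalityI[of d "carrier A" e]) (auto simp: mem_derivations_iff)

context cbimod
begin

lemma derivation_add:
  assumes "d \<in> derivations A M" "e \<in> derivations A M"
  shows "(\<lambda>x\<in>carrier A. d x \<oplus>\<^bsub>M\<^esub> e x) \<in> derivations A M"
proof -
  have de: "lin_map A M d" "lin_map A M e"
    using assms by (simp_all add: mem_derivations_iff)
  have c: "d x \<in> carrier M" "e x \<in> carrier M" if "x \<in> carrier A" for x
    using lin_mapD(1)[OF de(1) that] lin_mapD(1)[OF de(2) that] .
  have "lin_map A M (\<lambda>x\<in>carrier A. d x \<oplus>\<^bsub>M\<^esub> e x)"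
    by (rule lin_map_cong[OF lin_map_add[OF A.cspace_axioms M.cspace_axioms de]])
      (simp_all add: A.cspace_axioms)
  moreover have "d (x \<otimes>\<^bsub>A\<^esub> y) \<oplus>\<^bsub>M\<^esub> e (x \<otimes>\<^bsub>A\<^esub> y) =
      lact M x (d y \<oplus>\<^bsub>M\<^esub> e y) \<oplus>\<^bsub>M\<^esub> ract M (d x \<oplus>\<^bsub>M\<^esub> e x) y"
    if "x \<in> carrier A" "y \<in> carrier A" for x y
    using assms that c by (simp add: mem_derivations_iff lact_simps ract_simps M.a_ac)
  ultimately show ?thesis
    by (simp add: mem_derivations_iff)
qed

lemma derivation_scale:
  assumes "d \<in> derivations A M"
  shows "(\<lambda>x\<in>carrier A. c \<odot>\<^bsub>M\<^esub> d x) \<in> derivations A M"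
proof -
  have d: "lin_map A M d"
    using assms by (simp_all add: mem_derivations_iff)
  have c: "d x \<in> carrier M" if "x \<in> carrier A" for x
    using lin_mapD(1)[OF d that] .
  have "lin_map A M (\<lambda>x\<in>carrier A. c \<odot>\<^bsub>M\<^esub> d x)"
    by (rule lin_map_cong[OF lin_map_scale[OF A.cspace_axioms M.cspace_axioms d]])
      (simp_all add: A.cspace_axioms)
  moreover have "c \<odot>\<^bsub>M\<^esub> d (x \<otimes>\<^bsub>A\<^esub> y) = lact M x (c \<odot>\<^bsub>M\<^esub> d y) \<oplus>\<^bsub>M\<^esub> ract M (c \<odot>\<^bsub>M\<^esub> d x) y"
    if "x \<in> carrier A" "y \<in> carrier A" for x y
    using assms that c by (simp add: mem_derivations_iff lact_simps ract_simps M.scale_add_right)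
  ultimately show ?thesis
    by (simp add: mem_derivations_iff)
qed

lemma derivation_zero: "(\<lambda>x\<in>carrier A. \<zero>\<^bsub>M\<^esub>) \<in> derivations A M"
proof -
  have "lact M x \<zero>\<^bsub>M\<^esub> = \<zero>\<^bsub>M\<^esub>" "ract M \<zero>\<^bsub>M\<^esub> x = \<zero>\<^bsub>M\<^esub>" if "x \<in> carrier A" for x
    using lact_simps(3)[OF that M.zero_closed, of 0] ract_simps(3)[OF that M.zero_closed, of 0]
      lact_simps(1)[OF that M.zero_closed] ract_simps(1)[OF that M.zero_closed] by simp_all
  then show ?thesis
    by (simp add: mem_derivations_iff lin_map_def)
qed

end

context calg
begin

interpretation O: cbimod A "outer_bimodule A" by (rule cbimod_outer)
interpretation I: cbimod A "inner_bimodule A" by (rule cbimod_inner)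

abbreviation "D \<equiv> double_der A"

lemma double_der_simps:
  "carrier D = derivations A (outer_bimodule A)"
  "\<zero>\<^bsub>D\<^esub> = (\<lambda>x\<in>carrier A. \<zero>\<^bsub>A2\<^esub>)"
  "d \<oplus>\<^bsub>D\<^esub> e = (\<lambda>x\<in>carrier A. d x \<oplus>\<^bsub>A2\<^esub> e x)"
  "c \<odot>\<^bsub>D\<^esub> d = (\<lambda>x\<in>carrier A. c \<odot>\<^bsub>A2\<^esub> d x)"
  "lact D a d = (\<lambda>x\<in>carrier A. lact (inner_bimodule A) a (d x))"
  "ract D d a = (\<lambda>x\<in>carrier A. ract (inner_bimodule A) (d x) a)"
  by (simp_all add: double_der_def)

lemma double_der_lin: "d \<in> carrier D \<Longrightarrow> lin_map A A2 d"
  by (simp add: double_der_simps mem_derivations_iff lin_map_def)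

lemma double_der_closed: "d \<in> carrier D \<Longrightarrow> x \<in> carrier A \<Longrightarrow> d x \<in> carrier A2"
  by (rule lin_mapD(1)[OF double_der_lin])

lemma double_der_mult: "d \<in> carrier D \<Longrightarrow> x \<in> carrier A \<Longrightarrow> y \<in> carrier A \<Longrightarrow>
    d (x \<otimes> y) = lact (outer_bimodule A) x (d y) \<oplus>\<^bsub>A2\<^esub> ract (outer_bimodule A) (d x) y"
  by (simp add: double_der_simps mem_derivations_iff)

lemma double_der_eqI:
  assumes "d \<in> carrier D" "e \<in> carrier D" "\<And>x. x \<in> carrier A \<Longrightarrow> d x = e x"
  shows "d = e"
  using derivations_eqI assms unfolding double_der_simps by blast

text \<open>The inner actions commute with the outer ones, so composing an outer derivation with them gives an
outer derivation again.\<close>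

lemma double_der_act_closed:
  assumes "a \<in> carrier A" "d \<in> carrier D"
  shows "lact D a d \<in> carrier D" "ract D d a \<in> carrier D"
proof -
  note d = double_der_lin[OF assms(2)]
  note c = double_der_closed[OF assms(2)]
  have l: "lin_map A2 A2 (lact (inner_bimodule A) a)"
    "lin_map A2 A2 (\<lambda>X. ract (inner_bimodule A) X a)"
    using I.lin_lact[OF assms(1)] I.lin_ract[OF assms(1)] by (simp_all add: lin_map_def)
  have "lin_map A A2 (lact D a d)"
    by (rule lin_map_cong[OF lin_map_comp[OF d l(1)] _ cspace_axioms]) (simp add: double_der_simps)
  moreover have "lin_map A A2 (ract D d a)"
    by (rule lin_map_cong[OF lin_map_comp[OF d l(2)] _ cspace_axioms]) (simp add: double_der_simps)
  moreover have "lact (inner_bimodule A) a (d (x \<otimes> y)) =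
      lact (outer_bimodule A) x (lact (inner_bimodule A) a (d y)) \<oplus>\<^bsub>A2\<^esub>
      ract (outer_bimodule A) (lact (inner_bimodule A) a (d x)) y"
    "ract (inner_bimodule A) (d (x \<otimes> y)) a =
      lact (outer_bimodule A) x (ract (inner_bimodule A) (d y) a) \<oplus>\<^bsub>A2\<^esub>
      ract (outer_bimodule A) (ract (inner_bimodule A) (d x) a) y"
    if xy: "x \<in> carrier A" "y \<in> carrier A" for x y
  proof -
    note oc = O.lact_simps(1)[OF xy(1), of "d y"] O.ract_simps(1)[OF xy(2), of "d x"]
    show "lact (inner_bimodule A) a (d (x \<otimes> y)) =
      lact (outer_bimodule A) x (lact (inner_bimodule A) a (d y)) \<oplus>\<^bsub>A2\<^esub>
      ract (outer_bimodule A) (lact (inner_bimodule A) a (d x)) y"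
      using oc c xy assms(1)
      by (simp add: double_der_mult[OF assms(2) xy] lin_mapD(2)[OF l(1)] inner_outer_commute)
    show "ract (inner_bimodule A) (d (x \<otimes> y)) a =
      lact (outer_bimodule A) x (ract (inner_bimodule A) (d y) a) \<oplus>\<^bsub>A2\<^esub>
      ract (outer_bimodule A) (ract (inner_bimodule A) (d x) a) y"
      using oc c xy assms(1)
      by (simp add: double_der_mult[OF assms(2) xy] lin_mapD(2)[OF l(2)] inner_outer_commute)
  qed
  ultimately show "lact D a d \<in> carrier D" "ract D d a \<in> carrier D"
    by (simp_all add: double_der_simps mem_derivations_iff lin_map_def)
qed

lemma double_der_add_closed: "d \<in> carrier D \<Longrightarrow> e \<in> carrier D \<Longrightarrow> d \<oplus>\<^bsub>D\<^esub> e \<in> carrier D"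
  using O.derivation_add by (simp add: double_der_simps)

lemma double_der_scale_closed: "d \<in> carrier D \<Longrightarrow> c \<odot>\<^bsub>D\<^esub> d \<in> carrier D"
  using O.derivation_scale by (simp add: double_der_simps)

lemma double_der_zero_closed: "\<zero>\<^bsub>D\<^esub> \<in> carrier D"
  using O.derivation_zero by (simp add: double_der_simps)

lemma double_der_apply:
  assumes "x \<in> carrier A"
  shows "\<zero>\<^bsub>D\<^esub> x = \<zero>\<^bsub>A2\<^esub>" "(d \<oplus>\<^bsub>D\<^esub> e) x = d x \<oplus>\<^bsub>A2\<^esub> e x" "(c \<odot>\<^bsub>D\<^esub> d) x = c \<odot>\<^bsub>A2\<^esub> d x"
    "lact D a d x = lact (inner_bimodule A) a (d x)" "ract D d a x = ract (inner_bimodule A) (d x) a"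
  using assms by (simp_all add: double_der_simps)

lemma cspace_double_der: "cspace D"
proof (rule cspaceI)
  note cl = double_der_add_closed double_der_scale_closed double_der_zero_closed
  fix d e f and b c :: complex
  show "\<zero>\<^bsub>D\<^esub> \<in> carrier D" by (rule cl)
  assume d: "d \<in> carrier D"
  show "c \<odot>\<^bsub>D\<^esub> d \<in> carrier D" by (intro cl d)
  show "\<zero>\<^bsub>D\<^esub> \<oplus>\<^bsub>D\<^esub> d = d"
    by (rule double_der_eqI) (simp_all add: d cl double_der_apply double_der_closed)
  show "1 \<odot>\<^bsub>D\<^esub> d = d"
    by (rule double_der_eqI) (simp_all add: d cl double_der_apply double_der_closed)
  show "0 \<odot>\<^bsub>D\<^esub> d = \<zero>\<^bsub>D\<^esub>"
    by (rule double_der_eqI) (simp_all add: d cl double_der_apply double_der_closed)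
  show "(b + c) \<odot>\<^bsub>D\<^esub> d = b \<odot>\<^bsub>D\<^esub> d \<oplus>\<^bsub>D\<^esub> c \<odot>\<^bsub>D\<^esub> d"
    by (rule double_der_eqI)
      (simp_all add: d cl double_der_apply double_der_closed A2.scale_add_left)
  show "(b * c) \<odot>\<^bsub>D\<^esub> d = b \<odot>\<^bsub>D\<^esub> (c \<odot>\<^bsub>D\<^esub> d)"
    by (rule double_der_eqI)
      (simp_all add: d cl double_der_apply double_der_closed A2.scale_scale)
  assume e: "e \<in> carrier D"
  show "d \<oplus>\<^bsub>D\<^esub> e \<in> carrier D" by (intro cl d e)
  show "d \<oplus>\<^bsub>D\<^esub> e = e \<oplus>\<^bsub>D\<^esub> d"
    by (rule double_der_eqI) (simp_all add: d e cl double_der_apply double_der_closed A2.a_comm)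
  show "c \<odot>\<^bsub>D\<^esub> (d \<oplus>\<^bsub>D\<^esub> e) = c \<odot>\<^bsub>D\<^esub> d \<oplus>\<^bsub>D\<^esub> c \<odot>\<^bsub>D\<^esub> e"
    by (rule double_der_eqI)
      (simp_all add: d e cl double_der_apply double_der_closed A2.scale_add_right)
  assume f: "f \<in> carrier D"
  show "d \<oplus>\<^bsub>D\<^esub> e \<oplus>\<^bsub>D\<^esub> f = d \<oplus>\<^bsub>D\<^esub> (e \<oplus>\<^bsub>D\<^esub> f)"
    by (rule double_der_eqI) (simp_all add: d e f cl double_der_apply double_der_closed A2.a_assoc)
qed

lemma cbimod_double_der: "cbimod A D"
proof (rule cbimodI)
  note cl = double_der_add_closed double_der_scale_closed double_der_act_closed
  note s = double_der_apply double_der_closed cl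
  show "calgebra A" by (rule calgebra_axioms)
  show "cspace D" by (rule cspace_double_der)
  show "bilinear A D D (lact D)"
    by (intro bilinearI lin_mapI double_der_eqI)
      (simp_all add: s I.lact_simps[simplified])
  show "bilinear D A D (ract D)"
    by (intro bilinearI lin_mapI double_der_eqI)
      (simp_all add: s I.ract_simps[simplified])
  fix a b d assume abd: "a \<in> carrier A" "b \<in> carrier A" "d \<in> carrier D"
  then show "lact D (a \<otimes> b) d = lact D a (lact D b d)"
    "ract D d (a \<otimes> b) = ract D (ract D d a) b"
    "lact D a (ract D d b) = ract D (lact D a d) b"
    by (intro double_der_eqI, simp_all add: s I.lact_mult I.ract_mult I.lact_ract)+
next
  fix d assume "d \<in> carrier D"
  then show "lact D \<one> d = d" "ract D d \<one> = d"
    by (intro double_der_eqI, simp_all add: double_der_apply double_der_closed double_der_act_closed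
        I.lact_one I.ract_one)+
qed

lemma outer_tens:
  "\<lbrakk>a \<in> carrier A; x \<in> carrier A; y \<in> carrier A\<rbrakk> \<Longrightarrow> lact (outer_bimodule A) a (x \<otimes>\<otimes> y) = (a \<otimes> x) \<otimes>\<otimes> y"
  "\<lbrakk>a \<in> carrier A; x \<in> carrier A; y \<in> carrier A\<rbrakk> \<Longrightarrow> ract (outer_bimodule A) (x \<otimes>\<otimes> y) a = x \<otimes>\<otimes> (y \<otimes> a)"
  by (simp_all add: outer_simps tmap lin_mult lin_map_id)

lemma inner_tens:
  "\<lbrakk>a \<in> carrier A; x \<in> carrier A; y \<in> carrier A\<rbrakk> \<Longrightarrow> lact (inner_bimodule A) a (x \<otimes>\<otimes> y) = x \<otimes>\<otimes> (a \<otimes> y)"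
  "\<lbrakk>a \<in> carrier A; x \<in> carrier A; y \<in> carrier A\<rbrakk> \<Longrightarrow> ract (inner_bimodule A) (x \<otimes>\<otimes> y) a = (x \<otimes> a) \<otimes>\<otimes> y"
  by (simp_all add: inner_simps tmap lin_mult lin_map_id)

lemma lin_outer:
  "a \<in> carrier A \<Longrightarrow> lin_map A2 A2 (lact (outer_bimodule A) a)"
  "a \<in> carrier A \<Longrightarrow> lin_map A2 A2 (\<lambda>X. ract (outer_bimodule A) X a)"
  using O.lin_lact O.lin_ract by (simp_all add: lin_map_def)

lemma lin_inner:
  "a \<in> carrier A \<Longrightarrow> lin_map A2 A2 (lact (inner_bimodule A) a)"
  "a \<in> carrier A \<Longrightarrow> lin_map A2 A2 (\<lambda>X. ract (inner_bimodule A) X a)"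
  using I.lin_lact I.lin_ract by (simp_all add: lin_map_def)

text \<open>In the Leibniz rule, the two terms \<open>x \<otimes> y\<close> of \<open>x \<Delta>(y)\<close> and \<open>\<Delta>(x) y\<close> cancel.\<close>

lemma Delta_closed: "Delta A \<in> carrier D"
proof -
  have *: "lin_map A A2 (\<lambda>x. x \<otimes>\<otimes> \<one> \<ominus>\<^bsub>A2\<^esub> \<one> \<otimes>\<otimes> x)"
    by (intro lin_map_diff cspace_axioms A2.cspace_axioms bilinearD[OF AA.tens_bilinear] one_closed)
  have "lin_map A A2 (Delta A)"
    by (rule lin_map_cong[OF * _ cspace_axioms]) (simp add: Delta_def)
  then have l: "lin_map A (outer_bimodule A) (Delta A)"
    by (simp add: lin_map_def)
  have "Delta A (x \<otimes> y) = lact (outer_bimodule A) x (Delta A y) \<oplus>\<^bsub>A2\<^esub> ract (outer_bimodule A) (Delta A x) y"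
    if xy: "x \<in> carrier A" "y \<in> carrier A" for x y
  proof -
    interpret L: lin A2 A2 "lact (outer_bimodule A) x"
      by (intro linI A2.cspace_axioms lin_outer xy)
    interpret R: lin A2 A2 "\<lambda>X. ract (outer_bimodule A) X y"
      by (intro linI A2.cspace_axioms lin_outer xy)
    have "lact (outer_bimodule A) x (Delta A y) \<oplus>\<^bsub>A2\<^esub> ract (outer_bimodule A) (Delta A x) y =
        ((x \<otimes> y) \<otimes>\<otimes> \<one> \<ominus>\<^bsub>A2\<^esub> x \<otimes>\<otimes> y) \<oplus>\<^bsub>A2\<^esub> (x \<otimes>\<otimes> y \<ominus>\<^bsub>A2\<^esub> \<one> \<otimes>\<otimes> (x \<otimes> y))"
      using xy by (simp add: Delta_def L.diff R.diff outer_tens)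
    also have "\<dots> = Delta A (x \<otimes> y)"
      using xy by (simp add: Delta_def a_minus_def A2.a_assoc A2.r_neg1)
    finally show ?thesis ..
  qed
  with l show ?thesis
    by (simp add: double_der_simps mem_derivations_iff) (simp add: Delta_def)
qed

end


section \<open>Pairing double derivations with Hochschild chains\<close>

context cbimod
begin

sublocale MA: tensor M A
  by (simp add: tensor_def A.cspace_axioms M.cspace_axioms)

abbreviation "C1 \<equiv> mtensor M A 1"
abbreviation "A2 \<equiv> mtensor A A 1"
abbreviation "inner \<equiv> inner_bimodule A"
abbreviation "outer \<equiv> outer_bimodule A"
abbreviation "D \<equiv> double_der A"

sublocale C1: cspace C1
  by (rule MA.cspace_mtensor)

text \<open>The operator \<open>f \<mapsto> T'' f T'\<close> attached to a tensor \<open>T\<close>. The crossing of the factors is what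
turns the inner actions on \<open>T\<close> into actions on the result (\<open>twist_inner\<close>) and the outer ones into
actions on \<open>f\<close> (\<open>twist_outer\<close>).\<close>

definition twist :: "'m \<Rightarrow> ('a \<times> 'a list \<Rightarrow> complex) set \<Rightarrow> 'm" where
  "twist f = quot_lift M (\<lambda>(x, ys). lact M (hd ys) (ract M f x))"

lemma twist:
  assumes f: "f \<in> carrier M"
  shows "lin_map A2 M (twist f)"
    and "x \<in> carrier A \<Longrightarrow> y \<in> carrier A \<Longrightarrow> twist f (tens A A x [y]) = lact M y (ract M f x)"
proof -
  have "bilinear A A M (\<lambda>x y. lact M y (ract M f x))"
  proof (rule bilinearI)
    fix x assume "x \<in> carrier A"
    then show "lin_map A M (\<lambda>y. lact M y (ract M f x))"
      by (intro lin_lact' ract_simps f)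
  next
    fix y assume "y \<in> carrier A"
    then show "lin_map A M (\<lambda>x. lact M y (ract M f x))"
      by (rule lin_map_comp[OF lin_ract'[OF f] lin_lact])
  qed
  then show "lin_map A2 M (twist f)"
    "x \<in> carrier A \<Longrightarrow> y \<in> carrier A \<Longrightarrow> twist f (tens A A x [y]) = lact M y (ract M f x)"
    unfolding twist_def
    using A.AA.lift_1[OF M.cspace_axioms, of "\<lambda>(x, ys). lact M (hd ys) (ract M f x)"] by simp_all
qed

lemma twist_closed [simp, intro]: "f \<in> carrier M \<Longrightarrow> T \<in> carrier A2 \<Longrightarrow> twist f T \<in> carrier M"
  by (rule lin_mapD(1)[OF twist(1)])

lemma lin_twist:
  assumes T: "T \<in> carrier A2"
  shows "lin_map M M (\<lambda>f. twist f T)"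
proof (rule lin_mapI)
  fix f assume f: "f \<in> carrier M"
  show "twist f T \<in> carrier M"
    using f T by simp
  show "twist (c \<odot>\<^bsub>M\<^esub> f) T = c \<odot>\<^bsub>M\<^esub> twist f T" for c
    by (rule A.AA.lin_map_eq_1[OF M.cspace_axioms _ _ _ T, of "twist (c \<odot>\<^bsub>M\<^esub> f)"])
      (simp_all add: twist f lin_map_scale A.A2.cspace_axioms M.cspace_axioms ract_simps lact_simps)
  fix g assume g: "g \<in> carrier M"
  show "twist (f \<oplus>\<^bsub>M\<^esub> g) T = twist f T \<oplus>\<^bsub>M\<^esub> twist g T"
    by (rule A.AA.lin_map_eq_1[OF M.cspace_axioms _ _ _ T, of "twist (f \<oplus>\<^bsub>M\<^esub> g)"])
      (simp_all add: twist f g lin_map_add A.A2.cspace_axioms M.cspace_axioms ract_simps lact_simps)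
qed

lemma twist_inner:
  assumes f: "f \<in> carrier M" and a: "a \<in> carrier A" and T: "T \<in> carrier A2"
  shows "twist f (lact inner a T) = lact M a (twist f T)"
    and "twist f (ract inner T a) = ract M (twist f T) a"
proof -
  show "twist f (lact inner a T) = lact M a (twist f T)"
  proof (rule A.AA.lin_map_eq_1[OF M.cspace_axioms _ _ _ T])
    show "lin_map A2 M (\<lambda>T. twist f (lact inner a T))"
      by (rule lin_map_comp[OF A.lin_inner(1)[OF a] twist(1)[OF f]])
    show "lin_map A2 M (\<lambda>T. lact M a (twist f T))"
      by (rule lin_map_comp[OF twist(1)[OF f] lin_lact[OF a]])
  qed (simp_all add: A.inner_tens a f twist ract_simps lact_simps lact_mult)
  show "twist f (ract inner T a) = ract M (twist f T) a"
  proof (rule A.AA.lin_map_eq_1[OF M.cspace_axioms _ _ _ T])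
    show "lin_map A2 M (\<lambda>T. twist f (ract inner T a))"
      by (rule lin_map_comp[OF A.lin_inner(2)[OF a] twist(1)[OF f]])
    show "lin_map A2 M (\<lambda>T. ract M (twist f T) a)"
      by (rule lin_map_comp[OF twist(1)[OF f] lin_ract[OF a]])
  qed (simp_all add: A.inner_tens a f twist ract_simps lact_simps ract_mult lact_ract)
qed

lemma twist_outer:
  assumes f: "f \<in> carrier M" and a: "a \<in> carrier A" and T: "T \<in> carrier A2"
  shows "twist f (lact outer a T) = twist (ract M f a) T"
    and "twist f (ract outer T a) = twist (lact M a f) T"
proof -
  show "twist f (lact outer a T) = twist (ract M f a) T"
  proof (rule A.AA.lin_map_eq_1[OF M.cspace_axioms _ _ _ T])
    show "lin_map A2 M (\<lambda>T. twist f (lact outer a T))"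
      by (rule lin_map_comp[OF A.lin_outer(1)[OF a] twist(1)[OF f]])
    show "lin_map A2 M (twist (ract M f a))"
      by (intro twist ract_simps a f)
  qed (simp_all add: A.outer_tens a f twist ract_simps lact_simps ract_mult)
  show "twist f (ract outer T a) = twist (lact M a f) T"
  proof (rule A.AA.lin_map_eq_1[OF M.cspace_axioms _ _ _ T])
    show "lin_map A2 M (\<lambda>T. twist f (ract outer T a))"
      by (rule lin_map_comp[OF A.lin_outer(2)[OF a] twist(1)[OF f]])
    show "lin_map A2 M (twist (lact M a f))"
      by (intro twist lact_simps a f)
  qed (simp_all add: A.outer_tens a f twist ract_simps lact_simps lact_mult lact_ract)
qed

definition pair :: "('a \<Rightarrow> ('a \<times> 'a list \<Rightarrow> complex) set) \<Rightarrow> ('m \<times> 'a list \<Rightarrow> complex) set \<Rightarrow> 'm" where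
  "pair d = quot_lift M (\<lambda>(f, as). twist f (d (hd as)))"

lemma pair:
  assumes d: "d \<in> carrier D"
  shows "lin_map C1 M (pair d)"
    and "f \<in> carrier M \<Longrightarrow> a \<in> carrier A \<Longrightarrow> pair d (tens M A f [a]) = twist f (d a)"
proof -
  have "bilinear M A M (\<lambda>f a. twist f (d a))"
  proof (rule bilinearI)
    fix f assume "f \<in> carrier M"
    then show "lin_map A M (\<lambda>a. twist f (d a))"
      by (rule lin_map_comp[OF A.double_der_lin[OF d] twist(1)])
  next
    fix a assume "a \<in> carrier A"
    then show "lin_map M M (\<lambda>f. twist f (d a))"
      by (intro lin_twist A.double_der_closed d)
  qed
  then show "lin_map C1 M (pair d)"
    "f \<in> carrier M \<Longrightarrow> a \<in> carrier A \<Longrightarrow> pair d (tens M A f [a]) = twist f (d a)"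
    unfolding pair_def
    using MA.lift_1[OF M.cspace_axioms, of "\<lambda>(f, as). twist f (d (hd as))"] by simp_all
qed

lemma bimod_hom_pair:
  assumes X: "X \<in> carrier C1"
  shows "bimod_hom A D M (\<lambda>d. pair d X)"
proof (intro bimod_homI lin_mapI)
  note eq = MA.lin_map_eq_1[OF M.cspace_axioms _ _ _ X]
  note ap = A.double_der_apply A.double_der_closed
  note tw_add = lin_mapD(2)[OF twist(1)] and tw_scale = lin_mapD(3)[OF twist(1)]
  fix d assume d: "d \<in> carrier D"
  show "pair d X \<in> carrier M"
    by (rule lin_mapD(1)[OF pair(1)[OF d] X])
  show "pair (c \<odot>\<^bsub>D\<^esub> d) X = c \<odot>\<^bsub>M\<^esub> pair d X" for c
    by (rule eq[of "pair (c \<odot>\<^bsub>D\<^esub> d)"])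
      (simp_all add: pair d A.double_der_scale_closed lin_map_scale M.cspace_axioms C1.cspace_axioms
        ap tw_scale)
  fix e assume e: "e \<in> carrier D"
  show "pair (d \<oplus>\<^bsub>D\<^esub> e) X = pair d X \<oplus>\<^bsub>M\<^esub> pair e X"
    by (rule eq[of "pair (d \<oplus>\<^bsub>D\<^esub> e)"])
      (simp_all add: pair d e A.double_der_add_closed lin_map_add M.cspace_axioms C1.cspace_axioms
        ap tw_add)
next
  note eq = MA.lin_map_eq_1[OF M.cspace_axioms _ _ _ X]
  note ap = A.double_der_apply A.double_der_closed
  fix a d assume a: "a \<in> carrier A" and d: "d \<in> carrier D"
  show "pair (lact D a d) X = lact M a (pair d X)"
    by (rule eq[of "pair (lact D a d)"])
      (simp_all add: pair d A.double_der_act_closed a lin_map_comp[OF pair(1)[OF d] lin_lact[OF a]]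
        ap twist_inner)
  show "pair (ract D d a) X = ract M (pair d X) a"
    by (rule eq[of "pair (ract D d a)"])
      (simp_all add: pair d A.double_der_act_closed a lin_map_comp[OF pair(1)[OF d] lin_ract[OF a]]
        ap twist_inner)
qed

definition comm_map :: "('m \<times> 'a list \<Rightarrow> complex) set \<Rightarrow> 'm" where
  "comm_map = quot_lift M (\<lambda>(f, as). ract M f (hd as) \<ominus>\<^bsub>M\<^esub> lact M (hd as) f)"

lemma comm_map:
  shows "lin_map C1 M comm_map"
    and "f \<in> carrier M \<Longrightarrow> a \<in> carrier A \<Longrightarrow>
      comm_map (tens M A f [a]) = ract M f a \<ominus>\<^bsub>M\<^esub> lact M a f"
proof -
  have "bilinear M A M (\<lambda>f a. ract M f a \<ominus>\<^bsub>M\<^esub> lact M a f)"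
    by (intro bilinearI lin_map_diff A.cspace_axioms M.cspace_axioms)
      (simp_all add: lin_ract lin_lact lin_ract' lin_lact')
  then show "lin_map C1 M comm_map" "f \<in> carrier M \<Longrightarrow> a \<in> carrier A \<Longrightarrow>
      comm_map (tens M A f [a]) = ract M f a \<ominus>\<^bsub>M\<^esub> lact M a f"
    unfolding comm_map_def
    using MA.lift_1[OF M.cspace_axioms, of "\<lambda>(f, as). ract M f (hd as) \<ominus>\<^bsub>M\<^esub> lact M (hd as) f"]
    by simp_all
qed

text \<open>Here \<open>\<Delta> a = a \<otimes> 1 - 1 \<otimes> a\<close>, and the two summands act on \<open>f\<close> as \<open>f a\<close> and \<open>a f\<close>.\<close>

lemma pair_Delta:
  assumes X: "X \<in> carrier C1"
  shows "pair (Delta A) X = comm_map X"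
proof (rule MA.lin_map_eq_1[OF M.cspace_axioms _ _ _ X])
  show "lin_map C1 M (pair (Delta A))"
    by (intro pair A.Delta_closed)
  show "lin_map C1 M comm_map"
    by (rule comm_map)
  fix f a assume f: "f \<in> carrier M" and a: "a \<in> carrier A"
  interpret t: lin A2 M "twist f"
    by (intro linI A.A2.cspace_axioms M.cspace_axioms twist f)
  have "Delta A a = tens A A a [\<one>\<^bsub>A\<^esub>] \<ominus>\<^bsub>A2\<^esub> tens A A \<one>\<^bsub>A\<^esub> [a]"
    using a by (simp add: Delta_def)
  then show "pair (Delta A) (tens M A f [a]) = comm_map (tens M A f [a])"
    using f a by (simp add: pair A.Delta_closed comm_map t.diff twist lact_one ract_one
        ract_simps lact_simps)
qed


section \<open>Hochschild homology in degrees 0 and 1\<close>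

lemma tens_0_lin: "lin_map M (mtensor M A 0) (\<lambda>m. tens M A m [])"
proof (rule lin_mapI)
  note * = multilinearD[OF MA.multilinear_tens[of 0]]
  fix m assume m: "m \<in> carrier M"
  then have w: "(m, []) \<in> words M A 0" by (simp add: words_iff)
  then show "tens M A m [] \<in> carrier (mtensor M A 0)"
    by (rule MA.tens_closed)
  show "tens M A (c \<odot>\<^bsub>M\<^esub> m) [] = c \<odot>\<^bsub>mtensor M A 0\<^esub> tens M A m []" for c
    using *(3)[OF w] by simp
  show "tens M A (m \<oplus>\<^bsub>M\<^esub> m') [] = tens M A m [] \<oplus>\<^bsub>mtensor M A 0\<^esub> tens M A m' []"
    if "m' \<in> carrier M" for m'
    using *(2)[OF w that] by simp
qed

lemma tens_0_inj:
  assumes "m \<in> carrier M" "n \<in> carrier M" "tens M A m [] = tens M A n []"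
  shows "m = n"
proof -
  have "multilinear M A 0 M fst"
    by (rule multilinear_0I) (simp add: lin_map_id)
  from MA.mtensor_lift(2)[OF M.cspace_axioms this] assms show ?thesis
    by (simp add: words_iff) (metis fst_conv)
qed

lemma finsum_0_1:
  assumes "cspace N" "g 0 \<in> carrier N" "g 1 \<in> carrier N"
  shows "finsum N g {0..1::nat} = g 0 \<oplus>\<^bsub>N\<^esub> g 1"
proof -
  interpret N: cspace N by fact
  have "{0..1::nat} = {0, 1}" by auto
  with assms show ?thesis by simp
qed

lemma finsum_0_2:
  assumes "cspace N" "g 0 \<in> carrier N" "g 1 \<in> carrier N" "g 2 \<in> carrier N"
  shows "finsum N g {0..2::nat} = g 0 \<oplus>\<^bsub>N\<^esub> (g 1 \<oplus>\<^bsub>N\<^esub> g 2)"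
proof -
  interpret N: cspace N by fact
  have "{0..2::nat} = {0, 1, 2}" by auto
  with assms show ?thesis by simp
qed

lemma hoch_diff_1:
  assumes X: "X \<in> carrier C1"
  shows "hoch_diff A M 1 X = tens M A (comm_map X) []"
proof -
  let ?C0 = "mtensor M A 0"
  interpret C0: cspace ?C0 by (rule MA.cspace_mtensor)
  interpret t: lin M ?C0 "\<lambda>m. tens M A m []"
    by (intro linI M.cspace_axioms C0.cspace_axioms tens_0_lin)
  let ?g = "\<lambda>w. \<Oplus>\<^bsub>?C0\<^esub>i \<in> {0..1}. (- 1) ^ i \<odot>\<^bsub>?C0\<^esub> case_prod (tens M A) (hoch_face A M i w)"
  have g: "?g (f, [a]) = tens M A (comm_map (tens M A f [a])) []"
    if f: "f \<in> carrier M" and a: "a \<in> carrier A" for f a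
  proof -
    have c: "ract M f a \<in> carrier M" "lact M a f \<in> carrier M"
      using f a by (simp_all add: ract_simps lact_simps)
    then have "tens M A (comm_map (tens M A f [a])) [] =
        tens M A (ract M f a) [] \<oplus>\<^bsub>?C0\<^esub> \<ominus>\<^bsub>?C0\<^esub> tens M A (lact M a f) []"
      using f a by (simp add: comm_map t.diff) (simp add: a_minus_def)
    then show ?thesis
      using f a c by (subst finsum_0_1)
        (simp_all add: C0.cspace_axioms hoch_face_def C0.scale_minus_one)
  qed
  have l: "lin_map C1 ?C0 (\<lambda>X. tens M A (comm_map X) [])"
    by (rule lin_map_comp[OF comm_map(1) tens_0_lin])
  have "bilinear M A ?C0 (\<lambda>f a. tens M A (comm_map (tens M A f [a])) [])"
    by (intro bilinearI lin_map_comp[OF bilinearD(1)[OF MA.tens_bilinear] l]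
        lin_map_comp[OF bilinearD(2)[OF MA.tens_bilinear] l])
  then have "bilinear M A ?C0 (\<lambda>f a. ?g (f, [a]))"
    by (rule bilinear_cong) (simp_all only: g M.cspace_axioms A.cspace_axioms)
  note * = MA.lift_1[OF C0.cspace_axioms this]
  have "quot_lift ?C0 ?g X = tens M A (comm_map X) []"
    by (rule MA.lin_map_eq_1[OF C0.cspace_axioms *(1) l _ X]) (simp only: * g)
  then show ?thesis
    by (simp add: hoch_diff_def)
qed

lemma hoch_diff_2:
  shows "lin_map (mtensor M A 2) C1 (hoch_diff A M 2)"
    and "\<lbrakk>f \<in> carrier M; a \<in> carrier A; b \<in> carrier A\<rbrakk> \<Longrightarrow> hoch_diff A M 2 (tens M A f [a, b]) =
      tens M A (ract M f a) [b] \<oplus>\<^bsub>C1\<^esub> (\<ominus>\<^bsub>C1\<^esub> tens M A f [a \<otimes>\<^bsub>A\<^esub> b] \<oplus>\<^bsub>C1\<^esub> tens M A (lact M b f) [a])"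
proof -
  let ?g = "\<lambda>w. \<Oplus>\<^bsub>C1\<^esub>i \<in> {0..2}. (- 1) ^ i \<odot>\<^bsub>C1\<^esub> case_prod (tens M A) (hoch_face A M i w)"
  let ?h = "\<lambda>f a b. tens M A (ract M f a) [b] \<oplus>\<^bsub>C1\<^esub>
      ((- 1) \<odot>\<^bsub>C1\<^esub> tens M A f [a \<otimes>\<^bsub>A\<^esub> b] \<oplus>\<^bsub>C1\<^esub> tens M A (lact M b f) [a])"
  have g: "?g (f, [a, b]) = ?h f a b"
    if f: "f \<in> carrier M" and a: "a \<in> carrier A" and b: "b \<in> carrier A" for f a b
  proof -
    have c: "ract M f a \<in> carrier M" "lact M b f \<in> carrier M" "a \<otimes>\<^bsub>A\<^esub> b \<in> carrier A"
      using f a b by (simp_all add: ract_simps lact_simps)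
    then show ?thesis
      using f a b by (subst finsum_0_2) (simp_all add: C1.cspace_axioms hoch_face_def)
  qed
  have T1: "lin_map M C1 (\<lambda>f. tens M A f [a])" if "a \<in> carrier A" for a
    by (rule bilinearD(2)[OF MA.tens_bilinear that])
  have T2: "lin_map A C1 (\<lambda>a. tens M A f [a])" if "f \<in> carrier M" for f
    by (rule bilinearD(1)[OF MA.tens_bilinear that])
  note cs = M.cspace_axioms A.cspace_axioms C1.cspace_axioms
  have "multilinear M A 2 C1 (\<lambda>(f, as). ?h f (as ! 0) (as ! 1))"
  proof (rule multilinear_2I, goal_cases)
    case (1 a b)
    have "lin_map M C1 (\<lambda>f. ?h f a b)"
      by (intro lin_map_add lin_map_scale cs
          lin_map_comp[OF lin_ract[OF 1(1)] T1[OF 1(2)]] lin_map_comp[OF lin_lact[OF 1(2)] T1[OF 1(1)]]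
          T1[OF A.m_closed[OF 1]])
    then show ?case by (simp add: One_nat_def)
  next
    case (2 f b)
    have "lin_map A C1 (\<lambda>a. ?h f a b)"
      by (intro lin_map_add lin_map_scale cs
          lin_map_comp[OF lin_ract'[OF 2(1)] T1[OF 2(2)]] T2[OF lact_simps(1)[OF 2(2,1)]]
          lin_map_comp[OF A.lin_mult(2)[OF 2(2)] T2[OF 2(1)]])
    then show ?case by (simp add: One_nat_def)
  next
    case (3 f a)
    have "lin_map A C1 (\<lambda>b. ?h f a b)"
      by (intro lin_map_add lin_map_scale cs
          lin_map_comp[OF lin_lact'[OF 3(1)] T1[OF 3(2)]] T2[OF ract_simps(1)[OF 3(2,1)]]
          lin_map_comp[OF A.lin_mult(1)[OF 3(2)] T2[OF 3(1)]])
    then show ?case by (simp add: One_nat_def)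
  qed
  then have "multilinear M A 2 C1 ?g"
  proof (rule MA.multilinear_cong)
    fix f as assume "(f, as) \<in> words M A 2"
    then obtain a b where "as = [a, b]" "f \<in> carrier M" "a \<in> carrier A" "b \<in> carrier A"
      by (auto simp: words_iff numeral_2_eq_2 length_Suc_conv)
    then show "(\<lambda>(f, as). ?h f (as ! 0) (as ! 1)) (f, as) = ?g (f, as)"
      using g[of f a b] by (simp add: One_nat_def)
  qed
  note * = MA.mtensor_lift[OF C1.cspace_axioms this]
  have eq: "hoch_diff A M 2 = quot_lift C1 ?g"
    by (simp add: hoch_diff_def One_nat_def)
  show "lin_map (mtensor M A 2) C1 (hoch_diff A M 2)"
    unfolding eq by (rule *(1))
  assume fab: "f \<in> carrier M" "a \<in> carrier A" "b \<in> carrier A"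
  then have w: "(f, [a, b]) \<in> words M A 2"
    by (simp add: words_iff)
  show "hoch_diff A M 2 (tens M A f [a, b]) =
      tens M A (ract M f a) [b] \<oplus>\<^bsub>C1\<^esub> (\<ominus>\<^bsub>C1\<^esub> tens M A f [a \<otimes>\<^bsub>A\<^esub> b] \<oplus>\<^bsub>C1\<^esub> tens M A (lact M b f) [a])"
    unfolding eq *(2)[OF w] g[OF fab] using fab by (simp add: C1.scale_minus_one)
qed

lemma boundaries_subspace: "submodule (hoch_boundaries A M 1) complex_field C1"
proof -
  interpret C2: cspace "mtensor M A 2" by (rule MA.cspace_mtensor)
  interpret lin "mtensor M A 2" C1 "hoch_diff A M 2"
    by (intro linI C2.cspace_axioms C1.cspace_axioms hoch_diff_2)
  have eq: "hoch_boundaries A M 1 = hoch_diff A M 2 ` carrier (mtensor M A 2)"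
    by (simp add: hoch_boundaries_def)
  show ?thesis
    unfolding eq
    by (rule image_subspace[OF module.carrier_is_submodule[OF C2.is_module]])
qed

lemma boundary_mem:
  assumes "f \<in> carrier M" "a \<in> carrier A" "b \<in> carrier A"
  shows "tens M A (ract M f a) [b] \<oplus>\<^bsub>C1\<^esub> (\<ominus>\<^bsub>C1\<^esub> tens M A f [a \<otimes>\<^bsub>A\<^esub> b] \<oplus>\<^bsub>C1\<^esub> tens M A (lact M b f) [a])
    \<in> hoch_boundaries A M 1"
proof -
  have "tens M A f [a, b] \<in> carrier (mtensor M A 2)"
    by (rule MA.tens_closed) (simp add: words_iff assms)
  then show ?thesis
    using hoch_diff_2(2)[OF assms] by (auto simp: hoch_boundaries_def)
qed

text \<open>For the boundary \<open>f a \<otimes> b - f \<otimes> a b + b f \<otimes> a\<close> of \<open>f \<otimes> a \<otimes> b\<close>, the Leibniz rule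
\<open>d(a b) = a d(b) + d(a) b\<close> expands the middle term into the two outer ones, because the outer actions
on \<open>d(b)\<close> and \<open>d(a)\<close> can be moved to \<open>f\<close>.\<close>

lemma pair_boundary:
  assumes d: "d \<in> carrier D" and X: "X \<in> hoch_boundaries A M 1"
  shows "pair d X = \<zero>\<^bsub>M\<^esub>"
proof -
  interpret C2: cspace "mtensor M A 2" by (rule MA.cspace_mtensor)
  interpret p: lin C1 M "pair d"
    by (intro linI C1.cspace_axioms M.cspace_axioms pair d)
  obtain Y where Y: "Y \<in> carrier (mtensor M A 2)" "X = hoch_diff A M 2 Y"
    using X by (auto simp: hoch_boundaries_def)
  have "pair d (hoch_diff A M 2 Y) = (\<lambda>Y. \<zero>\<^bsub>M\<^esub>) Y"
  proof (rule MA.mtensor_lin_map_eq[OF M.cspace_axioms _ _ _ Y(1)])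
    show "lin_map (mtensor M A 2) M (\<lambda>Y. pair d (hoch_diff A M 2 Y))"
      by (rule lin_map_comp[OF hoch_diff_2(1) pair(1)[OF d]])
    show "lin_map (mtensor M A 2) M (\<lambda>Y. \<zero>\<^bsub>M\<^esub>)"
      by (simp add: lin_map_def)
    fix f as assume "(f, as) \<in> words M A 2"
    then obtain a b where as: "as = [a, b]" and f: "f \<in> carrier M"
      and a: "a \<in> carrier A" and b: "b \<in> carrier A"
      by (auto simp: words_iff numeral_2_eq_2 length_Suc_conv)
    interpret t: lin A2 M "twist f"
      by (intro linI A.A2.cspace_axioms M.cspace_axioms twist f)
    interpret O: cbimod A outer by (rule A.cbimod_outer)
    note c = ract_simps(1)[OF a f] lact_simps(1)[OF b f]
    note da = A.double_der_closed[OF d a] and db = A.double_der_closed[OF d b]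
    have "twist f (d (a \<otimes>\<^bsub>A\<^esub> b)) = twist (ract M f a) (d b) \<oplus>\<^bsub>M\<^esub> twist (lact M b f) (d a)"
      using O.lact_simps(1)[OF a, of "d b"] O.ract_simps(1)[OF b, of "d a"] da db
      by (simp add: A.double_der_mult[OF d a b] t.add twist_outer f a b)
    then show "pair d (hoch_diff A M 2 (tens M A f as)) = \<zero>\<^bsub>M\<^esub>"
      using f a b c da db
      by (simp add: as hoch_diff_2 p.add p.minus pair d M.minus_add M.a_ac M.r_neg2 M.r_neg)
  qed
  with Y show ?thesis
    by simp
qed

end


section \<open>Monoid algebras\<close>

lemma submodule_cong:
  assumes "carrier N = carrier M" "add N = add M" "zero N = zero M" "smult N = smult M"
  shows "submodule H R N \<longleftrightarrow> submodule H R M"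
  by (simp add: submodule_def submodule_axioms_def subgroup_def assms m_inv_def)

lemma lin_span_cong:
  assumes "carrier N = carrier M" "add N = add M" "zero N = zero M" "smult N = smult M"
  shows "lin_span N S = lin_span M S"
  unfolding lin_span_def submodule_cong[OF assms] ..

lemma quot_cong:
  assumes "carrier N = carrier M" "add N = add M" "zero N = zero M" "smult N = smult M"
  shows "a_r_coset N = a_r_coset M" "carrier (N QuotC H) = carrier (M QuotC H)"
    "add (N QuotC H) = add (M QuotC H)" "zero (N QuotC H) = zero (M QuotC H)"
    "smult (N QuotC H) = smult (M QuotC H)"
proof -
  show *: "a_r_coset N = a_r_coset M"
    by (simp add: fun_eq_iff a_r_coset_def' assms)
  show "carrier (N QuotC H) = carrier (M QuotC H)" "add (N QuotC H) = add (M QuotC H)"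
    "zero (N QuotC H) = zero (M QuotC H)" "smult (N QuotC H) = smult (M QuotC H)"
    by (simp_all add: cquot_def A_RCOSETS_def' set_add_def' assms * fun_eq_iff)
qed

locale monoid_algebra = monoid W for W :: "'w monoid" (structure)
begin

abbreviation "F \<equiv> free_space (carrier W)"
abbreviation "K \<equiv> monoid_calg W"

lemma monoid_calg_fields:
  "carrier K = carrier F" "add K = add F" "zero K = zero F" "smult K = smult F" "one K = delta \<one>"
  by (simp_all add: monoid_calg_def free_space_def)

text \<open>Sums over the supports are replaced by sums over common finite supersets, which is what makes the
product visibly bilinear.\<close>

lemma mult_superset:
  assumes "finite S" "finite T" "{w. f w \<noteq> 0} \<subseteq> S" "{w. g w \<noteq> 0} \<subseteq> T"
  shows "(f \<otimes>\<^bsub>K\<^esub> g) w = (\<Sum>u\<in>S. \<Sum>v\<in>T. if u \<otimes> v = w then f u * g v else 0)"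
proof -
  have "(f \<otimes>\<^bsub>K\<^esub> g) w = (\<Sum>u | f u \<noteq> 0. \<Sum>v | g v \<noteq> 0. if u \<otimes> v = w then f u * g v else 0)"
    by (simp add: monoid_calg_def)
  also have "\<dots> = (\<Sum>u | f u \<noteq> 0. \<Sum>v\<in>T. if u \<otimes> v = w then f u * g v else 0)"
    by (intro sum.cong refl sum.mono_neutral_left assms) auto
  also have "\<dots> = (\<Sum>u\<in>S. \<Sum>v\<in>T. if u \<otimes> v = w then f u * g v else 0)"
    by (intro sum.mono_neutral_left assms) (auto intro: sum.neutral)
  finally show ?thesis .
qed

lemma mult_delta:
  "delta u \<otimes>\<^bsub>K\<^esub> delta v = delta (u \<otimes> v)"
proof
  fix w
  have "(delta u \<otimes>\<^bsub>K\<^esub> delta v) w =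
      (\<Sum>a\<in>{u}. \<Sum>b\<in>{v}. if a \<otimes> b = w then delta u a * delta v b else 0)"
    by (rule mult_superset) (auto simp: delta_def)
  then show "(delta u \<otimes>\<^bsub>K\<^esub> delta v) w = delta (u \<otimes> v) w"
    by (simp add: delta_def)
qed

lemma mult_closed:
  assumes "f \<in> carrier F" "g \<in> carrier F"
  shows "f \<otimes>\<^bsub>K\<^esub> g \<in> carrier F"
proof -
  let ?S = "(\<lambda>(u, v). u \<otimes> v) ` ({w. f w \<noteq> 0} \<times> {w. g w \<noteq> 0})"
  have "{w. (f \<otimes>\<^bsub>K\<^esub> g) w \<noteq> 0} \<subseteq> ?S"
  proof
    fix w assume "w \<in> {w. (f \<otimes>\<^bsub>K\<^esub> g) w \<noteq> 0}"
    then have "(\<Sum>u | f u \<noteq> 0. \<Sum>v | g v \<noteq> 0. if u \<otimes> v = w then f u * g v else 0) \<noteq> 0"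
      by (simp add: monoid_calg_def)
    then obtain u where u: "u \<in> {u. f u \<noteq> 0}"
      "(\<Sum>v | g v \<noteq> 0. if u \<otimes> v = w then f u * g v else 0) \<noteq> 0"
      by (rule sum.not_neutral_contains_not_neutral)
    from u(2) obtain v where v: "v \<in> {v. g v \<noteq> 0}" "(if u \<otimes> v = w then f u * g v else 0) \<noteq> 0"
      by (rule sum.not_neutral_contains_not_neutral)
    then have "w = u \<otimes> v"
      by (auto split: if_splits)
    with u(1) v(1) show "w \<in> ?S"
      by auto
  qed
  moreover have "finite ?S" "?S \<subseteq> carrier W"
    using assms by auto
  ultimately show ?thesis
    by (auto intro: finite_subset)
qed

lemma lin_mult_left:
  assumes g: "g \<in> carrier F"
  shows "lin_map F F (\<lambda>f. f \<otimes>\<^bsub>K\<^esub> g)"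
proof (rule lin_mapI)
  let ?T = "{w. g w \<noteq> 0}"
  have T: "finite ?T" using g by simp
  fix f assume f: "f \<in> carrier F"
  show "f \<otimes>\<^bsub>K\<^esub> g \<in> carrier F"
    by (rule mult_closed[OF f g])
  show "(c \<odot>\<^bsub>F\<^esub> f) \<otimes>\<^bsub>K\<^esub> g = c \<odot>\<^bsub>F\<^esub> (f \<otimes>\<^bsub>K\<^esub> g)" for c
  proof
    fix w
    let ?S = "{w. f w \<noteq> 0}"
    have S: "finite ?S" using f by simp
    have "((c \<odot>\<^bsub>F\<^esub> f) \<otimes>\<^bsub>K\<^esub> g) w = (\<Sum>u\<in>?S. \<Sum>v\<in>?T. if u \<otimes> v = w then c * f u * g v else 0)"
      by (subst mult_superset[OF S T]) (auto cong del: if_weak_cong)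
    also have "\<dots> = c * (\<Sum>u\<in>?S. \<Sum>v\<in>?T. if u \<otimes> v = w then f u * g v else 0)"
      unfolding sum_distrib_left by (intro sum.cong refl) simp
    also have "\<dots> = c * (f \<otimes>\<^bsub>K\<^esub> g) w"
      by (subst mult_superset[OF S T]) auto
    finally show "((c \<odot>\<^bsub>F\<^esub> f) \<otimes>\<^bsub>K\<^esub> g) w = (c \<odot>\<^bsub>F\<^esub> (f \<otimes>\<^bsub>K\<^esub> g)) w"
      by simp
  qed
  fix f' assume f': "f' \<in> carrier F"
  show "(f \<oplus>\<^bsub>F\<^esub> f') \<otimes>\<^bsub>K\<^esub> g = f \<otimes>\<^bsub>K\<^esub> g \<oplus>\<^bsub>F\<^esub> f' \<otimes>\<^bsub>K\<^esub> g"
  proof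
    fix w
    let ?S = "{w. f w \<noteq> 0} \<union> {w. f' w \<noteq> 0}"
    have S: "finite ?S" using f f' by simp
    have "((f \<oplus>\<^bsub>F\<^esub> f') \<otimes>\<^bsub>K\<^esub> g) w = (\<Sum>u\<in>?S. \<Sum>v\<in>?T. if u \<otimes> v = w then (f u + f' u) * g v else 0)"
      by (subst mult_superset[OF S T]) (auto cong del: if_weak_cong)
    also have "\<dots> = (\<Sum>u\<in>?S. \<Sum>v\<in>?T. if u \<otimes> v = w then f u * g v else 0) +
        (\<Sum>u\<in>?S. \<Sum>v\<in>?T. if u \<otimes> v = w then f' u * g v else 0)"
      unfolding sum.distrib[symmetric] by (intro sum.cong refl) (simp add: distrib_right)
    also have "\<dots> = (f \<otimes>\<^bsub>K\<^esub> g) w + (f' \<otimes>\<^bsub>K\<^esub> g) w"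
      by (subst (1 2) mult_superset[OF S T]) auto
    finally show "((f \<oplus>\<^bsub>F\<^esub> f') \<otimes>\<^bsub>K\<^esub> g) w = (f \<otimes>\<^bsub>K\<^esub> g \<oplus>\<^bsub>F\<^esub> f' \<otimes>\<^bsub>K\<^esub> g) w"
      by simp
  qed
qed

lemma lin_mult_right:
  assumes g: "g \<in> carrier F"
  shows "lin_map F F (\<lambda>f. g \<otimes>\<^bsub>K\<^esub> f)"
proof (rule lin_mapI)
  let ?T = "{w. g w \<noteq> 0}"
  have T: "finite ?T" using g by simp
  fix f assume f: "f \<in> carrier F"
  show "g \<otimes>\<^bsub>K\<^esub> f \<in> carrier F"
    by (rule mult_closed[OF g f])
  show "g \<otimes>\<^bsub>K\<^esub> (c \<odot>\<^bsub>F\<^esub> f) = c \<odot>\<^bsub>F\<^esub> (g \<otimes>\<^bsub>K\<^esub> f)" for c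
  proof
    fix w
    let ?S = "{w. f w \<noteq> 0}"
    have S: "finite ?S" using f by simp
    have "(g \<otimes>\<^bsub>K\<^esub> (c \<odot>\<^bsub>F\<^esub> f)) w = (\<Sum>u\<in>?T. \<Sum>v\<in>?S. if u \<otimes> v = w then g u * (c * f v) else 0)"
      by (subst mult_superset[OF T S]) (auto cong del: if_weak_cong)
    also have "\<dots> = c * (\<Sum>u\<in>?T. \<Sum>v\<in>?S. if u \<otimes> v = w then g u * f v else 0)"
      unfolding sum_distrib_left by (intro sum.cong refl) simp
    also have "\<dots> = c * (g \<otimes>\<^bsub>K\<^esub> f) w"
      by (subst mult_superset[OF T S]) auto
    finally show "(g \<otimes>\<^bsub>K\<^esub> (c \<odot>\<^bsub>F\<^esub> f)) w = (c \<odot>\<^bsub>F\<^esub> (g \<otimes>\<^bsub>K\<^esub> f)) w"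
      by simp
  qed
  fix f' assume f': "f' \<in> carrier F"
  show "g \<otimes>\<^bsub>K\<^esub> (f \<oplus>\<^bsub>F\<^esub> f') = g \<otimes>\<^bsub>K\<^esub> f \<oplus>\<^bsub>F\<^esub> g \<otimes>\<^bsub>K\<^esub> f'"
  proof
    fix w
    let ?S = "{w. f w \<noteq> 0} \<union> {w. f' w \<noteq> 0}"
    have S: "finite ?S" using f f' by simp
    have "(g \<otimes>\<^bsub>K\<^esub> (f \<oplus>\<^bsub>F\<^esub> f')) w = (\<Sum>u\<in>?T. \<Sum>v\<in>?S. if u \<otimes> v = w then g u * (f v + f' v) else 0)"
      by (subst mult_superset[OF T S]) (auto cong del: if_weak_cong)
    also have "\<dots> = (\<Sum>u\<in>?T. \<Sum>v\<in>?S. if u \<otimes> v = w then g u * f v else 0) +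
        (\<Sum>u\<in>?T. \<Sum>v\<in>?S. if u \<otimes> v = w then g u * f' v else 0)"
      unfolding sum.distrib[symmetric] by (intro sum.cong refl) (simp add: distrib_left)
    also have "\<dots> = (g \<otimes>\<^bsub>K\<^esub> f) w + (g \<otimes>\<^bsub>K\<^esub> f') w"
      by (subst (1 2) mult_superset[OF T S]) auto
    finally show "(g \<otimes>\<^bsub>K\<^esub> (f \<oplus>\<^bsub>F\<^esub> f')) w = (g \<otimes>\<^bsub>K\<^esub> f \<oplus>\<^bsub>F\<^esub> g \<otimes>\<^bsub>K\<^esub> f') w"
      by simp
  qed
qed

lemma cspace_monoid_calg: "cspace K"
  by (rule cspace_cong[OF cspace_free_space]) (rule monoid_calg_fields)+

text \<open>Both sides are linear in each of the three arguments, so the associativity of words is enough.\<close>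

lemma mult_assoc:
  assumes f: "f \<in> carrier F" and g: "g \<in> carrier F" and h: "h \<in> carrier F"
  shows "f \<otimes>\<^bsub>K\<^esub> g \<otimes>\<^bsub>K\<^esub> h = f \<otimes>\<^bsub>K\<^esub> (g \<otimes>\<^bsub>K\<^esub> h)"
proof -
  note eq = lin_map_free_eq[OF cspace_free_space]
  note l = lin_mult_left and r = lin_mult_right
  note d = delta_closed[where W = "carrier W"]
  have 1: "delta u \<otimes>\<^bsub>K\<^esub> delta v \<otimes>\<^bsub>K\<^esub> h = delta u \<otimes>\<^bsub>K\<^esub> (delta v \<otimes>\<^bsub>K\<^esub> h)"
    if u: "u \<in> carrier W" and v: "v \<in> carrier W" for u v
    by (rule eq[OF r[OF mult_closed[OF d[OF u] d[OF v]]] lin_map_comp[OF r[OF d[OF v]] r[OF d[OF u]]] _ h])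
      (simp add: mult_delta m_assoc u v)
  have 2: "delta u \<otimes>\<^bsub>K\<^esub> g \<otimes>\<^bsub>K\<^esub> h = delta u \<otimes>\<^bsub>K\<^esub> (g \<otimes>\<^bsub>K\<^esub> h)"
    if u: "u \<in> carrier W" for u
    by (rule eq[OF lin_map_comp[OF r[OF d[OF u]] l[OF h]] lin_map_comp[OF l[OF h] r[OF d[OF u]]] _ g])
      (simp only: 1 u)
  show ?thesis
    by (rule eq[OF lin_map_comp[OF l[OF g] l[OF h]] l[OF mult_closed[OF g h]] _ f]) (simp only: 2)
qed

lemma ring_monoid_calg: "ring K"
proof (rule ringI)
  note d = delta_closed[where W = "carrier W"]
  show "abelian_group K"
    using cspace_monoid_calg module.axioms(2) cspace.is_module by blast
  have "delta \<one> \<otimes>\<^bsub>K\<^esub> f = f" "f \<otimes>\<^bsub>K\<^esub> delta \<one> = f" if f: "f \<in> carrier F" for f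
  proof -
    show "delta \<one> \<otimes>\<^bsub>K\<^esub> f = f"
      by (rule lin_map_free_eq[OF cspace_free_space lin_mult_right[OF d[OF one_closed]] lin_map_id _ f])
        (simp add: mult_delta)
    show "f \<otimes>\<^bsub>K\<^esub> delta \<one> = f"
      by (rule lin_map_free_eq[OF cspace_free_space lin_mult_left[OF d[OF one_closed]] lin_map_id _ f])
        (simp add: mult_delta)
  qed
  then show "Group.monoid K"
    by (intro monoidI) (simp_all only: monoid_calg_fields mult_closed mult_assoc d one_closed)
  fix x y z assume "x \<in> carrier K" "y \<in> carrier K" "z \<in> carrier K"
  then have *: "x \<in> carrier F" "y \<in> carrier F" "z \<in> carrier F"
    by (simp_all only: monoid_calg_fields)
  show "(x \<oplus>\<^bsub>K\<^esub> y) \<otimes>\<^bsub>K\<^esub> z = x \<otimes>\<^bsub>K\<^esub> z \<oplus>\<^bsub>K\<^esub> y \<otimes>\<^bsub>K\<^esub> z"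
    using lin_mapD(2)[OF lin_mult_left[OF *(3)] *(1,2)] by (simp only: monoid_calg_fields)
  show "z \<otimes>\<^bsub>K\<^esub> (x \<oplus>\<^bsub>K\<^esub> y) = z \<otimes>\<^bsub>K\<^esub> x \<oplus>\<^bsub>K\<^esub> z \<otimes>\<^bsub>K\<^esub> y"
    using lin_mapD(2)[OF lin_mult_right[OF *(3)] *(1,2)] by (simp only: monoid_calg_fields)
qed

end


section \<open>The tensor algebra of a bimodule\<close>

locale tensor_algebra = cbimod A M for A :: "(complex, 'a) module" and M :: "('a, 'm) bimodule"
begin

sublocale AM: tensor A M
  by (simp add: tensor_def A.cspace_axioms M.cspace_axioms)

abbreviation "W \<equiv> word_monoid A M"

lemma word_carrier: "(a, ms) \<in> carrier W \<longleftrightarrow> a \<in> carrier A \<and> set ms \<subseteq> carrier M"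
  by (auto simp: word_monoid_def)

lemma word_mult:
  "(a, []) \<otimes>\<^bsub>W\<^esub> (b, ns) = (a \<otimes>\<^bsub>A\<^esub> b, ns)"
  "(a, ms @ [m]) \<otimes>\<^bsub>W\<^esub> (b, ns) = (a, ms @ ract M m b # ns)"
  by (simp_all add: word_monoid_def)

lemma word_one: "\<one>\<^bsub>W\<^esub> = (\<one>\<^bsub>A\<^esub>, [])"
  by (simp add: word_monoid_def)

text \<open>Multiplying on the right by \<open>(b, ns)\<close> lets \<open>b\<close> act on the last letter, or on the
\<open>A\<close>-entry of a word without letters; this is the case distinction at the end of a list throughout.\<close>

lemma monoid_words: "Group.monoid W"
proof (rule monoidI)
  show "\<one>\<^bsub>W\<^esub> \<in> carrier W"
    by (simp add: word_one word_carrier)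
  fix u v w assume u: "u \<in> carrier W"
  obtain a us where [simp]: "u = (a, us)" by (cases u)
  note u' = u[unfolded \<open>u = (a, us)\<close> word_carrier]
  show "\<one>\<^bsub>W\<^esub> \<otimes>\<^bsub>W\<^esub> u = u"
    using u' by (simp add: word_one word_mult)
  show "u \<otimes>\<^bsub>W\<^esub> \<one>\<^bsub>W\<^esub> = u"
    using u' by (cases us rule: rev_cases) (simp_all add: word_one word_mult ract_one)
  assume v: "v \<in> carrier W"
  obtain b vs where [simp]: "v = (b, vs)" by (cases v)
  note v' = v[unfolded \<open>v = (b, vs)\<close> word_carrier]
  show "u \<otimes>\<^bsub>W\<^esub> v \<in> carrier W"
    using u' v' by (cases us rule: rev_cases) (auto simp: word_mult word_carrier ract_simps)
  assume w: "w \<in> carrier W"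
  obtain c ws where [simp]: "w = (c, ws)" by (cases w)
  note w' = w[unfolded \<open>w = (c, ws)\<close> word_carrier]
  have 2: "(x, xs @ y # ys @ [z]) \<otimes>\<^bsub>W\<^esub> (c, ws) = (x, xs @ y # ys @ ract M z c # ws)" for x xs y ys z
    using word_mult(2)[of x "xs @ y # ys" z c ws] by simp
  show "u \<otimes>\<^bsub>W\<^esub> v \<otimes>\<^bsub>W\<^esub> w = u \<otimes>\<^bsub>W\<^esub> (v \<otimes>\<^bsub>W\<^esub> w)"
    using u' v' w'
    by (cases us rule: rev_cases; cases vs rule: rev_cases)
      (simp_all add: word_mult 2 A.m_assoc ract_mult)
qed

sublocale W: monoid_algebra W
  by (simp add: monoid_algebra_def monoid_words)

abbreviation "R \<equiv> (\<Union>n. multilinear_rels A M n) \<union> balancing_rels A M"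

lemma words_subset: "words A M n \<subseteq> carrier W"
  by (auto simp: words_iff word_carrier)

lemma balancing_cases:
  assumes "r \<in> balancing_rels A M"
  obtains a b m ms where "r = delta (a \<otimes>\<^bsub>A\<^esub> b, m # ms) - delta (a, lact M b m # ms)"
      "a \<in> carrier A" "b \<in> carrier A" "m \<in> carrier M" "set ms \<subseteq> carrier M"
  | a b us m m' vs where
      "r = delta (a, us @ ract M m b # m' # vs) - delta (a, us @ m # lact M b m' # vs)"
      "a \<in> carrier A" "b \<in> carrier A" "m \<in> carrier M" "m' \<in> carrier M"
      "set us \<subseteq> carrier M" "set vs \<subseteq> carrier M"
  using assms unfolding balancing_rels_def in_lists_conv_set by blast

lemma balancing_rels_closed: "balancing_rels A M \<subseteq> carrier (free_space (carrier W))"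
proof
  fix r assume "r \<in> balancing_rels A M"
  then show "r \<in> carrier (free_space (carrier W))"
  proof (cases rule: balancing_cases)
    case 1
    show ?thesis unfolding 1(1)
      by (rule free_space_rel_closed) (use 1 in \<open>simp_all add: word_carrier lact_simps\<close>)
  next
    case 2
    show ?thesis unfolding 2(1)
      by (rule free_space_rel_closed) (use 2 in \<open>simp_all add: word_carrier lact_simps ract_simps\<close>)
  qed
qed

sublocale T: presentation "carrier W" R
proof (rule presentation.intro, rule Un_least)
  show "(\<Union>n. multilinear_rels A M n) \<subseteq> carrier (free_space (carrier W))"
    by (rule UN_least, rule AM.multilinear_rels_closed, rule words_subset)
qed (rule balancing_rels_closed)

abbreviation "TA \<equiv> tensor_alg A M"

lemma tensor_alg_rels_eq: "tensor_alg_rels A M = T.relspace"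
  unfolding tensor_alg_rels_def by (rule lin_span_cong) (rule W.monoid_calg_fields)+

lemma TA_fields:
  "carrier TA = carrier T.Q" "add TA = add T.Q" "zero TA = zero T.Q" "smult TA = smult T.Q"
  unfolding tensor_alg_def tensor_alg_rels_eq
  by (rule quot_cong, (rule W.monoid_calg_fields)+)+

lemma cspace_TA: "cspace TA"
  by (rule cspace_cong[OF T.quot_cspace]) (rule TA_fields)+

lemma lin_map_TA: "lin_map TA N f \<longleftrightarrow> lin_map T.Q N f"
  by (simp only: lin_map_def TA_fields)

lemma tensor_alg_elem_eq: "tensor_alg_elem A M a ms = T.cls (a, ms)"
  unfolding tensor_alg_elem_def tensor_alg_rels_eq
  by (rule fun_cong[OF fun_cong[OF quot_cong(1)]]) (rule W.monoid_calg_fields)+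

text \<open>The functions on words that factor through the tensor algebra as linear maps.\<close>

definition tensor_fun :: "(complex, 'b, 'z) module_scheme \<Rightarrow> ('a \<times> 'm list \<Rightarrow> 'b) \<Rightarrow> bool" where
  "tensor_fun B g \<longleftrightarrow> (\<forall>n. multilinear A M n B g) \<and>
     (\<forall>a b m ms. a \<in> carrier A \<and> b \<in> carrier A \<and> m \<in> carrier M \<and> set ms \<subseteq> carrier M \<longrightarrow>
        g (a \<otimes>\<^bsub>A\<^esub> b, m # ms) = g (a, lact M b m # ms)) \<and>
     (\<forall>a b us m m' vs. a \<in> carrier A \<and> b \<in> carrier A \<and> m \<in> carrier M \<and> m' \<in> carrier M \<and>
        set us \<subseteq> carrier M \<and> set vs \<subseteq> carrier M \<longrightarrow>
        g (a, us @ ract M m b # m' # vs) = g (a, us @ m # lact M b m' # vs))"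

lemma tensor_funI:
  assumes "\<And>ms. set ms \<subseteq> carrier M \<Longrightarrow> lin_map A B (\<lambda>a. g (a, ms))"
    and "\<And>a us vs. \<lbrakk>a \<in> carrier A; set us \<subseteq> carrier M; set vs \<subseteq> carrier M\<rbrakk> \<Longrightarrow>
      lin_map M B (\<lambda>m. g (a, us @ m # vs))"
    and "\<And>a b m ms. \<lbrakk>a \<in> carrier A; b \<in> carrier A; m \<in> carrier M; set ms \<subseteq> carrier M\<rbrakk> \<Longrightarrow>
      g (a \<otimes>\<^bsub>A\<^esub> b, m # ms) = g (a, lact M b m # ms)"
    and "\<And>a b us m m' vs. \<lbrakk>a \<in> carrier A; b \<in> carrier A; m \<in> carrier M; m' \<in> carrier M;
        set us \<subseteq> carrier M; set vs \<subseteq> carrier M\<rbrakk> \<Longrightarrow>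
      g (a, us @ ract M m b # m' # vs) = g (a, us @ m # lact M b m' # vs)"
  shows "tensor_fun B g"
  using assms unfolding tensor_fun_def multilinear_def by simp

lemma tensor_funD:
  assumes "tensor_fun B g"
  shows "set ms \<subseteq> carrier M \<Longrightarrow> lin_map A B (\<lambda>a. g (a, ms))"
    and "\<lbrakk>a \<in> carrier A; set us \<subseteq> carrier M; set vs \<subseteq> carrier M\<rbrakk> \<Longrightarrow>
      lin_map M B (\<lambda>m. g (a, us @ m # vs))"
    and "\<lbrakk>a \<in> carrier A; b \<in> carrier A; m \<in> carrier M; set ms \<subseteq> carrier M\<rbrakk> \<Longrightarrow>
      g (a \<otimes>\<^bsub>A\<^esub> b, m # ms) = g (a, lact M b m # ms)"
    and "\<lbrakk>a \<in> carrier A; b \<in> carrier A; m \<in> carrier M; m' \<in> carrier M;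
        set us \<subseteq> carrier M; set vs \<subseteq> carrier M\<rbrakk> \<Longrightarrow>
      g (a, us @ ract M m b # m' # vs) = g (a, us @ m # lact M b m' # vs)"
    and "multilinear A M n B g"
  using assms unfolding tensor_fun_def multilinear_def by simp_all

lemma tensor_fun_closed:
  assumes "tensor_fun B g" "w \<in> carrier W"
  shows "g w \<in> carrier B"
proof -
  obtain a ms where "w = (a, ms)" by (cases w)
  then show ?thesis
    using lin_mapD(1)[OF tensor_funD(1)[OF assms(1), of ms]] assms(2) by (simp add: word_carrier)
qed

lemma tensor_fun_rels:
  assumes "cspace B" "tensor_fun B g" "r \<in> R"
  shows "lin_ext B g r = \<zero>\<^bsub>B\<^esub>"
proof -
  have g: "g \<in> carrier W \<rightarrow> carrier B"
    using tensor_fun_closed[OF assms(2)] by blast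
  show ?thesis
    using assms(3)
  proof
    assume "r \<in> (\<Union>n. multilinear_rels A M n)"
    then obtain n where "r \<in> multilinear_rels A M n" by blast
    then show ?thesis
      by (rule AM.lin_ext_multilinear_rels[OF tensor_funD(5)[OF assms(2)] assms(1) g words_subset])
  next
    assume "r \<in> balancing_rels A M"
    then show ?thesis
    proof (cases rule: balancing_cases)
      case 1
      show ?thesis unfolding 1(1)
        by (rule lin_ext_eq_rel[OF assms(1) g])
          (use 1 in \<open>simp_all add: word_carrier lact_simps tensor_funD(3)[OF assms(2)]\<close>)
    next
      case 2
      show ?thesis unfolding 2(1)
        by (rule lin_ext_eq_rel[OF assms(1) g])
          (use 2 in \<open>simp_all add: word_carrier lact_simps ract_simps tensor_funD(4)[OF assms(2)]\<close>)
    qed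
  qed
qed

lemma tensor_fun_lift:
  assumes "cspace B" "tensor_fun B g"
  shows "lin_map T.Q B (quot_lift B g)"
    and "w \<in> carrier W \<Longrightarrow> quot_lift B g (T.cls w) = g w"
proof -
  have g: "g \<in> carrier W \<rightarrow> carrier B"
    using tensor_fun_closed[OF assms(2)] by blast
  note * = T.quot_lift[OF assms(1) g tensor_fun_rels[OF assms]]
  show "lin_map T.Q B (quot_lift B g)"
    by (rule *(1))
  show "w \<in> carrier W \<Longrightarrow> quot_lift B g (T.cls w) = g w"
    by (rule *(3))
qed

lemma tensor_fun_cls: "tensor_fun T.Q T.cls"
  unfolding tensor_fun_def
proof (intro conjI allI impI; (elim conjE)?)
  show "multilinear A M n T.Q T.cls" for n
    by (rule AM.multilinear_cls[OF T.presentation_axioms words_subset]) blast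
next
  fix a b m ms
  assume *: "a \<in> carrier A" "b \<in> carrier A" "m \<in> carrier M" "set ms \<subseteq> carrier M"
  show "T.cls (a \<otimes>\<^bsub>A\<^esub> b, m # ms) = T.cls (a, lact M b m # ms)"
  proof (rule T.cls_eq_rel)
    have "ms \<in> lists (carrier M)" using *(4) by auto
    then show "delta (a \<otimes>\<^bsub>A\<^esub> b, m # ms) - delta (a, lact M b m # ms) \<in> R"
      by (intro UnI2, unfold balancing_rels_def, use *(1-3) in blast)
  qed (use * in \<open>simp_all add: word_carrier lact_simps\<close>)
next
  fix a b us m m' vs
  assume *: "a \<in> carrier A" "b \<in> carrier A" "m \<in> carrier M" "m' \<in> carrier M"
    "set us \<subseteq> carrier M" "set vs \<subseteq> carrier M"
  show "T.cls (a, us @ ract M m b # m' # vs) = T.cls (a, us @ m # lact M b m' # vs)"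
  proof (rule T.cls_eq_rel)
    have "us \<in> lists (carrier M)" "vs \<in> lists (carrier M)" using *(5,6) by auto
    then show "delta (a, us @ ract M m b # m' # vs) - delta (a, us @ m # lact M b m' # vs) \<in> R"
      by (intro UnI2, unfold balancing_rels_def, use *(1-4) in blast)
  qed (use * in \<open>simp_all add: word_carrier lact_simps ract_simps\<close>)
qed

text \<open>Left multiplication by a word is itself compatible with the relations. Together with its mirror image
this shows that the span of the relations is a two-sided ideal.\<close>

lemma tensor_fun_mult_left:
  assumes g: "tensor_fun B g" and w: "w \<in> carrier W"
  shows "tensor_fun B (\<lambda>u. g (w \<otimes>\<^bsub>W\<^esub> u))"
proof -
  obtain b ns where [simp]: "w = (b, ns)" by (cases w)
  note w' = w[unfolded \<open>w = (b, ns)\<close> word_carrier]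
  show ?thesis
  proof (cases ns rule: rev_cases)
    case Nil
    show ?thesis
    proof (rule tensor_funI, unfold \<open>w = (b, ns)\<close> Nil word_mult, goal_cases)
      case (1 ms)
      with w' show ?case
        by (intro lin_map_comp[OF A.lin_mult(1) tensor_funD(1)[OF g]]) auto
    next
      case (2 a us vs)
      with w' show ?case
        by (intro tensor_funD(2)[OF g]) auto
    next
      case (3 a c m ms)
      with w' show ?case
        using tensor_funD(3)[OF g, of "b \<otimes>\<^bsub>A\<^esub> a" c m ms] by (simp add: A.m_assoc)
    next
      case (4 a c us m m' vs)
      with w' show ?case
        by (intro tensor_funD(4)[OF g]) auto
    qed
  next
    case (snoc xs l)
    then have l: "l \<in> carrier M" and xs: "set xs \<subseteq> carrier M" and b: "b \<in> carrier A"
      using w' by auto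
    show ?thesis
    proof (rule tensor_funI, unfold \<open>w = (b, ns)\<close> snoc word_mult, goal_cases)
      case (1 ms)
      then show ?case
        by (intro lin_map_comp[OF lin_ract'[OF l] tensor_funD(2)[OF g b xs]])
    next
      case (2 a us vs)
      then show ?case
        using tensor_funD(2)[OF g b, of "xs @ ract M l a # us" vs] xs l by (simp add: ract_simps)
    next
      case (3 a c m ms)
      then show ?case
        using tensor_funD(4)[OF g b, of c "ract M l a" m xs ms] xs l by (simp add: ract_simps ract_mult)
    next
      case (4 a c us m m' vs)
      then show ?case
        using tensor_funD(4)[OF g b, of c m m' "xs @ ract M l a # us" vs] xs l by (simp add: ract_simps)
    qed
  qed
qed

lemma word_mult_right_snoc:
  "(a, us @ m # ys @ [l]) \<otimes>\<^bsub>W\<^esub> (b, ns) = (a, us @ m # ys @ ract M l b # ns)"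
  "(a, us @ m # m' # ys @ [l]) \<otimes>\<^bsub>W\<^esub> (b, ns) = (a, us @ m # m' # ys @ ract M l b # ns)"
  "(a, us @ [m, m']) \<otimes>\<^bsub>W\<^esub> (b, ns) = (a, us @ m # ract M m' b # ns)"
  "(a, [m]) \<otimes>\<^bsub>W\<^esub> (b, ns) = (a, ract M m b # ns)"
  "(a, m # ys @ [l]) \<otimes>\<^bsub>W\<^esub> (b, ns) = (a, m # ys @ ract M l b # ns)"
  using word_mult(2)[of a "us @ m # ys" l b ns] word_mult(2)[of a "us @ m # m' # ys" l b ns]
    word_mult(2)[of a "us @ [m]" m' b ns] word_mult(2)[of a "[]" m b ns]
    word_mult(2)[of a "m # ys" l b ns] by simp_all

lemma tensor_fun_mult_right:
  assumes g: "tensor_fun B g" and w: "w \<in> carrier W"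
  shows "tensor_fun B (\<lambda>u. g (u \<otimes>\<^bsub>W\<^esub> w))"
proof -
  obtain b ns where [simp]: "w = (b, ns)" by (cases w)
  have b: "b \<in> carrier A" and ns: "set ns \<subseteq> carrier M"
    using w by (simp_all add: word_carrier)
  show ?thesis
  proof (rule tensor_funI, unfold \<open>w = (b, ns)\<close>, goal_cases)
    case (1 ms)
    show ?case
    proof (cases ms rule: rev_cases)
      case Nil
      then show ?thesis
        using lin_map_comp[OF A.lin_mult(2)[OF b] tensor_funD(1)[OF g ns]] by (simp add: word_mult)
    next
      case (snoc ys l)
      then show ?thesis
        using tensor_funD(1)[OF g, of "ys @ ract M l b # ns"] 1 b ns by (simp add: word_mult ract_simps)
    qed
  next
    case (2 a us vs)
    show ?case
    proof (cases vs rule: rev_cases)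
      case Nil
      then show ?thesis
        using lin_map_comp[OF lin_ract[OF b] tensor_funD(2)[OF g 2(1,2) ns]] by (simp add: word_mult)
    next
      case (snoc ys l)
      then show ?thesis
        using tensor_funD(2)[OF g 2(1,2), of "ys @ ract M l b # ns"] 2 b ns
        by (simp add: word_mult_right_snoc ract_simps)
    qed
  next
    case (3 a c m ms)
    show ?case
    proof (cases ms rule: rev_cases)
      case Nil
      then show ?thesis
        using tensor_funD(3)[OF g 3(1,2), of "ract M m b" ns] 3 b ns
        by (simp add: word_mult_right_snoc ract_simps lact_ract)
    next
      case (snoc ys l)
      then show ?thesis
        using tensor_funD(3)[OF g 3(1,2,3), of "ys @ ract M l b # ns"] 3 b ns
        by (simp add: word_mult_right_snoc ract_simps)
    qed
  next
    case (4 a c us m m' vs)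
    show ?case
    proof (cases vs rule: rev_cases)
      case Nil
      then show ?thesis
        using tensor_funD(4)[OF g 4(1,2,3) _ 4(5) ns, of "ract M m' b"] 4 b
        by (simp add: word_mult_right_snoc ract_simps lact_ract)
    next
      case (snoc ys l)
      then show ?thesis
        using tensor_funD(4)[OF g 4(1-5), of "ys @ ract M l b # ns"] 4 b ns
        by (simp add: word_mult_right_snoc ract_simps)
    qed
  qed
qed

abbreviation "cst x \<equiv> T.relspace +>\<^bsub>free_space (carrier W)\<^esub> x"
abbreviation "F \<equiv> free_space (carrier W)"

lemma relspace_subspace: "submodule T.relspace complex_field F"
  by (rule T.subspace)

lemma relspace_closed: "x \<in> T.relspace \<Longrightarrow> x \<in> carrier F"
  by (rule subsetD[OF cspace.subspaceD(1)[OF cspace_free_space relspace_subspace]])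

text \<open>Multiplication by a word, followed by the projection to the quotient, satisfies all relations as a
function on words; hence it vanishes on their span.\<close>

lemma relspace_delta_mult:
  assumes w: "w \<in> carrier W" and n: "n \<in> T.relspace"
  shows "delta w \<otimes>\<^bsub>W.K\<^esub> n \<in> T.relspace" "n \<otimes>\<^bsub>W.K\<^esub> delta w \<in> T.relspace"
proof -
  note dw = delta_closed[OF w]
  have *: "f n \<in> T.relspace"
    if f: "lin_map F F f" and g: "tensor_fun T.Q (\<lambda>u. cst (f (delta u)))" for f
  proof -
    interpret q: lin F T.Q "\<lambda>x. cst (f x)"
      by (rule linI[OF cspace_free_space T.quot_cspace lin_map_comp[OF f T.lin_coset]])
    let ?g = "\<lambda>u. cst (f (delta u))"
    have gc: "?g \<in> carrier W \<rightarrow> carrier T.Q"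
      using tensor_fun_closed[OF g] by blast
    have eq: "cst (f x) = lin_ext T.Q ?g x" if x: "x \<in> carrier F" for x
      by (rule lin_map_free_eq[OF T.quot_cspace q.lin lin_lin_ext[OF T.quot_cspace gc] _ x])
        (simp only: lin_ext_delta[OF T.quot_cspace gc])
    have "T.relspace \<subseteq> {x \<in> carrier F. cst (f x) = \<zero>\<^bsub>T.Q\<^esub>}"
    proof (rule T.lin_span_least[OF q.kernel_subspace], rule subsetI)
      fix r assume r: "r \<in> R"
      then have "r \<in> carrier F" using T.rels by blast
      then show "r \<in> {x \<in> carrier F. cst (f x) = \<zero>\<^bsub>T.Q\<^esub>}"
        using eq tensor_fun_rels[OF T.quot_cspace g r] by blast
    qed
    then have "cst (f n) = T.relspace"
      using n T.quot_zero by blast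
    then show ?thesis
      using T.coset_eq_N_iff[OF lin_mapD(1)[OF f relspace_closed[OF n]]] by simp
  qed
  have eq: "tensor_fun T.Q g" if "tensor_fun T.Q g'" "\<And>u. g u = g' u" for g g'
  proof -
    have "g = g'" using that(2) by blast
    with that(1) show ?thesis by simp
  qed
  show "delta w \<otimes>\<^bsub>W.K\<^esub> n \<in> T.relspace"
    by (rule *[OF W.lin_mult_right[OF dw] eq[OF tensor_fun_mult_left[OF tensor_fun_cls w]]])
      (simp only: W.mult_delta)
  show "n \<otimes>\<^bsub>W.K\<^esub> delta w \<in> T.relspace"
    by (rule *[OF W.lin_mult_left[OF dw] eq[OF tensor_fun_mult_right[OF tensor_fun_cls w]]])
      (simp only: W.mult_delta)
qed

lemma ideal_relspace: "ideal T.relspace W.K"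
proof (rule idealI)
  show "ring W.K"
    by (rule W.ring_monoid_calg)
  have "submodule T.relspace complex_field W.K"
    using relspace_subspace by (subst submodule_cong[of W.K F]) (rule W.monoid_calg_fields)+
  then show "subgroup T.relspace (add_monoid W.K)"
    by (simp add: submodule_def)
  fix n x assume n: "n \<in> T.relspace" and "x \<in> carrier W.K"
  then have x: "x \<in> carrier F" by (simp only: W.monoid_calg_fields)
  note nF = relspace_closed[OF n]
  interpret r: lin F F "\<lambda>x. x \<otimes>\<^bsub>W.K\<^esub> n"
    by (rule linI[OF cspace_free_space cspace_free_space W.lin_mult_left[OF nF]])
  interpret l: lin F F "\<lambda>x. n \<otimes>\<^bsub>W.K\<^esub> x"
    by (rule linI[OF cspace_free_space cspace_free_space W.lin_mult_right[OF nF]])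
  have "x \<in> {x \<in> carrier F. x \<otimes>\<^bsub>W.K\<^esub> n \<in> T.relspace}"
    by (rule free_space_induct[OF r.vimage_subspace[OF relspace_subspace] _ x])
      (rule CollectI, intro conjI delta_closed relspace_delta_mult n)
  then show "x \<otimes>\<^bsub>W.K\<^esub> n \<in> T.relspace" by blast
  have "x \<in> {x \<in> carrier F. n \<otimes>\<^bsub>W.K\<^esub> x \<in> T.relspace}"
    by (rule free_space_induct[OF l.vimage_subspace[OF relspace_subspace] _ x])
      (rule CollectI, intro conjI delta_closed relspace_delta_mult n)
  then show "n \<otimes>\<^bsub>W.K\<^esub> x \<in> T.relspace" by blast
qed

end


lemma calg_homI:
  assumes "lin_map A B h" "h \<one>\<^bsub>A\<^esub> = \<one>\<^bsub>B\<^esub>"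
    and "\<And>x y. x \<in> carrier A \<Longrightarrow> y \<in> carrier A \<Longrightarrow> h (x \<otimes>\<^bsub>A\<^esub> y) = h x \<otimes>\<^bsub>B\<^esub> h y"
  shows "h \<in> calg_hom A B"
  using assms by (auto simp: calg_hom_def lin_map_def intro!: ring_hom_memI)

lemma calg_homD:
  assumes "h \<in> calg_hom A B"
  shows "lin_map A B h" "h \<one>\<^bsub>A\<^esub> = \<one>\<^bsub>B\<^esub>"
    and "x \<in> carrier A \<Longrightarrow> y \<in> carrier A \<Longrightarrow> h (x \<otimes>\<^bsub>A\<^esub> y) = h x \<otimes>\<^bsub>B\<^esub> h y"
  using assms by (auto simp: calg_hom_def lin_map_def ring_hom_def)

lemma ring_cong:
  assumes "ring R" "carrier S = carrier R" "add S = add R" "zero S = zero R" "mult S = mult R"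
    "one S = one R"
  shows "ring S"
proof -
  interpret ring R by fact
  have "\<exists>y\<in>carrier R. y \<oplus>\<^bsub>R\<^esub> x = \<zero>\<^bsub>R\<^esub>" if "x \<in> carrier R" for x
    using l_neg[OF that] a_inv_closed[OF that] by blast
  then show ?thesis
    by (intro ringI abelian_groupI monoidI)
      (simp_all add: assms a_ac m_assoc l_distr r_distr)
qed

context tensor_algebra
begin

lemma TA_eq: "TA = W.K QuotC T.relspace"
  by (simp only: tensor_alg_def tensor_alg_rels_eq)

lemma K_coset: "a_r_coset W.K = a_r_coset F"
  by (rule quot_cong(1)) (rule W.monoid_calg_fields)+

lemma TA_carrier: "carrier TA = cst ` carrier F"
  by (simp only: TA_fields T.quot_carrier)

lemma TA_mult:
  assumes "x \<in> carrier F" "y \<in> carrier F"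
  shows "cst x \<otimes>\<^bsub>TA\<^esub> cst y = cst (x \<otimes>\<^bsub>W.K\<^esub> y)"
proof -
  have "x \<in> carrier W.K" "y \<in> carrier W.K"
    using assms by (simp_all only: W.monoid_calg_fields)
  from ideal.rcoset_mult_add[OF ideal_relspace this] show ?thesis
    unfolding TA_eq cquot_def K_coset module.simps monoid.simps ring.simps .
qed

lemma TA_one: "\<one>\<^bsub>TA\<^esub> = T.cls \<one>\<^bsub>W\<^esub>"
  unfolding TA_eq cquot_def K_coset by (simp only: monoid.simps W.monoid_calg_fields)

lemma cls_mult:
  assumes "u \<in> carrier W" "v \<in> carrier W"
  shows "T.cls u \<otimes>\<^bsub>TA\<^esub> T.cls v = T.cls (u \<otimes>\<^bsub>W\<^esub> v)"
  using TA_mult[OF delta_closed[OF assms(1)] delta_closed[OF assms(2)]]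
  by (simp only: W.mult_delta)

lemma ring_TA: "ring TA"
  by (rule ring_cong[OF ideal.quotient_is_ring[OF ideal_relspace]])
    (simp_all add: TA_eq cquot_def FactRing_def)

lemma lin_TA_mult:
  assumes "X \<in> carrier TA"
  shows "lin_map TA TA (\<lambda>Y. X \<otimes>\<^bsub>TA\<^esub> Y)" "lin_map TA TA (\<lambda>Y. Y \<otimes>\<^bsub>TA\<^esub> X)"
proof -
  interpret TA: ring TA by (rule ring_TA)
  obtain x where x: "x \<in> carrier F" "X = cst x"
    using assms unfolding TA_carrier by blast
  have sc: "c \<odot>\<^bsub>TA\<^esub> cst y = cst (c \<odot>\<^bsub>F\<^esub> y)" if "y \<in> carrier F" for c y
    using T.quot_scale[OF that] by (simp only: TA_fields)
  note cl = cspace.scale_closed[OF cspace_free_space]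
  show "lin_map TA TA (\<lambda>Y. X \<otimes>\<^bsub>TA\<^esub> Y)"
  proof (rule lin_mapI)
    fix Y c assume Y: "Y \<in> carrier TA"
    then show "X \<otimes>\<^bsub>TA\<^esub> Y \<in> carrier TA"
      using assms by (rule TA.m_closed[rotated])
    obtain y where y: "y \<in> carrier F" "Y = cst y"
      using Y unfolding TA_carrier by blast
    show "X \<otimes>\<^bsub>TA\<^esub> (c \<odot>\<^bsub>TA\<^esub> Y) = c \<odot>\<^bsub>TA\<^esub> (X \<otimes>\<^bsub>TA\<^esub> Y)"
      unfolding x y sc[OF y(1)] TA_mult[OF x(1) y(1)] sc[OF W.mult_closed[OF x(1) y(1)]]
        TA_mult[OF x(1) cl[OF y(1)]] lin_mapD(3)[OF W.lin_mult_right[OF x(1)] y(1)] ..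
    show "X \<otimes>\<^bsub>TA\<^esub> (Y \<oplus>\<^bsub>TA\<^esub> Z) = X \<otimes>\<^bsub>TA\<^esub> Y \<oplus>\<^bsub>TA\<^esub> X \<otimes>\<^bsub>TA\<^esub> Z" if "Z \<in> carrier TA" for Z
      by (rule TA.r_distr[OF Y that assms])
  qed
  show "lin_map TA TA (\<lambda>Y. Y \<otimes>\<^bsub>TA\<^esub> X)"
  proof (rule lin_mapI)
    fix Y c assume Y: "Y \<in> carrier TA"
    then show "Y \<otimes>\<^bsub>TA\<^esub> X \<in> carrier TA"
      using assms by (rule TA.m_closed)
    obtain y where y: "y \<in> carrier F" "Y = cst y"
      using Y unfolding TA_carrier by blast
    show "(c \<odot>\<^bsub>TA\<^esub> Y) \<otimes>\<^bsub>TA\<^esub> X = c \<odot>\<^bsub>TA\<^esub> (Y \<otimes>\<^bsub>TA\<^esub> X)"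
      unfolding x y sc[OF y(1)] TA_mult[OF y(1) x(1)] sc[OF W.mult_closed[OF y(1) x(1)]]
        TA_mult[OF cl[OF y(1)] x(1)] lin_mapD(3)[OF W.lin_mult_left[OF x(1)] y(1)] ..
    show "(Y \<oplus>\<^bsub>TA\<^esub> Z) \<otimes>\<^bsub>TA\<^esub> X = Y \<otimes>\<^bsub>TA\<^esub> X \<oplus>\<^bsub>TA\<^esub> Z \<otimes>\<^bsub>TA\<^esub> X" if "Z \<in> carrier TA" for Z
      by (rule TA.l_distr[OF Y that assms])
  qed
qed

lemma cls_TA: "w \<in> carrier W \<Longrightarrow> T.cls w \<in> carrier TA"
  using T.cls_closed by (simp only: TA_fields)

lemma lin_map_TA_eq:
  assumes "cspace N" "lin_map TA N f" "lin_map TA N g"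
    and "\<And>w. w \<in> carrier W \<Longrightarrow> f (T.cls w) = g (T.cls w)" "X \<in> carrier TA"
  shows "f X = g X"
  by (rule T.lin_map_eq[OF assms(1) assms(2,3)[unfolded lin_map_TA] assms(4)])
    (use assms(5) in \<open>simp_all only: TA_fields\<close>)

text \<open>The homomorphism sends \<open>a \<otimes> m\<^sub>1 \<otimes> \<dots> \<otimes> m\<^sub>n\<close> to
\<open>rho a * theta m\<^sub>1 * \<dots> * theta m\<^sub>n\<close>. This respects the balancing relations because \<open>theta\<close> is a
bimodule map, and it is multiplicative on words for the same reason.\<close>

theorem tensor_algebra_universal:
  fixes B :: "(complex, 'b) module"
  assumes "calgebra B" and rho: "rho \<in> calg_hom A B" and theta: "lin_map M B theta"
    and th_l: "\<And>a m. a \<in> carrier A \<Longrightarrow> m \<in> carrier M \<Longrightarrow> theta (lact M a m) = rho a \<otimes>\<^bsub>B\<^esub> theta m"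
    and th_r: "\<And>a m. a \<in> carrier A \<Longrightarrow> m \<in> carrier M \<Longrightarrow> theta (ract M m a) = theta m \<otimes>\<^bsub>B\<^esub> rho a"
  shows "\<exists>T\<in>calg_hom TA B. (\<forall>a\<in>carrier A. T (tensor_alg_elem A M a []) = rho a) \<and>
    (\<forall>m\<in>carrier M. T (tensor_alg_elem A M \<one>\<^bsub>A\<^esub> [m]) = theta m)"
proof -
  interpret B: calg B using assms(1) by (simp add: calg_def)
  define P where "P ms = foldr (\<lambda>m x. theta m \<otimes>\<^bsub>B\<^esub> x) ms \<one>\<^bsub>B\<^esub>" for ms
  define g where "g = (\<lambda>(a, ms). rho a \<otimes>\<^bsub>B\<^esub> P ms)"
  note rhoD = calg_homD[OF rho]
  have rc: "rho a \<in> carrier B" if "a \<in> carrier A" for a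
    by (rule lin_mapD(1)[OF rhoD(1) that])
  have tc: "theta m \<in> carrier B" if "m \<in> carrier M" for m
    by (rule lin_mapD(1)[OF theta that])
  have P_Nil: "P [] = \<one>\<^bsub>B\<^esub>" and P_Cons: "P (m # ms) = theta m \<otimes>\<^bsub>B\<^esub> P ms" for m ms
    by (simp_all add: P_def)
  have Pc: "P ms \<in> carrier B" if "set ms \<subseteq> carrier M" for ms
    using that by (induction ms) (simp_all add: P_Nil P_Cons tc)
  have P_app: "P (us @ vs) = P us \<otimes>\<^bsub>B\<^esub> P vs" if "set us \<subseteq> carrier M" "set vs \<subseteq> carrier M" for us vs
    using that by (induction us) (simp_all add: P_Nil P_Cons tc Pc B.m_assoc)
  have g: "tensor_fun B g"
  proof (rule tensor_funI)
    fix ms assume ms: "set ms \<subseteq> carrier M"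
    show "lin_map A B (\<lambda>a. g (a, ms))"
      unfolding g_def split_conv by (rule lin_map_comp[OF rhoD(1) B.lin_mult(2)[OF Pc[OF ms]]])
  next
    fix a us vs assume a: "a \<in> carrier A" and us: "set us \<subseteq> carrier M" and vs: "set vs \<subseteq> carrier M"
    have "lin_map M B (\<lambda>m. (rho a \<otimes>\<^bsub>B\<^esub> P us) \<otimes>\<^bsub>B\<^esub> (theta m \<otimes>\<^bsub>B\<^esub> P vs))"
      by (rule lin_map_comp[OF lin_map_comp[OF theta B.lin_mult(2)[OF Pc[OF vs]]]
            B.lin_mult(1)[OF B.m_closed[OF rc[OF a] Pc[OF us]]]])
    then show "lin_map M B (\<lambda>m. g (a, us @ m # vs))"
      by (rule lin_map_cong) (use a us vs in \<open>simp_all add: g_def P_app P_Cons Pc rc tc B.m_assoc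
          M.cspace_axioms\<close>)
  next
    fix a b m ms
    assume "a \<in> carrier A" "b \<in> carrier A" "m \<in> carrier M" "set ms \<subseteq> carrier M"
    then show "g (a \<otimes>\<^bsub>A\<^esub> b, m # ms) = g (a, lact M b m # ms)"
      by (simp add: g_def P_Cons rhoD th_l rc tc Pc B.m_assoc)
  next
    fix a b us m m' vs
    assume "a \<in> carrier A" "b \<in> carrier A" "m \<in> carrier M" "m' \<in> carrier M"
      "set us \<subseteq> carrier M" "set vs \<subseteq> carrier M"
    then show "g (a, us @ ract M m b # m' # vs) = g (a, us @ m # lact M b m' # vs)"
      by (simp add: g_def P_app P_Cons rhoD th_l th_r rc tc Pc B.m_assoc lact_simps ract_simps)
  qed
  let ?T = "quot_lift B g"
  note T = tensor_fun_lift[OF B.cspace_axioms g]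
  have lT: "lin_map TA B ?T"
    using T(1) by (simp only: lin_map_TA)
  have g_mult: "g (u \<otimes>\<^bsub>W\<^esub> v) = g u \<otimes>\<^bsub>B\<^esub> g v" if u: "u \<in> carrier W" and v: "v \<in> carrier W" for u v
  proof -
    obtain a ms b ns where [simp]: "u = (a, ms)" "v = (b, ns)" by (cases u; cases v)
    have "a \<in> carrier A" "set ms \<subseteq> carrier M" "b \<in> carrier A" "set ns \<subseteq> carrier M"
      using u v by (simp_all add: word_carrier)
    then show ?thesis
      by (cases ms rule: rev_cases)
        (simp_all add: word_mult g_def P_app P_Cons P_Nil rhoD th_r rc tc Pc B.m_assoc ract_simps)
  qed
  have T_mult: "?T (X \<otimes>\<^bsub>TA\<^esub> Y) = ?T X \<otimes>\<^bsub>B\<^esub> ?T Y" if X: "X \<in> carrier TA" and Y: "Y \<in> carrier TA" for X Y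
  proof -
    note cT = lin_mapD(1)[OF lT]
    have 1: "?T (T.cls u \<otimes>\<^bsub>TA\<^esub> Y) = ?T (T.cls u) \<otimes>\<^bsub>B\<^esub> ?T Y" if u: "u \<in> carrier W" for u
    proof (rule lin_map_TA_eq[OF B.cspace_axioms lin_map_comp[OF lin_TA_mult(1)[OF cls_TA[OF u]] lT]
          lin_map_comp[OF lT B.lin_mult(1)[OF cT[OF cls_TA[OF u]]]] _ Y])
      fix v assume v: "v \<in> carrier W"
      then show "?T (T.cls u \<otimes>\<^bsub>TA\<^esub> T.cls v) = ?T (T.cls u) \<otimes>\<^bsub>B\<^esub> ?T (T.cls v)"
        using u monoid.m_closed[OF monoid_words u v] by (simp only: cls_mult T(2) g_mult)
    qed
    show ?thesis
      by (rule lin_map_TA_eq[OF B.cspace_axioms lin_map_comp[OF lin_TA_mult(2)[OF Y] lT]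
          lin_map_comp[OF lT B.lin_mult(2)[OF cT[OF Y]]] _ X]) (rule 1)
  qed
  have one: "\<one>\<^bsub>W\<^esub> \<in> carrier W"
    by (rule monoid.one_closed[OF monoid_words])
  have "?T \<in> calg_hom TA B"
  proof (rule calg_homI[OF lT _ T_mult])
    show "?T \<one>\<^bsub>TA\<^esub> = \<one>\<^bsub>B\<^esub>"
      unfolding TA_one T(2)[OF one] by (simp add: word_one g_def P_Nil rhoD)
  qed
  moreover have "?T (tensor_alg_elem A M a []) = rho a" if "a \<in> carrier A" for a
    using that T(2)[of "(a, [])"] by (simp add: tensor_alg_elem_eq word_carrier g_def P_Nil rc)
  moreover have "?T (tensor_alg_elem A M \<one>\<^bsub>A\<^esub> [m]) = theta m" if "m \<in> carrier M" for m
    using that T(2)[of "(\<one>\<^bsub>A\<^esub>, [m])"]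
    by (simp add: tensor_alg_elem_eq word_carrier g_def P_Nil P_Cons rc tc rhoD)
  ultimately show ?thesis
    by blast
qed

lemma elem_closed: "a \<in> carrier A \<Longrightarrow> set ms \<subseteq> carrier M \<Longrightarrow> tensor_alg_elem A M a ms \<in> carrier TA"
  unfolding tensor_alg_elem_eq by (rule cls_TA) (simp add: word_carrier)

lemma elem_mult:
  assumes "a \<in> carrier A" "b \<in> carrier A" "m \<in> carrier M" "set ms \<subseteq> carrier M" "set ns \<subseteq> carrier M"
  shows "tensor_alg_elem A M a [] \<otimes>\<^bsub>TA\<^esub> tensor_alg_elem A M b ns = tensor_alg_elem A M (a \<otimes>\<^bsub>A\<^esub> b) ns"
    and "tensor_alg_elem A M a (ms @ [m]) \<otimes>\<^bsub>TA\<^esub> tensor_alg_elem A M b ns =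
      tensor_alg_elem A M a (ms @ ract M m b # ns)"
  unfolding tensor_alg_elem_eq using assms
  by (subst cls_mult; simp only: word_mult word_carrier; simp)+

lemma elem_1_lin: "lin_map M TA (\<lambda>m. tensor_alg_elem A M \<one>\<^bsub>A\<^esub> [m])"
  using tensor_funD(2)[OF tensor_fun_cls, of "\<one>\<^bsub>A\<^esub>" "[]" "[]"]
  unfolding tensor_alg_elem_eq lin_map_def TA_fields by simp

lemma elem_1_lact:
  assumes "a \<in> carrier A" "m \<in> carrier M"
  shows "tensor_alg_elem A M \<one>\<^bsub>A\<^esub> [lact M a m] =
      tensor_alg_elem A M a [] \<otimes>\<^bsub>TA\<^esub> tensor_alg_elem A M \<one>\<^bsub>A\<^esub> [m]"
proof -
  have "tensor_alg_elem A M \<one>\<^bsub>A\<^esub> [lact M a m] = tensor_alg_elem A M (\<one>\<^bsub>A\<^esub> \<otimes>\<^bsub>A\<^esub> a) [m]"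
    using tensor_funD(3)[OF tensor_fun_cls, of "\<one>\<^bsub>A\<^esub>" a m "[]"] assms
    unfolding tensor_alg_elem_eq by simp
  then show ?thesis
    using elem_mult(1)[of a "\<one>\<^bsub>A\<^esub>" m "[]" "[m]"] assms by simp
qed

lemma elem_1_ract:
  assumes "a \<in> carrier A" "m \<in> carrier M"
  shows "tensor_alg_elem A M \<one>\<^bsub>A\<^esub> [ract M m a] =
      tensor_alg_elem A M \<one>\<^bsub>A\<^esub> [m] \<otimes>\<^bsub>TA\<^esub> tensor_alg_elem A M a []"
  using elem_mult(2)[of "\<one>\<^bsub>A\<^esub>" a m "[]" "[]"] assms by simp

text \<open>The tensor algebra is generated in degrees \<open>0\<close> and \<open>1\<close>: appending a letter \<open>m\<close> to a word is
multiplication by \<open>1 \<otimes> m\<close>.\<close>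

lemma hom_eqI:
  assumes "cspace B" "S \<in> calg_hom TA B" "T \<in> calg_hom TA B"
    and 0: "\<And>a. a \<in> carrier A \<Longrightarrow> S (tensor_alg_elem A M a []) = T (tensor_alg_elem A M a [])"
    and 1: "\<And>m. m \<in> carrier M \<Longrightarrow> S (tensor_alg_elem A M \<one>\<^bsub>A\<^esub> [m]) = T (tensor_alg_elem A M \<one>\<^bsub>A\<^esub> [m])"
    and "X \<in> carrier TA"
  shows "S X = T X"
proof (rule lin_map_TA_eq[OF assms(1) calg_homD(1)[OF assms(2)] calg_homD(1)[OF assms(3)] _ assms(6)])
  fix w assume "w \<in> carrier W"
  moreover obtain a ms where w: "w = (a, ms)" by (cases w)
  ultimately have a: "a \<in> carrier A" and ms: "set ms \<subseteq> carrier M"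
    by (simp_all add: word_carrier)
  have "S (tensor_alg_elem A M a ms) = T (tensor_alg_elem A M a ms)"
    using ms
  proof (induction ms rule: rev_induct)
    case Nil
    then show ?case by (rule_tac 0[OF a])
  next
    case (snoc m ms)
    then have m: "m \<in> carrier M" and ms: "set ms \<subseteq> carrier M" by auto
    have "tensor_alg_elem A M a (ms @ [m]) =
        tensor_alg_elem A M a ms \<otimes>\<^bsub>TA\<^esub> tensor_alg_elem A M \<one>\<^bsub>A\<^esub> [m]"
    proof (cases ms rule: rev_cases)
      case Nil
      then show ?thesis
        using elem_mult(1)[of a "\<one>\<^bsub>A\<^esub>" m "[]" "[m]"] a m by simp
    next
      case (snoc ns n)
      then show ?thesis
        using elem_mult(2)[of a "\<one>\<^bsub>A\<^esub>" n ns "[m]"] a m ms by (simp add: ract_one)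
    qed
    moreover have "tensor_alg_elem A M a ms \<in> carrier TA" "tensor_alg_elem A M \<one>\<^bsub>A\<^esub> [m] \<in> carrier TA"
      using a m ms by (simp_all add: elem_closed)
    ultimately show ?case
      using snoc.IH[OF ms] 1[OF m] calg_homD(3)[OF assms(2)] calg_homD(3)[OF assms(3)] by simp
  qed
  then show "S (T.cls w) = T (T.cls w)"
    by (simp only: w tensor_alg_elem_eq)
qed

end


section \<open>Lifting derivations from quasi-free algebras\<close>

lemma calgebraI:
  assumes "cspace A" "bilinear A A A (mult A)" "\<one>\<^bsub>A\<^esub> \<in> carrier A"
    and "\<And>x y z. \<lbrakk>x \<in> carrier A; y \<in> carrier A; z \<in> carrier A\<rbrakk> \<Longrightarrow>
      x \<otimes>\<^bsub>A\<^esub> y \<otimes>\<^bsub>A\<^esub> z = x \<otimes>\<^bsub>A\<^esub> (y \<otimes>\<^bsub>A\<^esub> z)"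
    and "\<And>x. x \<in> carrier A \<Longrightarrow> \<one>\<^bsub>A\<^esub> \<otimes>\<^bsub>A\<^esub> x = x" "\<And>x. x \<in> carrier A \<Longrightarrow> x \<otimes>\<^bsub>A\<^esub> \<one>\<^bsub>A\<^esub> = x"
  shows "calgebra A"
proof -
  interpret cspace A by fact
  note r = lin_mapD[OF bilinearD(1)[OF assms(2)]] and l = lin_mapD[OF bilinearD(2)[OF assms(2)]]
  have "ring A"
    by (intro ringI monoidI abelian_group_axioms assms l r)
  then show ?thesis
    by (intro calgebra.intro is_module calgebra_axioms.intro l r)
qed

text \<open>Scalar multiplication by \<open>c\<close> is multiplication by the element \<open>c 1\<close>.\<close>

lemma ideal_subspace:
  assumes "calgebra R" "ideal I R"
  shows "submodule I complex_field R"
proof -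
  interpret R: calgebra R by fact
  interpret ideal I R by fact
  show ?thesis
  proof (rule R.subspaceI)
    fix c x assume x: "x \<in> I"
    then have "c \<odot>\<^bsub>R\<^esub> x = (c \<odot>\<^bsub>R\<^esub> \<one>\<^bsub>R\<^esub>) \<otimes>\<^bsub>R\<^esub> x"
      using a_subset by (simp add: R.smult_mult_left subset_iff)
    then show "c \<odot>\<^bsub>R\<^esub> x \<in> I"
      using x by (simp add: I_l_closed)
  qed (use a_subset in auto)
qed

lemma coset_calg_hom:
  assumes "calgebra R" "ideal I R"
  shows "(\<lambda>x. I +>\<^bsub>R\<^esub> x) \<in> calg_hom R (R QuotC I)"
proof -
  interpret R: calgebra R by fact
  interpret I: ideal I R by fact
  interpret q: quotient R I
    by (intro quotient.intro quotient_axioms.intro R.cspace_axioms ideal_subspace[OF assms])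
  show ?thesis
  proof (rule calg_homI[OF q.lin_coset])
    show "I +>\<^bsub>R\<^esub> \<one>\<^bsub>R\<^esub> = \<one>\<^bsub>R QuotC I\<^esub>"
      by (simp add: cquot_def)
    fix x y assume "x \<in> carrier R" "y \<in> carrier R"
    from I.rcoset_mult_add[OF this]
    show "I +>\<^bsub>R\<^esub> (x \<otimes>\<^bsub>R\<^esub> y) = (I +>\<^bsub>R\<^esub> x) \<otimes>\<^bsub>R QuotC I\<^esub> (I +>\<^bsub>R\<^esub> y)"
      by (simp add: cquot_def)
  qed
qed

text \<open>A homomorphism to \<open>R / I\<close>, given by representatives in \<open>R\<close>. In this form it can be moved to an
isomorphic copy of \<open>R\<close> by composing functions, without mentioning cosets.\<close>

definition hom_mod :: "(complex, 'a, 'x) module_scheme \<Rightarrow> (complex, 'r, 'y) module_scheme \<Rightarrow> 'r set \<Rightarrow>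
    ('a \<Rightarrow> 'r) \<Rightarrow> bool" where
  "hom_mod A R I f \<longleftrightarrow> (\<forall>a\<in>carrier A. f a \<in> carrier R) \<and>
     (\<forall>a\<in>carrier A. \<forall>b\<in>carrier A. I +>\<^bsub>R\<^esub> f (a \<oplus>\<^bsub>A\<^esub> b) = I +>\<^bsub>R\<^esub> (f a \<oplus>\<^bsub>R\<^esub> f b)) \<and>
     (\<forall>c. \<forall>a\<in>carrier A. I +>\<^bsub>R\<^esub> f (c \<odot>\<^bsub>A\<^esub> a) = I +>\<^bsub>R\<^esub> (c \<odot>\<^bsub>R\<^esub> f a)) \<and>
     (\<forall>a\<in>carrier A. \<forall>b\<in>carrier A. I +>\<^bsub>R\<^esub> f (a \<otimes>\<^bsub>A\<^esub> b) = I +>\<^bsub>R\<^esub> (f a \<otimes>\<^bsub>R\<^esub> f b)) \<and>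
     I +>\<^bsub>R\<^esub> f \<one>\<^bsub>A\<^esub> = I +>\<^bsub>R\<^esub> \<one>\<^bsub>R\<^esub>"

lemma hom_mod_quot:
  assumes "calgebra R" "ideal I R" "hom_mod A R I f"
  shows "(\<lambda>a. I +>\<^bsub>R\<^esub> f a) \<in> calg_hom A (R QuotC I)"
proof -
  note h = calg_homD[OF coset_calg_hom[OF assms(1,2)]] and l = lin_mapD[OF h(1)]
  note f = assms(3)[unfolded hom_mod_def]
  show ?thesis
    by (intro calg_homI lin_mapI) (use f in \<open>simp_all flip: h(2,3) l(2,3) add: l(1)\<close>)
qed

text \<open>A lifting problem only depends on the isomorphism class of the extension. So the lifting
  property for algebras over one carrier type gives it for every algebra \<open>R\<close> whose carrier injects
  into that type: the structure of \<open>R\<close> is copied to the image of \<open>j\<close>.\<close>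

lemma nilpotent_lifting_transport:
  fixes R :: "(complex, 's) module" and j :: "'s \<Rightarrow> 'r"
  assumes lifting: "nilpotent_lifting (TYPE('r)) A" and A: "calgebra A" and R: "calgebra R" and I: "nilpotent_ideal I R"
    and j: "inj_on j (carrier R)" and f: "hom_mod A R I f"
  shows "\<exists>\<psi>\<in>calg_hom A R. \<forall>a\<in>carrier A. I +>\<^bsub>R\<^esub> \<psi> a = I +>\<^bsub>R\<^esub> f a"
proof -
  interpret R: calgebra R by (rule R)
  define i where "i = inv_into (carrier R) j"
  have ij [simp]: "i (j x) = x" if "x \<in> carrier R" for x
    unfolding i_def by (rule inv_into_f_f[OF j that])
  define R' :: "(complex, 'r) module" where
    "R' = \<lparr>carrier = j ` carrier R, mult = (\<lambda>x y. j (i x \<otimes>\<^bsub>R\<^esub> i y)), one = j \<one>\<^bsub>R\<^esub>, zero = j \<zero>\<^bsub>R\<^esub>,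
       add = (\<lambda>x y. j (i x \<oplus>\<^bsub>R\<^esub> i y)), smult = (\<lambda>c x. j (c \<odot>\<^bsub>R\<^esub> i x))\<rparr>"
  have car: "carrier R' = j ` carrier R"
    by (simp add: R'_def)
  have ops: "j x \<otimes>\<^bsub>R'\<^esub> j y = j (x \<otimes>\<^bsub>R\<^esub> y)" "j x \<oplus>\<^bsub>R'\<^esub> j y = j (x \<oplus>\<^bsub>R\<^esub> y)"
    "c \<odot>\<^bsub>R'\<^esub> j x = j (c \<odot>\<^bsub>R\<^esub> x)" if "x \<in> carrier R" "y \<in> carrier R" for x y c
    using that by (simp_all add: R'_def)
  have distinguished: "\<one>\<^bsub>R'\<^esub> = j \<one>\<^bsub>R\<^esub>" "\<zero>\<^bsub>R'\<^esub> = j \<zero>\<^bsub>R\<^esub>"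
    by (simp_all add: R'_def)
  have jc: "j x \<in> carrier R'" if "x \<in> carrier R" for x
    unfolding car using that by (rule imageI)
  have cs: "cspace R'"
    by (rule cspaceI) (auto simp: car ops distinguished R.a_ac R.scale_add_left R.scale_add_right R.scale_scale)
  have R': "calgebra R'"
    by (intro calgebraI cs bilinearI lin_mapI)
      (auto simp: car ops distinguished R.l_distr R.r_distr R.m_assoc R.smult_mult_left R.smult_mult_right)
  interpret I: ideal I R
    using I by (simp add: nilpotent_ideal_def)
  have IR: "I \<subseteq> carrier R" by (rule I.a_subset)
  have coset: "j ` I +>\<^bsub>R'\<^esub> j x = j ` (I +>\<^bsub>R\<^esub> x)" if x: "x \<in> carrier R" for x
  proof -
    have "j h \<oplus>\<^bsub>R'\<^esub> j x = j (h \<oplus>\<^bsub>R\<^esub> x)" if "h \<in> I" for h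
      using ops(2)[OF subsetD[OF IR that] x] .
    then show ?thesis
      by (auto simp: a_r_coset_def')
  qed
  have coset_sub: "I +>\<^bsub>R\<^esub> x \<subseteq> carrier R" if "x \<in> carrier R" for x
    using that IR by (auto simp: a_r_coset_def')
  have I': "nilpotent_ideal (j ` I) R'"
    unfolding nilpotent_ideal_def
  proof
    have sub: "submodule (j ` I) complex_field R'"
    proof (rule cspace.subspaceI[OF cs])
      show "j ` I \<subseteq> carrier R'"
        unfolding car using IR by (rule image_mono)
      show "\<zero>\<^bsub>R'\<^esub> \<in> j ` I"
        unfolding distinguished by (rule imageI) simp
      fix a b c assume "a \<in> j ` I"
      then obtain x where x: "x \<in> I" "a = j x" by blast
      note xR = subsetD[OF IR x(1)]
      show "c \<odot>\<^bsub>R'\<^esub> a \<in> j ` I"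
        unfolding x(2) ops(3)[OF xR xR]
        using R.subspaceD(4)[OF ideal_subspace[OF R I.is_ideal] x(1)] by (rule imageI)
      assume "b \<in> j ` I"
      then obtain y where y: "y \<in> I" "b = j y" by blast
      show "a \<oplus>\<^bsub>R'\<^esub> b \<in> j ` I"
        unfolding x(2) y(2) ops(2)[OF xR subsetD[OF IR y(1)]]
        using I.a_closed[OF x(1) y(1)] by (rule imageI)
    qed
    show "ideal (j ` I) R'"
    proof (rule idealI)
      show "ring R'" by (rule calgebra.axioms(2)[OF R'])
      show "subgroup (j ` I) (add_monoid R')"
        using sub by (simp add: submodule_def)
      fix a b assume "a \<in> j ` I" "b \<in> carrier R'"
      then obtain x y where x: "x \<in> I" "a = j x" and y: "y \<in> carrier R" "b = j y"
        unfolding car by blast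
      note xR = subsetD[OF IR x(1)]
      show "b \<otimes>\<^bsub>R'\<^esub> a \<in> j ` I" "a \<otimes>\<^bsub>R'\<^esub> b \<in> j ` I"
        unfolding x(2) y(2) ops(1)[OF xR y(1)] ops(1)[OF y(1) xR]
        by (rule imageI, rule I.I_l_closed[OF x(1) y(1)], rule imageI, rule I.I_r_closed[OF x(1) y(1)])
    qed
    obtain n where n: "foldr (\<otimes>\<^bsub>R\<^esub>) xs \<one>\<^bsub>R\<^esub> = \<zero>\<^bsub>R\<^esub>" if "set xs \<subseteq> I" "length xs = n" for xs
      using I unfolding nilpotent_ideal_def by blast
    have fold: "foldr (\<otimes>\<^bsub>R'\<^esub>) (map j xs) \<one>\<^bsub>R'\<^esub> = j (foldr (\<otimes>\<^bsub>R\<^esub>) xs \<one>\<^bsub>R\<^esub>) \<and>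
        foldr (\<otimes>\<^bsub>R\<^esub>) xs \<one>\<^bsub>R\<^esub> \<in> carrier R" if "set xs \<subseteq> carrier R" for xs
      using that by (induction xs) (simp_all add: distinguished ops)
    have "foldr (\<otimes>\<^bsub>R'\<^esub>) ys \<one>\<^bsub>R'\<^esub> = \<zero>\<^bsub>R'\<^esub>" if ys: "set ys \<subseteq> j ` I \<and> length ys = n" for ys
    proof -
      have "ys \<in> map j ` lists I"
        unfolding lists_image[symmetric] using ys by (simp add: lists_eq_set)
      then obtain xs where xs: "set xs \<subseteq> I" "ys = map j xs"
        by (auto simp: lists_eq_set)
      have "foldr (\<otimes>\<^bsub>R\<^esub>) xs \<one>\<^bsub>R\<^esub> = \<zero>\<^bsub>R\<^esub>"
        using n[of xs] xs ys by simp
      then show ?thesis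
        using fold[of xs] xs IR by (simp add: distinguished subset_trans)
    qed
    then show "\<exists>n. \<forall>xs. set xs \<subseteq> j ` I \<and> length xs = n \<longrightarrow> foldr (\<otimes>\<^bsub>R'\<^esub>) xs \<one>\<^bsub>R'\<^esub> = \<zero>\<^bsub>R'\<^esub>"
      by blast
  qed
  then have ideal': "ideal (j ` I) R'"
    by (simp add: nilpotent_ideal_def)
  note f' = f[unfolded hom_mod_def]
  have fc: "f a \<in> carrier R" if "a \<in> carrier A" for a
    using f' that by blast
  have eq: "j ` I +>\<^bsub>R'\<^esub> j x = j ` I +>\<^bsub>R'\<^esub> j y"
    if "I +>\<^bsub>R\<^esub> x = I +>\<^bsub>R\<^esub> y" "x \<in> carrier R" "y \<in> carrier R" for x y
    using that coset by simp
  interpret A: calgebra A by (rule A)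
  have hom': "hom_mod A R' (j ` I) (\<lambda>a. j (f a))"
    unfolding hom_mod_def
    proof (intro conjI ballI allI)
      fix a b c assume a: "a \<in> carrier A"
      then show "j (f a) \<in> carrier R'" by (intro jc fc)
      show "j ` I +>\<^bsub>R'\<^esub> j (f (c \<odot>\<^bsub>A\<^esub> a)) = j ` I +>\<^bsub>R'\<^esub> (c \<odot>\<^bsub>R'\<^esub> j (f a))"
        unfolding ops(3)[OF fc[OF a] fc[OF a]] by (rule eq) (use f' a fc in \<open>simp_all\<close>)
      assume b: "b \<in> carrier A"
      show "j ` I +>\<^bsub>R'\<^esub> j (f (a \<oplus>\<^bsub>A\<^esub> b)) = j ` I +>\<^bsub>R'\<^esub> (j (f a) \<oplus>\<^bsub>R'\<^esub> j (f b))"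
        unfolding ops(2)[OF fc[OF a] fc[OF b]] by (rule eq) (use f' a b fc in \<open>simp_all\<close>)
      show "j ` I +>\<^bsub>R'\<^esub> j (f (a \<otimes>\<^bsub>A\<^esub> b)) = j ` I +>\<^bsub>R'\<^esub> (j (f a) \<otimes>\<^bsub>R'\<^esub> j (f b))"
        unfolding ops(1)[OF fc[OF a] fc[OF b]] by (rule eq) (use f' a b fc in \<open>simp_all\<close>)
    next
      show "j ` I +>\<^bsub>R'\<^esub> j (f \<one>\<^bsub>A\<^esub>) = j ` I +>\<^bsub>R'\<^esub> \<one>\<^bsub>R'\<^esub>"
        unfolding distinguished by (rule eq) (use f' fc in \<open>simp_all\<close>)
    qed
  obtain \<psi>' where psi': "\<psi>' \<in> calg_hom A R'"
    and psi_coset: "\<And>a. a \<in> carrier A \<Longrightarrow> j ` I +>\<^bsub>R'\<^esub> \<psi>' a = j ` I +>\<^bsub>R'\<^esub> j (f a)"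
    using lifting R' I' hom_mod_quot[OF R' ideal' hom'] unfolding nilpotent_lifting_def by metis
  note p = calg_homD[OF psi'] and pl = lin_mapD[OF calg_homD(1)[OF psi']]
  have ps: "\<exists>x\<in>carrier R. \<psi>' a = j x" if "a \<in> carrier A" for a
    using pl(1)[OF that] unfolding car by blast
  have jp: "j (i (\<psi>' a)) = \<psi>' a" "i (\<psi>' a) \<in> carrier R" if "a \<in> carrier A" for a
    using ps[OF that] by auto
  have inj: "x = y" if "j x = j y" "x \<in> carrier R" "y \<in> carrier R" for x y
    using j that by (rule inj_onD)
  let ?p = "\<lambda>a. i (\<psi>' a)"
  have "?p \<in> calg_hom A R"
  proof (intro calg_homI lin_mapI)
    show "?p \<one>\<^bsub>A\<^esub> = \<one>\<^bsub>R\<^esub>"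
      by (simp add: p(2) distinguished)
    fix a b c assume a: "a \<in> carrier A"
    show "?p a \<in> carrier R" by (rule jp(2)[OF a])
    show "?p (c \<odot>\<^bsub>A\<^esub> a) = c \<odot>\<^bsub>R\<^esub> ?p a"
      using a ops(3)[OF jp(2)[OF a] jp(2)[OF a], of c] by (intro inj) (simp_all add: jp pl(3))
    assume b: "b \<in> carrier A"
    show "?p (a \<oplus>\<^bsub>A\<^esub> b) = ?p a \<oplus>\<^bsub>R\<^esub> ?p b"
      using a b ops(2)[OF jp(2)[OF a] jp(2)[OF b]] by (intro inj) (simp_all add: jp pl(2))
    show "?p (a \<otimes>\<^bsub>A\<^esub> b) = ?p a \<otimes>\<^bsub>R\<^esub> ?p b"
      using a b ops(1)[OF jp(2)[OF a] jp(2)[OF b]] by (intro inj) (simp_all add: jp p(3))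
  qed
  moreover have "I +>\<^bsub>R\<^esub> ?p a = I +>\<^bsub>R\<^esub> f a" if a: "a \<in> carrier A" for a
  proof -
    have "j ` (I +>\<^bsub>R\<^esub> ?p a) = j ` (I +>\<^bsub>R\<^esub> f a)"
      using psi_coset[OF a] coset[OF jp(2)[OF a]] coset[OF fc[OF a]] jp(1)[OF a] by simp
    then show ?thesis
      using inj_on_image_eq_iff[OF j coset_sub[OF jp(2)[OF a]] coset_sub[OF fc[OF a]]] by simp
  qed
  ultimately show ?thesis
    by (intro bexI[of _ ?p]) simp_all
qed


text \<open>The algebra \<open>A \<oplus> P\<close> in which \<open>P\<close> has zero product with itself. An algebra map
\<open>a \<mapsto> (a, \<delta> a)\<close> to it is the same as a derivation \<open>\<delta>\<close>.\<close>

definition square_zero_ext ::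
    "(complex, 'a) module \<Rightarrow> ('a, 'p) bimodule \<Rightarrow> (complex, 'a \<times> 'p) module" where
  "square_zero_ext A P =
    \<lparr>carrier = carrier A \<times> carrier P,
     mult = (\<lambda>(a, p) (b, q). (a \<otimes>\<^bsub>A\<^esub> b, lact P a q \<oplus>\<^bsub>P\<^esub> ract P p b)),
     one = (\<one>\<^bsub>A\<^esub>, \<zero>\<^bsub>P\<^esub>), zero = (\<zero>\<^bsub>A\<^esub>, \<zero>\<^bsub>P\<^esub>),
     add = (\<lambda>(a, p) (b, q). (a \<oplus>\<^bsub>A\<^esub> b, p \<oplus>\<^bsub>P\<^esub> q)),
     smult = (\<lambda>c (a, p). (c \<odot>\<^bsub>A\<^esub> a, c \<odot>\<^bsub>P\<^esub> p))\<rparr>"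

lemma square_zero_ext_simps [simp]:
  "carrier (square_zero_ext A P) = carrier A \<times> carrier P"
  "(a, p) \<otimes>\<^bsub>square_zero_ext A P\<^esub> (b, q) = (a \<otimes>\<^bsub>A\<^esub> b, lact P a q \<oplus>\<^bsub>P\<^esub> ract P p b)"
  "(a, p) \<oplus>\<^bsub>square_zero_ext A P\<^esub> (b, q) = (a \<oplus>\<^bsub>A\<^esub> b, p \<oplus>\<^bsub>P\<^esub> q)"
  "c \<odot>\<^bsub>square_zero_ext A P\<^esub> (a, p) = (c \<odot>\<^bsub>A\<^esub> a, c \<odot>\<^bsub>P\<^esub> p)"
  "\<one>\<^bsub>square_zero_ext A P\<^esub> = (\<one>\<^bsub>A\<^esub>, \<zero>\<^bsub>P\<^esub>)" "\<zero>\<^bsub>square_zero_ext A P\<^esub> = (\<zero>\<^bsub>A\<^esub>, \<zero>\<^bsub>P\<^esub>)"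
  by (simp_all add: square_zero_ext_def)

context cbimod
begin

lemma act_zero:
  "a \<in> carrier A \<Longrightarrow> lact M a \<zero>\<^bsub>M\<^esub> = \<zero>\<^bsub>M\<^esub>" "a \<in> carrier A \<Longrightarrow> ract M \<zero>\<^bsub>M\<^esub> a = \<zero>\<^bsub>M\<^esub>"
  "m \<in> carrier M \<Longrightarrow> lact M \<zero>\<^bsub>A\<^esub> m = \<zero>\<^bsub>M\<^esub>" "m \<in> carrier M \<Longrightarrow> ract M m \<zero>\<^bsub>A\<^esub> = \<zero>\<^bsub>M\<^esub>"
  using lact_simps(3)[of a "\<zero>\<^bsub>M\<^esub>" 0] ract_simps(3)[of a "\<zero>\<^bsub>M\<^esub>" 0]
    lact_simps(5)[of "\<zero>\<^bsub>A\<^esub>" m 0] ract_simps(5)[of "\<zero>\<^bsub>A\<^esub>" m 0]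
    lact_simps(1)[of a "\<zero>\<^bsub>M\<^esub>"] ract_simps(1)[of a "\<zero>\<^bsub>M\<^esub>"]
    lact_simps(1)[of "\<zero>\<^bsub>A\<^esub>" m] ract_simps(1)[of "\<zero>\<^bsub>A\<^esub>" m] by simp_all

lemma calgebra_square_zero: "calgebra (square_zero_ext A M)"
proof -
  have "cspace (square_zero_ext A M)"
    by (rule cspaceI) (auto simp: A.scale_add_left M.scale_add_left A.scale_add_right
        M.scale_add_right A.scale_scale M.scale_scale A.a_assoc M.a_assoc intro: A.a_comm M.a_comm)
  then show ?thesis
    by (intro calgebraI bilinearI lin_mapI)
      (auto simp: lact_simps ract_simps A.l_distr A.r_distr A.smult_mult_left A.smult_mult_right
        M.scale_add_right M.a_ac lact_mult ract_mult lact_ract lact_one ract_one act_zero A.m_assoc)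
qed

lemma nilpotent_ideal_square_zero:
  assumes K: "submodule K complex_field M"
    and stable: "\<And>a k. a \<in> carrier A \<Longrightarrow> k \<in> K \<Longrightarrow> lact M a k \<in> K \<and> ract M k a \<in> K"
  shows "nilpotent_ideal ({\<zero>\<^bsub>A\<^esub>} \<times> K) (square_zero_ext A M)"
  unfolding nilpotent_ideal_def
proof
  interpret E: calgebra "square_zero_ext A M" by (rule calgebra_square_zero)
  note K' = M.subspaceD[OF K]
  have KM: "k \<in> carrier M" if "k \<in> K" for k
    using K'(1) that by blast
  have "submodule ({\<zero>\<^bsub>A\<^esub>} \<times> K) complex_field (square_zero_ext A M)"
    by (rule E.subspaceI) (auto simp: K' KM)
  then show "ideal ({\<zero>\<^bsub>A\<^esub>} \<times> K) (square_zero_ext A M)"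
    by (intro idealI E.ring_axioms) (auto simp: submodule_def act_zero stable KM lact_simps ract_simps)
  show "\<exists>n. \<forall>xs. set xs \<subseteq> {\<zero>\<^bsub>A\<^esub>} \<times> K \<and> length xs = n \<longrightarrow>
      foldr (\<otimes>\<^bsub>square_zero_ext A M\<^esub>) xs \<one>\<^bsub>square_zero_ext A M\<^esub> = \<zero>\<^bsub>square_zero_ext A M\<^esub>"
    by (rule exI[of _ 2]) (auto simp: numeral_2_eq_2 length_Suc_conv act_zero KM ract_one)
qed

end

text \<open>If the derivation \<open>d\<close> takes values in the image of \<open>\<mu>\<close>, then \<open>a \<mapsto> (a, d a)\<close> is a
  homomorphism to \<open>A \<oplus> im \<mu>\<close>, which is the quotient of \<open>A \<oplus> P\<close> by the square-zero ideal
  \<open>ker \<mu>\<close>. The second component of a lift of it to \<open>A \<oplus> P\<close> is the derivation \<open>\<delta>\<close>.\<close>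

lemma quasi_free_lift_derivation:
  fixes A :: "(complex, 'a) module" and P :: "('a, 'p) bimodule" and Q :: "('a, 'q) bimodule"
    and j :: "'a \<times> 'p \<Rightarrow> 'r"
  assumes lifting: "nilpotent_lifting (TYPE('r)) A" and P: "cbimod A P" and Q: "cbimod A Q"
    and mu: "bimod_hom A P Q \<mu>" and d: "d \<in> derivations A Q"
    and surj: "\<And>a. a \<in> carrier A \<Longrightarrow> d a \<in> \<mu> ` carrier P"
    and j: "inj_on j (carrier A \<times> carrier P)"
  shows "\<exists>\<delta>. lin_map A P \<delta> \<and> (\<forall>a\<in>carrier A. \<mu> (\<delta> a) = d a) \<and>
    (\<forall>a\<in>carrier A. \<forall>b\<in>carrier A. \<delta> (a \<otimes>\<^bsub>A\<^esub> b) = lact P a (\<delta> b) \<oplus>\<^bsub>P\<^esub> ract P (\<delta> a) b)"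
proof -
  interpret P: cbimod A P by (rule P)
  interpret Q: cbimod A Q by (rule Q)
  let ?R = "square_zero_ext A P"
  interpret R: calgebra ?R by (rule P.calgebra_square_zero)
  note mu' = bimod_homD[OF mu]
  interpret mu: lin P Q \<mu>
    by (intro linI P.M.cspace_axioms Q.M.cspace_axioms mu')
  define K where "K = {p \<in> carrier P. \<mu> p = \<zero>\<^bsub>Q\<^esub>}"
  have K: "submodule K complex_field P"
    unfolding K_def by (rule mu.kernel_subspace)
  have nil: "nilpotent_ideal ({\<zero>\<^bsub>A\<^esub>} \<times> K) ?R"
    by (rule P.nilpotent_ideal_square_zero[OF K])
      (auto simp: K_def mu' P.lact_simps P.ract_simps Q.act_zero)
  then have I: "ideal ({\<zero>\<^bsub>A\<^esub>} \<times> K) ?R"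
    by (simp add: nilpotent_ideal_def)
  interpret q: quotient ?R "{\<zero>\<^bsub>A\<^esub>} \<times> K"
    by (intro quotient.intro quotient_axioms.intro R.cspace_axioms
        ideal_subspace[OF P.calgebra_square_zero I])
  have mem_iff: "({\<zero>\<^bsub>A\<^esub>} \<times> K) +>\<^bsub>?R\<^esub> (a, p) = ({\<zero>\<^bsub>A\<^esub>} \<times> K) +>\<^bsub>?R\<^esub> (b, q) \<longleftrightarrow> a = b \<and> \<mu> p = \<mu> q"
    if "a \<in> carrier A" "b \<in> carrier A" "p \<in> carrier P" "q \<in> carrier P" for a b p q
  proof -
    have "(a, p) \<ominus>\<^bsub>?R\<^esub> (b, q) = (a \<ominus>\<^bsub>A\<^esub> b, p \<ominus>\<^bsub>P\<^esub> q)"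
      using that R.scale_minus_one[of "(b, q)"]
      by (simp add: a_minus_def P.A.scale_minus_one P.M.scale_minus_one flip: R.scale_minus_one)
    then show ?thesis
      using that q.coset_eq_iff[of "(a, p)" "(b, q)"]
      by (auto simp: K_def mu.diff P.A.minus_eq_zero_iff Q.M.minus_eq_zero_iff)
  qed
  have dl: "lin_map A Q d" and dm: "\<And>a b. a \<in> carrier A \<Longrightarrow> b \<in> carrier A \<Longrightarrow>
      d (a \<otimes>\<^bsub>A\<^esub> b) = lact Q a (d b) \<oplus>\<^bsub>Q\<^esub> ract Q (d a) b"
    using d by (simp_all add: mem_derivations_iff)
  have dc: "d a \<in> carrier Q" if "a \<in> carrier A" for a
    by (rule lin_mapD(1)[OF dl that])
  have d1: "d \<one>\<^bsub>A\<^esub> = \<zero>\<^bsub>Q\<^esub>"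
    using dm[of "\<one>\<^bsub>A\<^esub>" "\<one>\<^bsub>A\<^esub>"] dc[of "\<one>\<^bsub>A\<^esub>"] by (simp add: Q.lact_one Q.ract_one)
  have "\<exists>p. p \<in> carrier P \<and> \<mu> p = d a" if "a \<in> carrier A" for a
    using surj[OF that] by force
  then obtain s where s: "\<And>a. a \<in> carrier A \<Longrightarrow> s a \<in> carrier P" "\<And>a. a \<in> carrier A \<Longrightarrow> \<mu> (s a) = d a"
    by metis
  have "hom_mod A ?R ({\<zero>\<^bsub>A\<^esub>} \<times> K) (\<lambda>a. (a, s a))"
    unfolding hom_mod_def
    by (auto simp: mem_iff s mu.add mu.scale mu' P.lact_simps P.ract_simps dm d1
        lin_mapD(2)[OF dl] lin_mapD(3)[OF dl])
  from nilpotent_lifting_transport[OF lifting P.A.calgebra_axioms P.calgebra_square_zero nil _ this, of j] j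
  obtain \<psi> where psi: "\<psi> \<in> calg_hom A ?R" and coset: "\<And>a. a \<in> carrier A \<Longrightarrow>
      ({\<zero>\<^bsub>A\<^esub>} \<times> K) +>\<^bsub>?R\<^esub> \<psi> a = ({\<zero>\<^bsub>A\<^esub>} \<times> K) +>\<^bsub>?R\<^esub> (a, s a)"
    by auto
  note psi' = calg_homD[OF psi] and psil = lin_mapD[OF calg_homD(1)[OF psi]]
  define \<delta> where "\<delta> a = snd (\<psi> a)" for a
  have psi_eq: "\<psi> a = (a, \<delta> a)" and dP: "\<delta> a \<in> carrier P" and mud: "\<mu> (\<delta> a) = d a"
    if a: "a \<in> carrier A" for a
  proof -
    obtain b p where bp: "\<psi> a = (b, p)" by (cases "\<psi> a")
    then have c: "b \<in> carrier A" "p \<in> carrier P"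
      using psil(1)[OF a] by simp_all
    then show "\<psi> a = (a, \<delta> a)" "\<delta> a \<in> carrier P" "\<mu> (\<delta> a) = d a"
      using coset[OF a] mem_iff[OF c(1) a c(2) s(1)[OF a]] s(2)[OF a] by (simp_all add: bp \<delta>_def)
  qed
  have "lin_map A P \<delta>"
  proof (rule lin_mapI)
    fix a c assume a: "a \<in> carrier A"
    show "\<delta> a \<in> carrier P" by (rule dP[OF a])
    show "\<delta> (c \<odot>\<^bsub>A\<^esub> a) = c \<odot>\<^bsub>P\<^esub> \<delta> a"
      using psil(3)[OF a, of c] psi_eq a by simp
    fix b assume b: "b \<in> carrier A"
    show "\<delta> (a \<oplus>\<^bsub>A\<^esub> b) = \<delta> a \<oplus>\<^bsub>P\<^esub> \<delta> b"
      using psil(2)[OF a b] psi_eq a b by simp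
  qed
  moreover have "\<delta> (a \<otimes>\<^bsub>A\<^esub> b) = lact P a (\<delta> b) \<oplus>\<^bsub>P\<^esub> ract P (\<delta> a) b"
    if "a \<in> carrier A" "b \<in> carrier A" for a b
    using psi'(3)[OF that] psi_eq that by simp
  ultimately show ?thesis
    using mud by blast
qed


section \<open>A dual basis of double derivations\<close>

definition bimod_power :: "'i set \<Rightarrow> ('a, 'm) bimodule \<Rightarrow> ('a, 'i \<Rightarrow> 'm) bimodule" where
  "bimod_power S M = with_actions
     \<lparr>carrier = S \<rightarrow>\<^sub>E carrier M, mult = undefined, one = undefined, zero = (\<lambda>s\<in>S. \<zero>\<^bsub>M\<^esub>),
      add = (\<lambda>p q. \<lambda>s\<in>S. p s \<oplus>\<^bsub>M\<^esub> q s), smult = (\<lambda>c p. \<lambda>s\<in>S. c \<odot>\<^bsub>M\<^esub> p s)\<rparr>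
     (\<lambda>a p. \<lambda>s\<in>S. lact M a (p s)) (\<lambda>p a. \<lambda>s\<in>S. ract M (p s) a)"

lemma bimod_power_carrier: "carrier (bimod_power S M) = S \<rightarrow>\<^sub>E carrier M"
  by (simp add: bimod_power_def)

lemma bimod_power_apply [simp]:
  assumes "s \<in> S"
  shows "\<zero>\<^bsub>bimod_power S M\<^esub> s = \<zero>\<^bsub>M\<^esub>" "(p \<oplus>\<^bsub>bimod_power S M\<^esub> q) s = p s \<oplus>\<^bsub>M\<^esub> q s"
    "(c \<odot>\<^bsub>bimod_power S M\<^esub> p) s = c \<odot>\<^bsub>M\<^esub> p s"
    "lact (bimod_power S M) a p s = lact M a (p s)" "ract (bimod_power S M) p a s = ract M (p s) a"
  using assms by (simp_all add: bimod_power_def)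

lemma bimod_power_closedI:
  "f \<in> extensional S \<Longrightarrow> (\<And>s. s \<in> S \<Longrightarrow> f s \<in> carrier M) \<Longrightarrow> f \<in> carrier (bimod_power S M)"
  by (simp add: bimod_power_carrier PiE_iff)

lemma bimod_power_extensional [simp]:
  "\<zero>\<^bsub>bimod_power S M\<^esub> \<in> extensional S" "p \<oplus>\<^bsub>bimod_power S M\<^esub> q \<in> extensional S"
  "c \<odot>\<^bsub>bimod_power S M\<^esub> p \<in> extensional S" "lact (bimod_power S M) a p \<in> extensional S"
  "ract (bimod_power S M) p a \<in> extensional S"
  by (simp_all add: bimod_power_def)

lemma bimod_power_closed: "p \<in> carrier (bimod_power S M) \<Longrightarrow> s \<in> S \<Longrightarrow> p s \<in> carrier M"
  by (auto simp: bimod_power_carrier)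

lemma bimod_power_eqI:
  assumes "p \<in> carrier (bimod_power S M)" "q \<in> carrier (bimod_power S M)" "\<And>s. s \<in> S \<Longrightarrow> p s = q s"
  shows "p = q"
  by (rule extensionalityI[of _ S]) (use assms in \<open>auto simp: bimod_power_carrier PiE_iff\<close>)

lemma (in cbimod) cbimod_power: "cbimod A (bimod_power S M)"
proof -
  let ?P = "bimod_power S M"
  note c = bimod_power_closed
  note eqI = bimod_power_eqI[of _ S M] and closedI = bimod_power_closedI[of _ S M]
  have zero: "\<zero>\<^bsub>?P\<^esub> \<in> carrier ?P"
    by (rule closedI) simp_all
  have add: "p \<oplus>\<^bsub>?P\<^esub> q \<in> carrier ?P" if "p \<in> carrier ?P" "q \<in> carrier ?P" for p q
    by (rule closedI) (simp_all add: c[OF that(1)] c[OF that(2)])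
  have scale: "k \<odot>\<^bsub>?P\<^esub> p \<in> carrier ?P" if "p \<in> carrier ?P" for k p
    by (rule closedI) (simp_all add: c[OF that])
  have act: "lact ?P a p \<in> carrier ?P" "ract ?P p a \<in> carrier ?P"
    if "p \<in> carrier ?P" "a \<in> carrier A" for p a
    by (rule closedI; simp add: c[OF that(1)] that(2) lact_simps ract_simps)+
  note cl = zero add scale act
  have cs: "cspace ?P"
    by (rule cspaceI; (rule eqI)?)
      (simp_all add: cl c M.a_ac M.scale_add_left M.scale_add_right M.scale_scale)
  show ?thesis
    by (rule cbimodI[OF A.calgebra_axioms cs]; (intro bilinearI lin_mapI)?; (rule eqI)?)
      (simp_all add: cl c cspace.scale_closed[OF cs] lact_simps ract_simps lact_mult ract_mult
        lact_one ract_one lact_ract)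
qed

context calg
begin

interpretation O: cbimod A "outer_bimodule A" by (rule cbimod_outer)
interpretation I: cbimod A "inner_bimodule A" by (rule cbimod_inner)

abbreviation "inner \<equiv> inner_bimodule A"
abbreviation "outer \<equiv> outer_bimodule A"

text \<open>The tensor \<open>T' (s \<otimes> 1 - 1 \<otimes> s) T''\<close>, expressed through the inner actions of \<open>s\<close>. Since
these commute with the outer actions, \<open>bdry s\<close> is an endomorphism of the outer bimodule.\<close>

definition bdry :: "'a \<Rightarrow> ('a \<times> 'a list \<Rightarrow> complex) set \<Rightarrow> ('a \<times> 'a list \<Rightarrow> complex) set" where
  "bdry s T = ract inner T s \<ominus>\<^bsub>A2\<^esub> lact inner s T"

lemma lin_bdry: "s \<in> carrier A \<Longrightarrow> lin_map A2 A2 (bdry s)"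
  unfolding bdry_def by (intro lin_map_diff A2.cspace_axioms lin_inner)

lemma bdry_tens:
  "\<lbrakk>s \<in> carrier A; x \<in> carrier A; y \<in> carrier A\<rbrakk> \<Longrightarrow> bdry s (x \<otimes>\<otimes> y) = (x \<otimes> s) \<otimes>\<otimes> y \<ominus>\<^bsub>A2\<^esub> x \<otimes>\<otimes> (s \<otimes> y)"
  by (simp add: bdry_def inner_tens)

lemma bdry_outer:
  assumes "s \<in> carrier A" "a \<in> carrier A" "T \<in> carrier A2"
  shows "bdry s (lact outer a T) = lact outer a (bdry s T)" "bdry s (ract outer T a) = ract outer (bdry s T) a"
proof -
  interpret L: lin A2 A2 "lact outer a"
    by (intro linI A2.cspace_axioms lin_outer assms)
  interpret R: lin A2 A2 "\<lambda>X. ract outer X a"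
    by (intro linI A2.cspace_axioms lin_outer assms)
  have "ract inner T s \<in> carrier A2" "lact inner s T \<in> carrier A2"
    using lin_mapD(1)[OF lin_inner(1)[OF assms(1)] assms(3)] lin_mapD(1)[OF lin_inner(2)[OF assms(1)] assms(3)]
    by simp_all
  then show "bdry s (lact outer a T) = lact outer a (bdry s T)" "bdry s (ract outer T a) = ract outer (bdry s T) a"
    using assms by (simp_all add: bdry_def L.diff R.diff inner_outer_commute)
qed

text \<open>Coordinates for the elements of \<open>A \<oplus> (A \<otimes> A)\<^sup>S\<close> as functions on words. The component in
  \<open>A\<close> is recorded on words of length one, and a representative of the component at \<open>s\<close> on the words
  \<open>[x, s, y]\<close>, so that different components occupy different words.\<close>

definition encode :: "'a \<times> ('a \<Rightarrow> ('a \<times> 'a list \<Rightarrow> complex) set) \<Rightarrow> 'a list \<Rightarrow> complex" where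
  "encode = (\<lambda>(a, p) w. if length w = 1 then (if hd w = a then 1 else 0)
     else if length w = 3 then (SOME v. v \<in> p (w ! 1)) (w ! 0, [w ! 2]) else 0)"

lemma coset_rep:
  assumes "X \<in> carrier A2"
  shows "(SOME v. v \<in> X) \<in> carrier (free_space (words A A 1))"
    "lin_span (free_space (words A A 1)) (multilinear_rels A A 1) +>\<^bsub>free_space (words A A 1)\<^esub> (SOME v. v \<in> X) = X"
proof -
  interpret presentation "words A A 1" "multilinear_rels A A 1" by (rule AA.pres)
  obtain x where x: "x \<in> carrier (free_space (words A A 1))" "X = relspace +>\<^bsub>free_space (words A A 1)\<^esub> x"
    using assms unfolding mtensor_def quot_carrier by blast
  have "x \<in> X"
    unfolding x(2) by (rule coset_self[OF x(1)])
  then have "(SOME v. v \<in> X) \<in> X"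
    by (rule someI[of "\<lambda>v. v \<in> X"])
  then have v: "(SOME v. v \<in> X) \<in> relspace +>\<^bsub>free_space (words A A 1)\<^esub> x"
    by (simp only: x(2))
  show "(SOME v. v \<in> X) \<in> carrier (free_space (words A A 1))"
    by (rule coset_mem_carrier[OF x(1) v])
  show "relspace +>\<^bsub>free_space (words A A 1)\<^esub> (SOME v. v \<in> X) = X"
    using coset_mem_eq[OF x(1) v] x(2) by (simp only:)
qed

lemma inj_encode: "inj_on encode (carrier A \<times> carrier (bimod_power S outer))"
proof (rule inj_onI, clarify)
  fix a p b q
  assume a: "a \<in> carrier A" and b: "b \<in> carrier A"
    and p: "p \<in> carrier (bimod_power S outer)" and q: "q \<in> carrier (bimod_power S outer)"
    and eq: "encode (a, p) = encode (b, q)"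
  have "encode (a, p) [a] = encode (b, q) [a]"
    using eq by simp
  then have ab: "a = b"
    by (simp add: encode_def One_nat_def split: if_splits)
  have "p = q"
  proof (rule bimod_power_eqI[OF p q])
    fix s assume s: "s \<in> S"
    have pq: "p s \<in> carrier A2" "q s \<in> carrier A2"
      using bimod_power_closed[OF p s] bimod_power_closed[OF q s] by simp_all
    let ?v = "SOME v. v \<in> p s" and ?w = "SOME v. v \<in> q s"
    have "?v u = ?w u" for u
    proof (cases "u \<in> words A A 1")
      case True
      then obtain x y where u: "u = (x, [y])"
        by (cases u) (auto simp: AA.words_1)
      have "encode (a, p) [x, s, y] = encode (b, q) [x, s, y]"
        using eq by simp
      then show ?thesis
        by (simp add: encode_def u One_nat_def numeral_2_eq_2)
    next
      case False
      have 0: "f u = 0" if "f \<in> carrier (free_space (words A A 1))" for f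
        using that False by (cases u) (auto simp: subset_iff)
      then show ?thesis
        by (simp only: 0[OF coset_rep(1)[OF pq(1)]] 0[OF coset_rep(1)[OF pq(2)]])
    qed
    then have "?v = ?w" by (rule ext)
    from arg_cong[OF this, of "a_r_coset (free_space (words A A 1))
        (lin_span (free_space (words A A 1)) (multilinear_rels A A 1))"]
    show "p s = q s"
      unfolding coset_rep(2)[OF pq(1)] coset_rep(2)[OF pq(2)] .
  qed
  with ab show "a = b \<and> p = q" by blast
qed

text \<open>Lifting \<open>\<Delta>\<close> through \<open>\<mu> : (A \<otimes> A)\<^sup>S \<rightarrow> A \<otimes> A\<close> for a finite generating set \<open>S\<close>; the
components of the lifted derivation are the \<open>\<delta> s\<close>.\<close>

theorem dual_basis:
  assumes smooth: "smooth_calg A"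
  obtains S \<delta> where "finite S" "S \<subseteq> carrier A" "\<And>s. s \<in> S \<Longrightarrow> \<delta> s \<in> carrier D"
    "\<And>a. a \<in> carrier A \<Longrightarrow> Delta A a = (\<Oplus>\<^bsub>A2\<^esub>s\<in>S. bdry s (\<delta> s a))"
proof -
  obtain S where S: "finite S" "S \<subseteq> carrier A" "calg_generated A S = carrier A"
    using smooth by (auto simp: smooth_calg_def finitely_generated_calg_def)
  have sA: "s \<in> carrier A" if "s \<in> S" for s
    using S(2) that by blast
  let ?P = "bimod_power S outer"
  interpret P: cbimod A ?P by (rule O.cbimod_power)
  have pc: "p s \<in> carrier A2" if "p \<in> carrier ?P" "s \<in> S" for p s
    using bimod_power_closed[OF that] by simp
  have bc: "bdry s T \<in> carrier A2" if "s \<in> S" "T \<in> carrier A2" for s T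
    by (rule lin_mapD(1)[OF lin_bdry[OF sA[OF that(1)]] that(2)])
  define \<mu> where "\<mu> p = (\<Oplus>\<^bsub>A2\<^esub>s\<in>S. bdry s (p s))" for p
  have "lin_map ?P A2 \<mu>"
    unfolding \<mu>_def
  proof (rule lin_map_sum[OF P.M.cspace_axioms A2.cspace_axioms S(1)])
    fix s assume s: "s \<in> S"
    have "lin_map ?P A2 (\<lambda>p. p s)"
      by (rule lin_mapI) (use s pc in auto)
    then show "lin_map ?P A2 (\<lambda>p. bdry s (p s))"
      by (rule lin_map_comp[OF _ lin_bdry[OF sA[OF s]]])
  qed
  then have mu_lin: "lin_map ?P outer \<mu>"
    by (simp add: lin_map_def)
  interpret mu: lin ?P outer \<mu>
    by (rule linI[OF P.M.cspace_axioms O.M.cspace_axioms mu_lin])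
  have mu: "bimod_hom A ?P outer \<mu>"
  proof (rule bimod_homI[OF mu_lin])
    fix a p assume a: "a \<in> carrier A" and p: "p \<in> carrier ?P"
    interpret L: lin A2 A2 "lact outer a"
      by (intro linI A2.cspace_axioms lin_outer a)
    interpret R: lin A2 A2 "\<lambda>X. ract outer X a"
      by (intro linI A2.cspace_axioms lin_outer a)
    show "\<mu> (lact ?P a p) = lact outer a (\<mu> p)"
      unfolding \<mu>_def using pc[OF p] bc a
      by (subst L.sum[OF S(1)], simp, intro A2.finsum_cong') (simp_all add: bdry_outer sA)
    show "\<mu> (ract ?P p a) = ract outer (\<mu> p) a"
      unfolding \<mu>_def using pc[OF p] bc a
      by (subst R.sum[OF S(1)], simp, intro A2.finsum_cong') (simp_all add: bdry_outer sA)
  qed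
  note mu' = bimod_homD(2,3)[OF mu]
  have Delta_der: "Delta A \<in> derivations A outer"
    using Delta_closed by (simp add: double_der_simps)
  note Dl = lin_mapD[OF double_der_lin[OF Delta_closed]]
  have surj: "Delta A a \<in> \<mu> ` carrier ?P" if "a \<in> carrier A" for a
  proof -
    let ?B = "{a \<in> carrier A. Delta A a \<in> \<mu> ` carrier ?P}"
    have img: "submodule (\<mu> ` carrier ?P) complex_field outer"
      by (rule mu.image_subspace[OF module.carrier_is_submodule[OF P.M.is_module]])
    interpret Del: lin A outer "Delta A"
      by (rule linI[OF cspace_axioms O.M.cspace_axioms]) (use Delta_der in \<open>simp add: mem_derivations_iff\<close>)
    have sub: "submodule ?B complex_field A"
      by (rule Del.vimage_subspace[OF img])
    note B = subspaceD[OF sub]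
    have "subring ?B A"
    proof (rule subringI)
      have "Delta A \<one> = \<mu> \<zero>\<^bsub>?P\<^esub>"
        using mu.zero by (simp add: Delta_def)
      then show "\<one> \<in> ?B"
        using P.M.zero_closed by blast
      fix a b assume "a \<in> ?B" "b \<in> ?B"
      then obtain p q where a: "a \<in> carrier A" "p \<in> carrier ?P" "Delta A a = \<mu> p"
        and b: "b \<in> carrier A" "q \<in> carrier ?P" "Delta A b = \<mu> q"
        by auto
      have "Delta A (a \<otimes> b) = \<mu> (lact ?P a q \<oplus>\<^bsub>?P\<^esub> ract ?P p b)"
        using a b P.lact_simps(1)[OF a(1) b(2)] P.ract_simps(1)[OF b(1) a(2)]
        by (simp add: mu.add mu' double_der_mult[OF Delta_closed])
      moreover have "lact ?P a q \<oplus>\<^bsub>?P\<^esub> ract ?P p b \<in> carrier ?P"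
        using P.lact_simps(1)[OF a(1) b(2)] P.ract_simps(1)[OF b(1) a(2)] by simp
      ultimately show "a \<otimes> b \<in> ?B"
        using a b by simp
    qed (use B in auto)
    moreover have "S \<subseteq> ?B"
    proof
      fix s assume s: "s \<in> S"
      \<comment> \<open>The unit vector at \<open>s\<close>, with \<open>\<mu> e = s \<otimes> 1 - 1 \<otimes> s = \<Delta> s\<close>.\<close>
      define e where "e = (\<lambda>t\<in>S. if t = s then \<one> \<otimes>\<otimes> \<one> else \<zero>\<^bsub>A2\<^esub>)"
      have e: "e \<in> carrier ?P"
        by (rule bimod_power_closedI) (auto simp: e_def)
      have bdry0: "bdry t \<zero>\<^bsub>A2\<^esub> = \<zero>\<^bsub>A2\<^esub>" if "t \<in> S" for t
        by (rule lin.zero[OF linI[OF A2.cspace_axioms A2.cspace_axioms lin_bdry[OF sA[OF that]]]])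
      have "\<mu> e = (\<Oplus>\<^bsub>A2\<^esub>t\<in>S. if s = t then bdry s (\<one> \<otimes>\<otimes> \<one>) else \<zero>\<^bsub>A2\<^esub>)"
        unfolding \<mu>_def using s bc by (intro A2.finsum_cong') (auto simp: e_def bdry0)
      also have "\<dots> = bdry s (\<one> \<otimes>\<otimes> \<one>)"
        using A2.add.finprod_singleton[OF s S(1), of "\<lambda>_. bdry s (\<one> \<otimes>\<otimes> \<one>)"] bc[OF s] by simp
      also have "\<dots> = Delta A s"
        using sA[OF s] by (simp add: bdry_tens Delta_def)
      finally show "s \<in> ?B"
        using sA[OF s] e by (metis (mono_tags, lifting) imageI mem_Collect_eq)
    qed
    ultimately have "calg_generated A S \<subseteq> ?B"
      unfolding calg_generated_def using sub by (intro Inter_lower) simp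
    with that show ?thesis
      unfolding S(3) by blast
  qed
  have "nilpotent_lifting TYPE('a list \<Rightarrow> complex) A"
    using smooth by (simp add: smooth_calg_def quasi_free_def)
  from quasi_free_lift_derivation[OF this O.cbimod_power cbimod_outer mu Delta_der surj inj_encode]
  obtain \<delta> where d: "lin_map A ?P \<delta>" "\<And>a. a \<in> carrier A \<Longrightarrow> \<mu> (\<delta> a) = Delta A a"
    "\<And>a b. a \<in> carrier A \<Longrightarrow> b \<in> carrier A \<Longrightarrow> \<delta> (a \<otimes> b) = lact ?P a (\<delta> b) \<oplus>\<^bsub>?P\<^esub> ract ?P (\<delta> a) b"
    by blast
  define d' where "d' s = (\<lambda>a\<in>carrier A. \<delta> a s)" for s
  show thesis
  proof (rule that[OF S(1,2)])
    show "Delta A a = (\<Oplus>\<^bsub>A2\<^esub>s\<in>S. bdry s (d' s a))" if "a \<in> carrier A" for a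
      using d(2)[OF that] that by (simp add: \<mu>_def d'_def)
    fix s assume s: "s \<in> S"
    show "d' s \<in> carrier D"
      unfolding double_der_simps mem_derivations_iff
    proof (intro conjI ballI)
      show "d' s \<in> extensional (carrier A)"
        by (simp add: d'_def)
      show "lin_map A outer (d' s)"
        by (rule lin_mapI) (use s pc lin_mapD[OF d(1)] in \<open>simp_all add: d'_def\<close>)
      fix x y assume "x \<in> carrier A" "y \<in> carrier A"
      then show "d' s (x \<otimes> y) = lact outer x (d' s y) \<oplus>\<^bsub>outer\<^esub> ract outer (d' s x) y"
        using s by (simp add: d'_def d(3))
    qed
  qed
qed

end


section \<open>Perfectness of the pairing\<close>

lemma (in cspace) finsum_uminus:
  assumes "finite T" "g \<in> T \<rightarrow> carrier M"
  shows "(\<Oplus>s\<in>T. \<ominus> g s) = \<ominus> (\<Oplus>s\<in>T. g s)"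
proof -
  have gc: "g s \<in> carrier M" if "s \<in> T" for s
    using assms(2) that by auto
  have "lin_map M M (\<lambda>x. (- 1) \<odot> x)"
    by (rule lin_map_scale[OF cspace_axioms cspace_axioms lin_map_id])
  then interpret l: lin M M "\<lambda>x. (- 1) \<odot> x"
    by (intro linI cspace_axioms)
  have "\<ominus> (\<Oplus>s\<in>T. g s) = (\<Oplus>s\<in>T. (- 1) \<odot> g s)"
    using l.sum[OF assms] gc by (simp add: scale_minus_one)
  also have "\<dots> = (\<Oplus>s\<in>T. \<ominus> g s)"
    using gc by (intro finsum_cong') (auto simp: scale_minus_one)
  finally show ?thesis ..
qed

context calg
begin

text \<open>The way in which the dual basis is used. The hypothesis on \<open>L\<close> and \<open>G\<close> says that \<open>L\<close> sends
\<open>bdry s T\<close> to \<open>- G s T\<close>, so applying \<open>L\<close> to the expansion of \<open>\<Delta> a\<close> expresses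
\<open>L(1 \<otimes> a)\<close> through the values of \<open>G s\<close>.\<close>

lemma dual_basis_apply:
  assumes S: "finite S" "S \<subseteq> carrier A" and d: "\<And>s. s \<in> S \<Longrightarrow> \<delta> s \<in> carrier D"
    and basis: "\<And>a. a \<in> carrier A \<Longrightarrow> Delta A a = (\<Oplus>\<^bsub>A2\<^esub>s\<in>S. bdry s (\<delta> s a))"
    and V: "cspace V" and L: "lin_map A2 V L" and G: "\<And>s. s \<in> S \<Longrightarrow> lin_map A2 V (G s)"
    and rel: "\<And>s x y. \<lbrakk>s \<in> S; x \<in> carrier A; y \<in> carrier A\<rbrakk> \<Longrightarrow>
      L (x \<otimes>\<otimes> (s \<otimes> y)) = L ((x \<otimes> s) \<otimes>\<otimes> y) \<oplus>\<^bsub>V\<^esub> G s (x \<otimes>\<otimes> y)"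
    and L1: "\<And>a. a \<in> carrier A \<Longrightarrow> L (a \<otimes>\<otimes> \<one>) = \<zero>\<^bsub>V\<^esub>"
    and a: "a \<in> carrier A"
  shows "L (\<one> \<otimes>\<otimes> a) = (\<Oplus>\<^bsub>V\<^esub>s\<in>S. G s (\<delta> s a))"
proof -
  interpret V: cspace V by (rule V)
  interpret L: lin A2 V L
    by (rule linI[OF A2.cspace_axioms V L])
  have sA: "s \<in> carrier A" if "s \<in> S" for s
    using S(2) that by blast
  have dc: "\<delta> s a \<in> carrier A2" if "s \<in> S" for s
    by (rule double_der_closed[OF d[OF that] a])
  have Gc: "G s T \<in> carrier V" if "s \<in> S" "T \<in> carrier A2" for s T
    by (rule lin_mapD(1)[OF G[OF that(1)] that(2)])
  have bc: "bdry s T \<in> carrier A2" if "s \<in> S" "T \<in> carrier A2" for s T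
    by (rule lin_mapD(1)[OF lin_bdry[OF sA[OF that(1)]] that(2)])
  have Lb: "L (bdry s T) = (- 1) \<odot>\<^bsub>V\<^esub> G s T" if s: "s \<in> S" and T: "T \<in> carrier A2" for s T
  proof (rule AA.lin_map_eq_1[OF V lin_map_comp[OF lin_bdry[OF sA[OF s]] L]
        lin_map_scale[OF A2.cspace_axioms V G[OF s]] _ T])
    fix x y assume x: "x \<in> carrier A" and y: "y \<in> carrier A"
    have c: "L ((x \<otimes> s) \<otimes>\<otimes> y) \<in> carrier V" "G s (x \<otimes>\<otimes> y) \<in> carrier V"
      using x y sA[OF s] Gc[OF s] by simp_all
    show "L (bdry s (x \<otimes>\<otimes> y)) = (- 1) \<odot>\<^bsub>V\<^esub> G s (x \<otimes>\<otimes> y)"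
      using x y sA[OF s] c rel[OF s x y]
      by (simp add: bdry_tens L.diff V.scale_minus_one) (simp add: a_minus_def V.minus_add V.r_neg2)
  qed
  have "\<ominus>\<^bsub>V\<^esub> L (\<one> \<otimes>\<otimes> a) = L (Delta A a)"
    using a L1[OF a] by (simp add: Delta_def L.diff) (simp add: a_minus_def)
  also have "\<dots> = (\<Oplus>\<^bsub>V\<^esub>s\<in>S. L (bdry s (\<delta> s a)))"
    unfolding basis[OF a] using bc dc by (intro L.sum S) auto
  also have "\<dots> = (\<Oplus>\<^bsub>V\<^esub>s\<in>S. \<ominus>\<^bsub>V\<^esub> G s (\<delta> s a))"
    using Gc dc by (intro V.finsum_cong') (simp_all add: Lb V.scale_minus_one)
  also have "\<dots> = \<ominus>\<^bsub>V\<^esub> (\<Oplus>\<^bsub>V\<^esub>s\<in>S. G s (\<delta> s a))"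
    using Gc dc by (intro V.finsum_uminus S) auto
  finally have eq: "\<ominus>\<^bsub>V\<^esub> L (\<one> \<otimes>\<otimes> a) = \<ominus>\<^bsub>V\<^esub> (\<Oplus>\<^bsub>V\<^esub>s\<in>S. G s (\<delta> s a))" .
  have "(\<Oplus>\<^bsub>V\<^esub>s\<in>S. G s (\<delta> s a)) \<in> carrier V" "L (\<one> \<otimes>\<otimes> a) \<in> carrier V"
    using a Gc dc by (auto intro!: V.finsum_closed)
  then show ?thesis
    using arg_cong[OF eq, of "a_inv V"] by (simp only: V.minus_minus)
qed

end

lemma bimod_hom_twist:
  assumes "cbimod A M" "cbimod A N" "bimod_hom A M N h" "f \<in> carrier M" "T \<in> carrier (mtensor A A 1)"
  shows "h (cbimod.twist M f T) = cbimod.twist N (h f) T"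
proof -
  interpret M: cbimod A M by fact
  interpret N: cbimod A N by fact
  note h = bimod_homD[OF assms(3)]
  have hf: "h f \<in> carrier N"
    by (rule lin_mapD(1)[OF h(1) assms(4)])
  show ?thesis
    by (rule M.A.AA.lin_map_eq_1[OF N.M.cspace_axioms
          lin_map_comp[OF M.twist(1)[OF assms(4)] h(1)] N.twist(1)[OF hf] _ assms(5)])
      (simp add: M.twist N.twist assms(4) hf h(2,3) M.ract_simps)
qed

context cbimod
begin

interpretation O: cbimod A outer by (rule A.cbimod_outer)
interpretation I: cbimod A inner by (rule A.cbimod_inner)
interpretation DD: cbimod A D by (rule A.cbimod_double_der)

lemma twist_inner_outer:
  assumes x: "x \<in> carrier A" and y: "y \<in> carrier A" and U: "U \<in> carrier A2"
  shows "I.twist (tens A A x [y]) U = lact outer x (ract outer U y)"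
proof -
  have xy: "tens A A x [y] \<in> carrier inner"
    using x y by simp
  have 1: "lin_map A2 A2 (I.twist (tens A A x [y]))"
    using I.twist(1)[OF xy] by (simp add: lin_map_def)
  show ?thesis
    by (rule A.AA.lin_map_eq_1[OF A.A2.cspace_axioms 1
          lin_map_comp[OF A.lin_outer(2)[OF y] A.lin_outer(1)[OF x]] _ U])
      (use x y xy in \<open>simp add: I.twist A.inner_tens A.outer_tens\<close>)
qed

lemma twist_double_der:
  assumes d: "d \<in> carrier D" and a: "a \<in> carrier A" and T: "T \<in> carrier A2"
  shows "DD.twist d T a = I.twist (d a) T"
proof -
  have da: "d a \<in> carrier inner"
    using A.double_der_closed[OF d a] by simp
  have ev: "lin_map D A2 (\<lambda>d. d a)"
    by (rule lin_mapI) (simp_all add: a A.double_der_apply A.double_der_closed)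
  have 1: "lin_map A2 A2 (I.twist (d a))"
    using I.twist(1)[OF da] by (simp add: lin_map_def)
  show ?thesis
    by (rule A.AA.lin_map_eq_1[OF A.A2.cspace_axioms lin_map_comp[OF DD.twist(1)[OF d] ev] 1 _ T])
      (simp add: DD.twist I.twist d A.double_der_closed[OF d a] a A.double_der_apply)
qed

context
  fixes S \<delta>
  assumes S: "finite S" "S \<subseteq> carrier A" and \<delta>: "\<And>s. s \<in> S \<Longrightarrow> \<delta> s \<in> carrier D"
    and basis: "\<And>a. a \<in> carrier A \<Longrightarrow> Delta A a = (\<Oplus>\<^bsub>A2\<^esub>s\<in>S. A.bdry s (\<delta> s a))"
begin

text \<open>This is \<open>d = \<Sum>\<^sub>s d(s)'' \<delta>\<^sub>s d(s)'\<close>, obtained with \<open>L (x \<otimes> y) = x d(y)\<close>. The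
hypothesis on \<open>L\<close> is the Leibniz rule \<open>x d(s y) = x s d(y) + x d(s) y\<close>, and \<open>L (a \<otimes> 1) = 0\<close>
because derivations kill \<open>1\<close>.\<close>

lemma dual_basis_expand:
  assumes d: "d \<in> carrier D"
  shows "d = (\<Oplus>\<^bsub>D\<^esub>s\<in>S. DD.twist (\<delta> s) (d s))"
proof (rule A.double_der_eqI[OF d])
  have sA: "s \<in> carrier A" if "s \<in> S" for s
    using S(2) that by blast
  note dc = A.double_der_closed[OF d]
  have tc: "DD.twist (\<delta> s) (d s) \<in> carrier D" if "s \<in> S" for s
    by (intro DD.twist_closed \<delta> dc sA that)
  show "(\<Oplus>\<^bsub>D\<^esub>s\<in>S. DD.twist (\<delta> s) (d s)) \<in> carrier D"
    using tc by (intro DD.M.finsum_closed) auto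
  fix a assume a: "a \<in> carrier A"
  have ev: "lin_map D A2 (\<lambda>d. d a)"
    by (rule lin_mapI) (simp_all add: a A.double_der_apply A.double_der_closed)
  interpret ev: lin D A2 "\<lambda>d. d a"
    by (rule linI[OF DD.M.cspace_axioms A.A2.cspace_axioms ev])
  let ?L = "quot_lift A2 (\<lambda>(x, ys). lact outer x (d (hd ys)))"
  have "bilinear A A A2 (\<lambda>x y. lact outer x (d y))"
  proof (rule bilinearI)
    fix x assume "x \<in> carrier A"
    then show "lin_map A A2 (\<lambda>y. lact outer x (d y))"
      by (rule lin_map_comp[OF A.double_der_lin[OF d] A.lin_outer(1)])
  next
    fix y assume "y \<in> carrier A"
    then show "lin_map A A2 (\<lambda>x. lact outer x (d y))"
      using O.lin_lact'[of "d y"] dc by (simp add: lin_map_def)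
  qed
  then have L: "lin_map A2 A2 ?L"
    "\<And>x y. x \<in> carrier A \<Longrightarrow> y \<in> carrier A \<Longrightarrow> ?L (tens A A x [y]) = lact outer x (d y)"
    using A.AA.lift_1[OF A.A2.cspace_axioms, of "\<lambda>(x, ys). lact outer x (d (hd ys))"] by simp_all
  have G: "lin_map A2 A2 (\<lambda>T. I.twist T (d s))" if "s \<in> S" for s
    using I.lin_twist[OF dc[OF sA[OF that]]] by (simp add: lin_map_def)
  have oc: "lact outer x T \<in> carrier A2" "ract outer T x \<in> carrier A2" if "x \<in> carrier A" "T \<in> carrier A2" for x T
    using O.lact_simps(1)[of x T] O.ract_simps(1)[of x T] that by simp_all
  have d1: "d \<one>\<^bsub>A\<^esub> = \<zero>\<^bsub>A2\<^esub>"
    using A.double_der_mult[OF d, of "\<one>\<^bsub>A\<^esub>" "\<one>\<^bsub>A\<^esub>"] dc[of "\<one>\<^bsub>A\<^esub>"] O.lact_one[of "d \<one>\<^bsub>A\<^esub>"]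
      O.ract_one[of "d \<one>\<^bsub>A\<^esub>"] by simp
  have "?L (tens A A \<one>\<^bsub>A\<^esub> [a]) = (\<Oplus>\<^bsub>A2\<^esub>s\<in>S. I.twist (\<delta> s a) (d s))"
  proof (rule A.dual_basis_apply[OF S \<delta> basis A.A2.cspace_axioms L(1) G _ _ a])
    fix s x y assume s: "s \<in> S" and x: "x \<in> carrier A" and y: "y \<in> carrier A"
    have "lact outer x (d (s \<otimes>\<^bsub>A\<^esub> y)) =
        lact outer x (lact outer s (d y)) \<oplus>\<^bsub>A2\<^esub> lact outer x (ract outer (d s) y)"
      using s x y sA dc oc lin_mapD(2)[OF A.lin_outer(1)[OF x]]
      by (simp add: A.double_der_mult[OF d sA[OF s] y])
    then show "?L (tens A A x [s \<otimes>\<^bsub>A\<^esub> y]) = ?L (tens A A (x \<otimes>\<^bsub>A\<^esub> s) [y]) \<oplus>\<^bsub>A2\<^esub> I.twist (tens A A x [y]) (d s)"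
      using s x y sA dc O.lact_mult[of x s "d y"] by (simp add: L(2) twist_inner_outer)
  next
    fix b assume "b \<in> carrier A"
    then show "?L (tens A A b [\<one>\<^bsub>A\<^esub>]) = \<zero>\<^bsub>A2\<^esub>"
      using O.act_zero(1)[of b] by (simp add: L(2) d1)
  qed
  then have "d a = (\<Oplus>\<^bsub>A2\<^esub>s\<in>S. I.twist (\<delta> s a) (d s))"
    using a dc O.lact_one[of "d a"] by (simp add: L(2))
  also have "\<dots> = (\<Oplus>\<^bsub>A2\<^esub>s\<in>S. DD.twist (\<delta> s) (d s) a)"
    using tc ev.closed by (intro A.A2.finsum_cong') (auto simp: twist_double_der \<delta> a dc sA)
  also have "\<dots> = (\<Oplus>\<^bsub>D\<^esub>s\<in>S. DD.twist (\<delta> s) (d s)) a"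
    using tc by (intro ev.sum[symmetric] S) auto
  finally show "d a = (\<Oplus>\<^bsub>D\<^esub>s\<in>S. DD.twist (\<delta> s) (d s)) a" .
qed

text \<open>The chain is \<open>\<Sum>\<^sub>s \<theta>(\<delta>\<^sub>s) \<otimes> s\<close>: apply \<open>\<theta>\<close> to the expansion of \<open>d\<close>.\<close>

lemma bimod_hom_is_pairing:
  assumes th: "bimod_hom A D M \<theta>"
  shows "\<exists>X\<in>carrier C1. \<forall>d\<in>carrier D. \<theta> d = pair d X"
proof
  have sA: "s \<in> carrier A" if "s \<in> S" for s
    using S(2) that by blast
  interpret th: lin D M \<theta>
    by (rule linI[OF DD.M.cspace_axioms M.cspace_axioms bimod_homD(1)[OF th]])
  let ?X = "\<Oplus>\<^bsub>C1\<^esub>s\<in>S. tens M A (\<theta> (\<delta> s)) [s]"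
  have tc: "tens M A (\<theta> (\<delta> s)) [s] \<in> carrier C1" if "s \<in> S" for s
    using that sA \<delta> by simp
  show "?X \<in> carrier C1"
    using tc by (intro C1.finsum_closed) auto
  show "\<forall>d\<in>carrier D. \<theta> d = pair d ?X"
  proof
    fix d assume d: "d \<in> carrier D"
    note dc = A.double_der_closed[OF d]
    interpret p: lin C1 M "pair d"
      by (rule linI[OF C1.cspace_axioms M.cspace_axioms pair(1)[OF d]])
    have wc: "DD.twist (\<delta> s) (d s) \<in> carrier D" if "s \<in> S" for s
      by (intro DD.twist_closed \<delta> dc sA that)
    have "\<theta> d = \<theta> (\<Oplus>\<^bsub>D\<^esub>s\<in>S. DD.twist (\<delta> s) (d s))"
      by (rule arg_cong[OF dual_basis_expand[OF d]])
    also have "\<dots> = (\<Oplus>\<^bsub>M\<^esub>s\<in>S. \<theta> (DD.twist (\<delta> s) (d s)))"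
      using wc by (intro th.sum S) auto
    also have "\<dots> = (\<Oplus>\<^bsub>M\<^esub>s\<in>S. pair d (tens M A (\<theta> (\<delta> s)) [s]))"
      using tc p.closed
      by (intro M.finsum_cong') (auto simp: pair d \<delta> sA dc
          bimod_hom_twist[OF A.cbimod_double_der cbimod_axioms th])
    also have "\<dots> = pair d ?X"
      using tc by (intro p.sum[symmetric] S) auto
    finally show "\<theta> d = pair d ?X" .
  qed
qed

text \<open>Modulo boundaries, \<open>f \<otimes> a b = f a \<otimes> b + b f \<otimes> a\<close>. So
\<open>L (x \<otimes> y) = f x \<otimes> y\<close> satisfies the hypotheses of \<open>dual_basis_apply\<close> with
\<open>G s T = T'' f T' \<otimes> s\<close>, and every chain \<open>X\<close> is homologous to \<open>\<Sum>\<^sub>s pair \<delta>\<^sub>s X \<otimes> s\<close>.\<close>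

lemma pairing_kernel:
  assumes X: "X \<in> carrier C1" and zero: "\<And>d. d \<in> carrier D \<Longrightarrow> pair d X = \<zero>\<^bsub>M\<^esub>"
  shows "X \<in> hoch_boundaries A M 1"
proof -
  let ?B = "hoch_boundaries A M 1"
  interpret q: quotient C1 ?B
    by (intro quotient.intro quotient_axioms.intro C1.cspace_axioms boundaries_subspace)
  let ?V = "C1 QuotC ?B"
  interpret V: cspace ?V by (rule q.quot_cspace)
  interpret q': lin C1 ?V "\<lambda>x. ?B +>\<^bsub>C1\<^esub> x"
    by (rule linI[OF C1.cspace_axioms V.cspace_axioms q.lin_coset])
  have sA: "s \<in> carrier A" if "s \<in> S" for s
    using S(2) that by blast
  let ?q = "\<lambda>x. ?B +>\<^bsub>C1\<^esub> x"
  have T1: "lin_map M ?V (\<lambda>f. ?q (tens M A f [a]))" if "a \<in> carrier A" for a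
    by (rule lin_map_comp[OF bilinearD(2)[OF MA.tens_bilinear that] q.lin_coset])
  have T2: "lin_map A ?V (\<lambda>a. ?q (tens M A f [a]))" if "f \<in> carrier M" for f
    by (rule lin_map_comp[OF bilinearD(1)[OF MA.tens_bilinear that] q.lin_coset])
  have bd: "?q (tens M A f [a \<otimes>\<^bsub>A\<^esub> b]) = ?q (tens M A (ract M f a) [b]) \<oplus>\<^bsub>?V\<^esub> ?q (tens M A (lact M b f) [a])"
    if f: "f \<in> carrier M" and a: "a \<in> carrier A" and b: "b \<in> carrier A" for f a b
  proof -
    have c: "tens M A (ract M f a) [b] \<in> carrier C1" "tens M A (lact M b f) [a] \<in> carrier C1"
      "tens M A f [a \<otimes>\<^bsub>A\<^esub> b] \<in> carrier C1"
      using f a b by (simp_all add: ract_simps lact_simps)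
    have "(tens M A (ract M f a) [b] \<oplus>\<^bsub>C1\<^esub> tens M A (lact M b f) [a]) \<ominus>\<^bsub>C1\<^esub> tens M A f [a \<otimes>\<^bsub>A\<^esub> b] \<in> ?B"
      using boundary_mem[OF f a b] c by (simp add: a_minus_def C1.a_ac)
    then show ?thesis
      using q.coset_eq_iff[OF C1.a_closed[OF c(1,2)] c(3)] q'.add[OF c(1,2)] by simp
  qed
  have q1: "?q (tens M A f [\<one>\<^bsub>A\<^esub>]) = \<zero>\<^bsub>?V\<^esub>" if f: "f \<in> carrier M" for f
  proof -
    have "?q (tens M A f [\<one>\<^bsub>A\<^esub>]) \<in> carrier ?V"
      using f by (intro q'.closed) simp
    then show ?thesis
      using bd[OF f A.one_closed A.one_closed] f by (simp add: lact_one ract_one)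
  qed
  let ?E = "\<lambda>X. \<Oplus>\<^bsub>?V\<^esub>s\<in>S. ?q (tens M A (pair (\<delta> s) X) [s])"
  have "?q X = ?E X"
  proof (rule MA.lin_map_eq_1[OF V.cspace_axioms q.lin_coset _ _ X])
    show "lin_map C1 ?V ?E"
      by (rule lin_map_sum[OF C1.cspace_axioms V.cspace_axioms S(1)])
        (rule lin_map_comp[OF pair(1)[OF \<delta>] T1[OF sA]])
    fix f a assume f: "f \<in> carrier M" and a: "a \<in> carrier A"
    let ?L = "quot_lift ?V (\<lambda>(x, ys). ?q (tens M A (ract M f x) [hd ys]))"
    have "bilinear A A ?V (\<lambda>x y. ?q (tens M A (ract M f x) [y]))"
    proof (rule bilinearI)
      fix x assume "x \<in> carrier A"
      then show "lin_map A ?V (\<lambda>y. ?q (tens M A (ract M f x) [y]))"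
        by (intro T2 ract_simps f)
    next
      fix y assume "y \<in> carrier A"
      then show "lin_map A ?V (\<lambda>x. ?q (tens M A (ract M f x) [y]))"
        by (rule lin_map_comp[OF lin_ract'[OF f] T1])
    qed
    then have L: "lin_map A2 ?V ?L"
      "\<And>x y. x \<in> carrier A \<Longrightarrow> y \<in> carrier A \<Longrightarrow> ?L (tens A A x [y]) = ?q (tens M A (ract M f x) [y])"
      using A.AA.lift_1[OF V.cspace_axioms, of "\<lambda>(x, ys). ?q (tens M A (ract M f x) [hd ys])"] by simp_all
    have "?L (tens A A \<one>\<^bsub>A\<^esub> [a]) = (\<Oplus>\<^bsub>?V\<^esub>s\<in>S. ?q (tens M A (twist f (\<delta> s a)) [s]))"
    proof (rule A.dual_basis_apply[OF S \<delta> basis V.cspace_axioms L(1) _ _ _ a])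
      fix s assume "s \<in> S"
      then show "lin_map A2 ?V (\<lambda>T. ?q (tens M A (twist f T) [s]))"
        by (intro lin_map_comp[OF twist(1)[OF f] T1] sA)
    next
      fix s x y assume "s \<in> S" and xy: "x \<in> carrier A" "y \<in> carrier A"
      then have s: "s \<in> carrier A" by (intro sA)
      show "?L (tens A A x [s \<otimes>\<^bsub>A\<^esub> y]) = ?L (tens A A (x \<otimes>\<^bsub>A\<^esub> s) [y]) \<oplus>\<^bsub>?V\<^esub> ?q (tens M A (twist f (tens A A x [y])) [s])"
        using s xy f bd[of "ract M f x" s y] by (simp add: L(2) twist ract_mult ract_simps)
    next
      fix b assume "b \<in> carrier A"
      then show "?L (tens A A b [\<one>\<^bsub>A\<^esub>]) = \<zero>\<^bsub>?V\<^esub>"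
        using f by (simp add: L(2) q1 ract_simps)
    qed
    then have "?q (tens M A f [a]) = (\<Oplus>\<^bsub>?V\<^esub>s\<in>S. ?q (tens M A (twist f (\<delta> s a)) [s]))"
      using f a by (simp add: L(2) ract_one)
    also have "\<dots> = ?E (tens M A f [a])"
      using f a q'.closed by (intro V.finsum_cong') (auto simp: pair \<delta> sA A.double_der_closed)
    finally show "?q (tens M A f [a]) = ?E (tens M A f [a])" .
  qed
  also have "\<dots> = (\<Oplus>\<^bsub>?V\<^esub>s\<in>S. \<zero>\<^bsub>?V\<^esub>)"
    using lin.zero[OF linI[OF M.cspace_axioms V.cspace_axioms T1]] sA
    by (intro V.finsum_cong') (auto simp: zero \<delta>)
  also have "\<dots> = \<zero>\<^bsub>?V\<^esub>"
    by simp
  also have "\<dots> = ?B"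
    by (rule q.quot_zero)
  finally show ?thesis
    using q.coset_eq_N_iff[OF X] by simp
qed

end

end


section \<open>Representations of deformed preprojective algebras\<close>

lemma (in tensor_algebra) calgebra_TA: "calgebra TA"
proof -
  interpret TA: ring TA by (rule ring_TA)
  show ?thesis
    by (intro calgebraI cspace_TA bilinearI lin_TA_mult) (simp_all add: TA.m_assoc)
qed

lemma quot_calg_hom:
  fixes R :: "(complex, 'r) module" and B :: "(complex, 'b) module"
  assumes R: "calgebra R" and J: "ideal J R" and B: "calgebra B" and h: "h \<in> calg_hom R B"
    and zero: "\<And>x. x \<in> J \<Longrightarrow> h x = \<zero>\<^bsub>B\<^esub>"
  shows "\<exists>k\<in>calg_hom (R QuotC J) B. \<forall>x\<in>carrier R. k (J +>\<^bsub>R\<^esub> x) = h x"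
proof -
  interpret R: calgebra R by fact
  interpret B: calgebra B by fact
  interpret J: ideal J R by fact
  interpret q: quotient R J
    by (intro quotient.intro quotient_axioms.intro R.cspace_axioms ideal_subspace R J)
  note h' = calg_homD[OF h]
  note c = calg_homD[OF coset_calg_hom[OF R J]]
  define k where "k X = the_elem (h ` X)" for X
  have k: "lin_map (R QuotC J) B k" "\<And>x. x \<in> carrier R \<Longrightarrow> k (J +>\<^bsub>R\<^esub> x) = h x"
    unfolding k_def by (rule q.lin_lift[OF B.cspace_axioms h'(1)], erule zero, assumption?)+
  have "k \<in> calg_hom (R QuotC J) B"
  proof (rule calg_homI[OF k(1)])
    show "k \<one>\<^bsub>R QuotC J\<^esub> = \<one>\<^bsub>B\<^esub>"
      unfolding c(2)[symmetric] k(2)[OF R.one_closed] by (rule h'(2))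
    fix X Y assume "X \<in> carrier (R QuotC J)" "Y \<in> carrier (R QuotC J)"
    then obtain x y where x: "x \<in> carrier R" "X = J +>\<^bsub>R\<^esub> x" and y: "y \<in> carrier R" "Y = J +>\<^bsub>R\<^esub> y"
      unfolding q.quot_carrier by blast
    show "k (X \<otimes>\<^bsub>R QuotC J\<^esub> Y) = k X \<otimes>\<^bsub>B\<^esub> k Y"
      unfolding x(2) y(2) c(3)[OF x(1) y(1), symmetric] k(2)[OF R.m_closed[OF x(1) y(1)]]
        k(2)[OF x(1)] k(2)[OF y(1)] by (rule h'(3)[OF x(1) y(1)])
  qed
  with k(2) show ?thesis
    by blast
qed

definition hom_bimodule ::
    "(complex, 'b) module \<Rightarrow> ('a \<Rightarrow> 'b) \<Rightarrow> ('a, 'b) bimodule" where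
  "hom_bimodule B rho = with_actions B (\<lambda>a f. rho a \<otimes>\<^bsub>B\<^esub> f) (\<lambda>f a. f \<otimes>\<^bsub>B\<^esub> rho a)"

lemma cbimod_hom_bimodule:
  fixes A :: "(complex, 'a) module" and B :: "(complex, 'b) module"
  assumes A: "calgebra A" and B: "calgebra B" and rho: "rho \<in> calg_hom A B"
  shows "cbimod A (hom_bimodule B rho)"
proof -
  interpret B: calgebra B by fact
  note r = calg_homD[OF rho]
  have rc: "rho a \<in> carrier B" if "a \<in> carrier A" for a
    by (rule lin_mapD(1)[OF r(1) that])
  have l: "bilinear A B B (\<lambda>a f. rho a \<otimes>\<^bsub>B\<^esub> f)"
    by (intro bilinearI B.lin_mult rc lin_map_comp[OF r(1) B.lin_mult(2)])
  have r': "bilinear B A B (\<lambda>f a. f \<otimes>\<^bsub>B\<^esub> rho a)"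
    by (intro bilinearI B.lin_mult rc lin_map_comp[OF r(1) B.lin_mult(1)])
  show ?thesis
    by (rule cbimodI[OF A]; unfold hom_bimodule_def with_actions_simps bilinear_with_actions)
      (simp_all add: l r' cspace_with_actions B.cspace_axioms r rc B.m_assoc)
qed

locale preprojective = calg A for A :: "(complex, 'a) module" (structure) +
  fixes lam assumes lam: "lam \<in> carrier A"
begin

sublocale TD: tensor_algebra A D
  using cbimod_double_der by (simp add: tensor_algebra_def)

abbreviation "T \<equiv> tensor_alg A D"
abbreviation "J \<equiv> preproj_ideal A lam"
abbreviation "telem \<equiv> tensor_alg_elem A D"

sublocale T: calgebra T
  by (rule TD.calgebra_TA)

lemma telem_closed [simp]:
  "a \<in> carrier A \<Longrightarrow> telem a [] \<in> carrier T" "d \<in> carrier D \<Longrightarrow> telem \<one> [d] \<in> carrier T"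
  by (simp_all add: TD.elem_closed)

lemma ideal_J: "ideal J T"
  unfolding preproj_ideal_def by (rule T.genideal_ideal) (simp add: Delta_closed lam)

lemma relation_mem_J: "telem \<one> [Delta A] \<ominus>\<^bsub>T\<^esub> telem lam [] \<in> J"
  unfolding preproj_ideal_def by (rule T.genideal_self') (simp add: Delta_closed lam)

lemma J_least: "ideal I T \<Longrightarrow> telem \<one> [Delta A] \<ominus>\<^bsub>T\<^esub> telem lam [] \<in> I \<Longrightarrow> J \<subseteq> I"
  unfolding preproj_ideal_def by (rule T.genideal_minimal) auto

sublocale J: quotient T J
  by (intro quotient.intro quotient_axioms.intro T.cspace_axioms ideal_subspace ideal_J T.calgebra_axioms)

abbreviation "cls x \<equiv> J +>\<^bsub>T\<^esub> x"

lemma preproj_carrier: "carrier (preproj_alg A lam) = cls ` carrier T"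
  unfolding preproj_alg_def by (rule J.quot_carrier)

text \<open>Extensions of a homomorphism from \<open>A\<close> to an arbitrary algebra \<open>B\<close>; representations are the case
of an endomorphism algebra.\<close>

definition extends :: "(complex, 'b) module \<Rightarrow> ('a \<Rightarrow> 'b) \<Rightarrow> ('a dder_tensors set \<Rightarrow> 'b) \<Rightarrow> bool" where
  "extends B rho sigma \<longleftrightarrow> sigma \<in> calg_hom (preproj_alg A lam) B \<and>
     (\<forall>a\<in>carrier A. sigma (preproj_map A lam a) = rho a)"

lemma extension_composite:
  assumes "extends B rho sigma"
  shows "(\<lambda>x. sigma (cls x)) \<in> calg_hom T B"
    and "a \<in> carrier A \<Longrightarrow> sigma (cls (telem a [])) = rho a"
proof -
  have s: "sigma \<in> calg_hom (T QuotC J) B"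
    using assms by (simp add: extends_def preproj_alg_def)
  note c = calg_homD[OF coset_calg_hom[OF T.calgebra_axioms ideal_J]] and s' = calg_homD[OF s]
  show "(\<lambda>x. sigma (cls x)) \<in> calg_hom T B"
  proof (rule calg_homI[OF lin_map_comp[OF c(1) s'(1)]])
    show "sigma (cls \<one>\<^bsub>T\<^esub>) = \<one>\<^bsub>B\<^esub>"
      by (simp only: c(2) s'(2))
    fix x y assume "x \<in> carrier T" "y \<in> carrier T"
    then show "sigma (cls (x \<otimes>\<^bsub>T\<^esub> y)) = sigma (cls x) \<otimes>\<^bsub>B\<^esub> sigma (cls y)"
      using s'(3)[OF lin_mapD(1)[OF c(1)] lin_mapD(1)[OF c(1)]] by (simp only: c(3))
  qed
  show "a \<in> carrier A \<Longrightarrow> sigma (cls (telem a [])) = rho a"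
    using assms by (simp add: extends_def preproj_map_def)
qed

text \<open>That the restriction to degree one is a bimodule map holds already in the tensor algebra; the relation
\<open>\<Delta> = lam\<close> fixes its value at \<open>\<Delta>\<close>.\<close>

lemma extension_bimod_hom:
  assumes s: "extends B rho sigma"
  shows "bimod_hom A D (hom_bimodule B rho) (\<lambda>d. sigma (cls (telem \<one> [d])))"
    and "sigma (cls (telem \<one> [Delta A])) = rho lam"
proof -
  note h = calg_homD[OF extension_composite(1)[OF s]]
  show "bimod_hom A D (hom_bimodule B rho) (\<lambda>d. sigma (cls (telem \<one> [d])))"
  proof (rule bimod_homI)
    show "lin_map D (hom_bimodule B rho) (\<lambda>d. sigma (cls (telem \<one> [d])))"
      unfolding hom_bimodule_def lin_map_with_actions by (rule lin_map_comp[OF TD.elem_1_lin h(1)])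
    fix a d assume "a \<in> carrier A" "d \<in> carrier D"
    then show "sigma (cls (telem \<one> [lact D a d])) = lact (hom_bimodule B rho) a (sigma (cls (telem \<one> [d])))"
      "sigma (cls (telem \<one> [ract D d a])) = ract (hom_bimodule B rho) (sigma (cls (telem \<one> [d]))) a"
      by (simp_all add: hom_bimodule_def TD.elem_1_lact TD.elem_1_ract h(3) extension_composite(2)[OF s])
  qed
  have "cls (telem \<one> [Delta A]) = cls (telem lam [])"
    using J.coset_eq_iff[of "telem \<one> [Delta A]" "telem lam []"] relation_mem_J
    by (simp add: Delta_closed lam)
  then show "sigma (cls (telem \<one> [Delta A])) = rho lam"
    using extension_composite(2)[OF s lam] by simp
qed

text \<open>The kernel of the homomorphism on the tensor algebra determined by \<open>\<theta>\<close> is an ideal containing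
\<open>\<Delta> - lam\<close>, so the homomorphism descends.\<close>

lemma bimod_hom_extension:
  assumes B: "calgebra B" and rho: "rho \<in> calg_hom A B"
    and th: "bimod_hom A D (hom_bimodule B rho) \<theta>" and Delta: "\<theta> (Delta A) = rho lam"
  shows "\<exists>sigma. extends B rho sigma \<and> (\<forall>d\<in>carrier D. sigma (cls (telem \<one> [d])) = \<theta> d)"
proof -
  interpret B: calgebra B by fact
  note th' = bimod_homD[OF th, unfolded hom_bimodule_def lin_map_with_actions with_actions_simps]
  obtain h where h: "h \<in> calg_hom T B" and h0: "\<And>a. a \<in> carrier A \<Longrightarrow> h (telem a []) = rho a"
    and h1: "\<And>d. d \<in> carrier D \<Longrightarrow> h (telem \<one> [d]) = \<theta> d"
    using TD.tensor_algebra_universal[OF B rho th'] by blast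
  note h' = calg_homD[OF h]
  interpret h: lin T B h
    by (rule linI[OF T.cspace_axioms B.cspace_axioms h'(1)])
  let ?K = "{x \<in> carrier T. h x = \<zero>\<^bsub>B\<^esub>}"
  have "ideal ?K T"
    using h.kernel_subspace by (intro idealI T.ring_axioms) (auto simp: submodule_def h'(3))
  moreover have "telem \<one> [Delta A] \<ominus>\<^bsub>T\<^esub> telem lam [] \<in> ?K"
    using B.minus_self[of "rho lam"] lin_mapD(1)[OF calg_homD(1)[OF rho] lam]
    by (simp add: h.diff h0 h1 Delta_closed lam Delta)
  ultimately have "J \<subseteq> ?K"
    by (rule J_least)
  then have "h x = \<zero>\<^bsub>B\<^esub>" if "x \<in> J" for x
    using that by blast
  from quot_calg_hom[OF T.calgebra_axioms ideal_J B h this]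
  obtain k where k: "k \<in> calg_hom (T QuotC J) B" "\<And>x. x \<in> carrier T \<Longrightarrow> k (cls x) = h x"
    by blast
  then have "extends B rho k" "\<forall>d\<in>carrier D. k (cls (telem \<one> [d])) = \<theta> d"
    by (simp_all add: extends_def preproj_alg_def preproj_map_def h0 h1)
  then show ?thesis
    by blast
qed

lemma extension_eqI:
  assumes B: "calgebra B" and s: "extends B rho sigma" and t: "extends B rho tau"
    and eq: "\<And>d. d \<in> carrier D \<Longrightarrow> sigma (cls (telem \<one> [d])) = tau (cls (telem \<one> [d]))"
    and x: "x \<in> carrier (preproj_alg A lam)"
  shows "sigma x = tau x"
proof -
  interpret B: calgebra B by fact
  obtain y where y: "y \<in> carrier T" "x = cls y"
    using x unfolding preproj_carrier by blast
  show ?thesis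
    unfolding y(2)
    by (rule TD.hom_eqI[OF B.cspace_axioms extension_composite(1)[OF s] extension_composite(1)[OF t]
          _ eq y(1)])
      (simp only: extension_composite(2)[OF s] extension_composite(2)[OF t])
qed

end

context cbimod
begin

text \<open>Degree zero chains are the coefficients themselves, and \<open>comm_map\<close> is the differential.\<close>

lemma class0_zero_iff:
  assumes m: "m \<in> carrier M"
  shows "hoch_class0 A M m = \<zero>\<^bsub>hoch_homology A M 0\<^esub> \<longleftrightarrow> m \<in> comm_map ` carrier C1"
proof -
  interpret C0: cspace "mtensor M A 0" by (rule MA.cspace_mtensor)
  have B: "hoch_boundaries A M 0 = (\<lambda>X. tens M A (comm_map X) []) ` carrier C1"
    by (simp add: hoch_boundaries_def hoch_diff_1 image_def)
  interpret l: lin C1 "mtensor M A 0" "\<lambda>X. tens M A (comm_map X) []"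
    by (rule linI[OF C1.cspace_axioms C0.cspace_axioms lin_map_comp[OF comm_map(1) tens_0_lin]])
  have sub: "submodule (hoch_boundaries A M 0) complex_field (mtensor M A 0)"
    unfolding B by (rule l.image_subspace[OF module.carrier_is_submodule[OF C1.is_module]])
  interpret q: quotient "mtensor M A 0" "hoch_boundaries A M 0"
    by (intro quotient.intro quotient_axioms.intro C0.cspace_axioms sub)
  have "hoch_class0 A M m = \<zero>\<^bsub>hoch_homology A M 0\<^esub> \<longleftrightarrow> tens M A m [] \<in> hoch_boundaries A M 0"
    using q.coset_eq_N_iff[OF lin_mapD(1)[OF tens_0_lin m]]
    by (simp add: hoch_class0_def hoch_homology_def cquot_def)
  also have "\<dots> \<longleftrightarrow> m \<in> comm_map ` carrier C1"
    unfolding B using tens_0_inj[OF m lin_mapD(1)[OF comm_map(1)]] by blast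
  finally show ?thesis .
qed

lemma comm_map_image:
  "comm_map ` carrier C1 = lin_span M {lact M a f \<ominus>\<^bsub>M\<^esub> ract M f a | a f. a \<in> carrier A \<and> f \<in> carrier M}"
  (is "_ = lin_span M ?S")
proof
  interpret c: lin C1 M comm_map
    by (rule linI[OF C1.cspace_axioms M.cspace_axioms comm_map(1)])
  have eq: "lact M a f \<ominus>\<^bsub>M\<^esub> ract M f a = (- 1) \<odot>\<^bsub>M\<^esub> comm_map (tens M A f [a])"
    if "a \<in> carrier A" "f \<in> carrier M" for a f
    using that by (simp add: comm_map M.scale_minus_one lact_simps ract_simps a_minus_def M.minus_add M.a_comm)
  have S: "?S \<subseteq> carrier M"
    by (auto simp: lact_simps ract_simps)
  note span = M.lin_span_subspace[OF S]
  have "carrier C1 \<subseteq> {X \<in> carrier C1. comm_map X \<in> lin_span M ?S}"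
  proof
    fix X assume X: "X \<in> carrier C1"
    show "X \<in> {X \<in> carrier C1. comm_map X \<in> lin_span M ?S}"
    proof (rule MA.mtensor_induct[OF c.vimage_subspace[OF span] _ X])
      fix f as assume "(f, as) \<in> words M A 1"
      then obtain a where a: "as = [a]" "a \<in> carrier A" and f: "f \<in> carrier M"
        by (auto simp: MA.words_1)
      have t: "tens M A f [a] \<in> carrier C1"
        using a f by simp
      have "lact M a f \<ominus>\<^bsub>M\<^esub> ract M f a \<in> lin_span M ?S"
        using M.lin_span_superset[of ?S] a f by blast
      then have "(- 1) \<odot>\<^bsub>M\<^esub> ((- 1) \<odot>\<^bsub>M\<^esub> comm_map (tens M A f [a])) \<in> lin_span M ?S"
        unfolding eq[OF a(2) f] by (rule M.subspaceD(4)[OF span])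
      then show "tens M A f as \<in> {X \<in> carrier C1. comm_map X \<in> lin_span M ?S}"
        using t by (simp add: M.scale_scale a(1))
    qed
  qed
  then show "comm_map ` carrier C1 \<subseteq> lin_span M ?S"
    by blast
  have img: "submodule (comm_map ` carrier C1) complex_field M"
    by (rule c.image_subspace[OF module.carrier_is_submodule[OF C1.is_module]])
  show "lin_span M ?S \<subseteq> comm_map ` carrier C1"
  proof (rule M.lin_span_least[OF img], clarify)
    fix a f assume a: "a \<in> carrier A" and f: "f \<in> carrier M"
    show "lact M a f \<ominus>\<^bsub>M\<^esub> ract M f a \<in> comm_map ` carrier C1"
      unfolding eq[OF a f] by (rule M.subspaceD(4)[OF img], rule imageI) (simp add: a f)
  qed
qed

lemma cycles_1: "hoch_cycles A M 1 = {X \<in> carrier C1. comm_map X = \<zero>\<^bsub>M\<^esub>}"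
proof -
  have "tens M A m [] = \<zero>\<^bsub>mtensor M A 0\<^esub> \<longleftrightarrow> m = \<zero>\<^bsub>M\<^esub>" if "m \<in> carrier M" for m
  proof -
    have "tens M A \<zero>\<^bsub>M\<^esub> [] = \<zero>\<^bsub>mtensor M A 0\<^esub>"
      by (rule lin.zero[OF linI[OF M.cspace_axioms MA.cspace_mtensor tens_0_lin]])
    then show ?thesis
      using tens_0_inj[OF that M.zero_closed] by metis
  qed
  note zero_iff = this
  have "hoch_diff A M 1 X = \<zero>\<^bsub>mtensor M A 0\<^esub> \<longleftrightarrow> comm_map X = \<zero>\<^bsub>M\<^esub>" if "X \<in> carrier C1" for X
    unfolding hoch_diff_1[OF that] by (rule zero_iff[OF lin_mapD(1)[OF comm_map(1) that]])
  then show ?thesis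
    unfolding hoch_cycles_def diff_self_eq_0 by blast
qed

lemma homology_1_trivial_iff:
  "carrier (hoch_homology A M 1) = {\<zero>\<^bsub>hoch_homology A M 1\<^esub>} \<longleftrightarrow>
    (\<forall>X\<in>carrier C1. comm_map X = \<zero>\<^bsub>M\<^esub> \<longrightarrow> X \<in> hoch_boundaries A M 1)"
proof -
  let ?B = "hoch_boundaries A M 1"
  interpret q: quotient C1 ?B
    by (intro quotient.intro quotient_axioms.intro C1.cspace_axioms boundaries_subspace)
  have *: "carrier (hoch_homology A M 1) = (\<lambda>X. ?B +>\<^bsub>C1\<^esub> X) ` hoch_cycles A M 1"
    "\<zero>\<^bsub>hoch_homology A M 1\<^esub> = ?B"
    by (auto simp: hoch_homology_def cquot_def A_RCOSETS_def' a_r_coset_def')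
  have "\<zero>\<^bsub>C1\<^esub> \<in> hoch_cycles A M 1"
    using lin.zero[OF linI[OF C1.cspace_axioms M.cspace_axioms comm_map(1)]] by (simp add: cycles_1)
  then have "carrier (hoch_homology A M 1) = {\<zero>\<^bsub>hoch_homology A M 1\<^esub>} \<longleftrightarrow>
      (\<forall>X\<in>hoch_cycles A M 1. ?B +>\<^bsub>C1\<^esub> X = ?B)"
    unfolding * by auto
  also have "\<dots> \<longleftrightarrow> (\<forall>X\<in>hoch_cycles A M 1. X \<in> ?B)"
    by (intro ball_cong refl q.coset_eq_N_iff) (simp add: cycles_1)
  finally show ?thesis
    by (auto simp: cycles_1)
qed

end

section \<open>Endomorphism algebras\<close>

lemma End_alg_simps:
  "carrier (End_alg V) = {f \<in> carrier V \<rightarrow>\<^sub>E carrier V. lin_map V V f}"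
  "f \<otimes>\<^bsub>End_alg V\<^esub> g = (\<lambda>x\<in>carrier V. f (g x))" "\<one>\<^bsub>End_alg V\<^esub> = (\<lambda>x\<in>carrier V. x)"
  "\<zero>\<^bsub>End_alg V\<^esub> = (\<lambda>x\<in>carrier V. \<zero>\<^bsub>V\<^esub>)"
  "f \<oplus>\<^bsub>End_alg V\<^esub> g = (\<lambda>x\<in>carrier V. f x \<oplus>\<^bsub>V\<^esub> g x)"
  "c \<odot>\<^bsub>End_alg V\<^esub> f = (\<lambda>x\<in>carrier V. c \<odot>\<^bsub>V\<^esub> f x)"
  by (auto simp: End_alg_def lin_map_def)

lemma calgebra_End_alg:
  fixes V :: "(complex, 'v) module"
  assumes "cspace V"
  shows "calgebra (End_alg V)"
proof -
  interpret V: cspace V by fact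
  let ?E = "End_alg V"
  have mem: "f \<in> carrier ?E \<longleftrightarrow> f \<in> extensional (carrier V) \<and> lin_map V V f" for f
    by (auto simp: End_alg_simps lin_map_def PiE_iff)
  have eqI: "f = g" if "f \<in> carrier ?E" "g \<in> carrier ?E" "\<And>x. x \<in> carrier V \<Longrightarrow> f x = g x" for f g
    by (rule extensionalityI[of _ "carrier V"]) (use that in \<open>auto simp: mem\<close>)
  have c: "f x \<in> carrier V" and add: "y \<in> carrier V \<Longrightarrow> f (x \<oplus>\<^bsub>V\<^esub> y) = f x \<oplus>\<^bsub>V\<^esub> f y"
    and scale: "f (k \<odot>\<^bsub>V\<^esub> x) = k \<odot>\<^bsub>V\<^esub> f x" if "f \<in> carrier ?E" "x \<in> carrier V" for f x y k
    using that by (simp_all add: mem lin_map_def)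
  have ap: "(f \<otimes>\<^bsub>?E\<^esub> g) x = f (g x)" "(f \<oplus>\<^bsub>?E\<^esub> g) x = f x \<oplus>\<^bsub>V\<^esub> g x" "(k \<odot>\<^bsub>?E\<^esub> f) x = k \<odot>\<^bsub>V\<^esub> f x"
    "\<one>\<^bsub>?E\<^esub> x = x" "\<zero>\<^bsub>?E\<^esub> x = \<zero>\<^bsub>V\<^esub>" if "x \<in> carrier V" for f g x k
    using that by (simp_all add: End_alg_simps)
  have cl: "\<one>\<^bsub>?E\<^esub> \<in> carrier ?E" "\<zero>\<^bsub>?E\<^esub> \<in> carrier ?E"
    by (simp_all add: mem lin_map_def End_alg_simps)
  have cl_s: "k \<odot>\<^bsub>?E\<^esub> f \<in> carrier ?E" if "f \<in> carrier ?E" for k f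
    using c[OF that] add[OF that] scale[OF that]
    by (simp add: mem lin_map_def End_alg_simps V.scale_add_right V.scale_scale mult.commute)
  have cl_a: "f \<oplus>\<^bsub>?E\<^esub> g \<in> carrier ?E" "f \<otimes>\<^bsub>?E\<^esub> g \<in> carrier ?E"
    if "f \<in> carrier ?E" "g \<in> carrier ?E" for f g
    using c[OF that(1)] add[OF that(1)] scale[OF that(1)] c[OF that(2)] add[OF that(2)] scale[OF that(2)]
    by (simp_all add: mem lin_map_def End_alg_simps V.scale_add_right V.a_ac)
  note cl' = cl cl_s cl_a
  have cs: "cspace ?E"
    by (rule cspaceI; (rule eqI)?)
      (simp_all add: cl' ap c V.a_ac V.scale_add_left V.scale_add_right V.scale_scale)
  show ?thesis
    by (rule calgebraI[OF cs]; (intro bilinearI lin_mapI)?; (rule eqI)?)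
      (simp_all add: cl' ap c add scale)
qed


section \<open>Extending representations\<close>

theorem theorem2p2:
  fixes A :: "(complex, 'a) module" and V :: "(complex, 'v) module"
    and lam :: 'a and rho :: "'a \<Rightarrow> 'v \<Rightarrow> 'v"
  assumes "smooth_calg A" and "lam \<in> carrier A"
    and "module complex_field V" and "rho \<in> calg_hom A (End_alg V)"
  shows "((\<exists>sigma. is_preproj_extension A lam V rho sigma) \<longleftrightarrow>
            hoch_class0 A (End_bimodule V rho) (rho lam) =
              \<zero>\<^bsub>hoch_homology A (End_bimodule V rho) 0\<^esub>) \<and>
         (hoch_class0 A (End_bimodule V rho) (rho lam) =
              \<zero>\<^bsub>hoch_homology A (End_bimodule V rho) 0\<^esub> \<longleftrightarrow>
            rho lam \<in> commutator_space A V rho) \<and>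
         ((\<exists>sigma. is_preproj_extension A lam V rho sigma) \<longrightarrow>
            ((\<forall>sigma tau. is_preproj_extension A lam V rho sigma \<and>
                is_preproj_extension A lam V rho tau \<longrightarrow>
                (\<forall>x \<in> carrier (preproj_alg A lam). sigma x = tau x)) \<longleftrightarrow>
             carrier (hoch_homology A (End_bimodule V rho) 1) =
               {\<zero>\<^bsub>hoch_homology A (End_bimodule V rho) 1\<^esub>}))"
proof -
  let ?E = "End_alg V"
  let ?M = "End_bimodule V rho"
  have A: "calgebra A"
    using assms(1) by (simp add: smooth_calg_def)
  have E: "calgebra ?E"
    by (rule calgebra_End_alg) (rule cspace.intro[OF assms(3)])
  note rho = assms(4)
  have M_eq: "?M = hom_bimodule ?E rho"
    by (simp add: End_bimodule_def hom_bimodule_def)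
  interpret P: preprojective A lam
    using A assms(2) by (simp add: preprojective_def preprojective_axioms_def calg_def)
  interpret M: cbimod A ?M
    unfolding M_eq by (rule cbimod_hom_bimodule[OF A E rho])
  interpret E: calgebra ?E by (rule E)
  obtain S \<delta> where S: "finite S" "S \<subseteq> carrier A" "\<And>s. s \<in> S \<Longrightarrow> \<delta> s \<in> carrier P.D"
    "\<And>a. a \<in> carrier A \<Longrightarrow> Delta A a = (\<Oplus>\<^bsub>P.A2\<^esub>s\<in>S. P.bdry s (\<delta> s a))"
    using P.dual_basis[OF assms(1)] by blast
  have ext: "is_preproj_extension A lam V rho sigma \<longleftrightarrow> P.extends ?E rho sigma" for sigma
    by (simp add: is_preproj_extension_def P.extends_def)
  let ?th = "\<lambda>sigma d. sigma (P.cls (P.telem \<one>\<^bsub>A\<^esub> [d]))"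
  have to_chain: "\<exists>X\<in>carrier M.C1. M.comm_map X = rho lam \<and> (\<forall>d\<in>carrier P.D. ?th sigma d = M.pair d X)"
    if s: "P.extends ?E rho sigma" for sigma
  proof -
    from P.extension_bimod_hom(1)[OF s] have "bimod_hom A P.D ?M (?th sigma)"
      by (simp only: M_eq)
    from M.bimod_hom_is_pairing[OF S this]
    obtain X where X: "X \<in> carrier M.C1" "\<forall>d\<in>carrier P.D. ?th sigma d = M.pair d X"
      by blast
    moreover have "M.comm_map X = rho lam"
      using M.pair_Delta[OF X(1)] X(2) P.Delta_closed P.extension_bimod_hom(2)[OF s] by metis
    ultimately show ?thesis
      by blast
  qed
  have from_chain: "\<exists>sigma. P.extends ?E rho sigma \<and> (\<forall>d\<in>carrier P.D. ?th sigma d = M.pair d X)"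
    if X: "X \<in> carrier M.C1" "M.comm_map X = rho lam" for X
  proof (rule P.bimod_hom_extension[OF E rho])
    show "bimod_hom A P.D (hom_bimodule ?E rho) (\<lambda>d. M.pair d X)"
      using M.bimod_hom_pair[OF X(1)] by (simp only: M_eq)
    show "M.pair (Delta A) X = rho lam"
      using M.pair_Delta[OF X(1)] X(2) by simp
  qed
  have rlam: "rho lam \<in> carrier ?M"
    using lin_mapD(1)[OF calg_homD(1)[OF rho] assms(2)] by (simp add: End_bimodule_def)
  have class0: "hoch_class0 A ?M (rho lam) = \<zero>\<^bsub>hoch_homology A ?M 0\<^esub> \<longleftrightarrow> rho lam \<in> M.comm_map ` carrier M.C1"
    by (rule M.class0_zero_iff[OF rlam])
  have "(\<exists>sigma. P.extends ?E rho sigma) \<longleftrightarrow> rho lam \<in> M.comm_map ` carrier M.C1"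
    using to_chain from_chain by (metis (no_types, lifting) image_iff)
  then have 1: "(\<exists>sigma. is_preproj_extension A lam V rho sigma) \<longleftrightarrow>
      hoch_class0 A ?M (rho lam) = \<zero>\<^bsub>hoch_homology A ?M 0\<^esub>"
    unfolding ext class0 .
  have "lin_span ?M S = lin_span ?E S" for S
    by (rule lin_span_cong) (simp_all add: End_bimodule_def)
  then have "M.comm_map ` carrier M.C1 = commutator_space A V rho"
    unfolding M.comm_map_image commutator_space_def by (simp add: End_bimodule_def)
  with class0 have 2: "hoch_class0 A ?M (rho lam) = \<zero>\<^bsub>hoch_homology A ?M 0\<^esub> \<longleftrightarrow>
      rho lam \<in> commutator_space A V rho"
    by simp
  have 3: "(\<forall>sigma tau. P.extends ?E rho sigma \<and> P.extends ?E rho tau \<longrightarrow>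
        (\<forall>x \<in> carrier (preproj_alg A lam). sigma x = tau x)) \<longleftrightarrow>
      carrier (hoch_homology A ?M 1) = {\<zero>\<^bsub>hoch_homology A ?M 1\<^esub>}" (is "?unique \<longleftrightarrow> ?trivial")
    if ex: "P.extends ?E rho sigma0" for sigma0
  proof
    assume unique: ?unique
    obtain X0 where X0: "X0 \<in> carrier M.C1" "M.comm_map X0 = rho lam"
      using to_chain[OF ex] by blast
    interpret c: lin M.C1 ?M M.comm_map
      by (rule linI[OF M.C1.cspace_axioms M.M.cspace_axioms M.comm_map(1)])
    show ?trivial
      unfolding M.homology_1_trivial_iff
    proof (intro ballI impI)
      fix X assume X: "X \<in> carrier M.C1" "M.comm_map X = \<zero>\<^bsub>?M\<^esub>"
      have "M.comm_map (X0 \<oplus>\<^bsub>M.C1\<^esub> X) = rho lam"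
        using X X0 rlam by (simp add: c.add)
      \<comment> \<open>Adding a cycle to \<open>X0\<close> gives another extension; by uniqueness the cycle pairs to zero.\<close>
      from from_chain[OF _ this] X X0 obtain sigma where
        sigma: "P.extends ?E rho sigma" "\<forall>d\<in>carrier P.D. ?th sigma d = M.pair d (X0 \<oplus>\<^bsub>M.C1\<^esub> X)"
        by auto
      from from_chain[OF X0] obtain tau where
        tau: "P.extends ?E rho tau" "\<forall>d\<in>carrier P.D. ?th tau d = M.pair d X0"
        by auto
      show "X \<in> hoch_boundaries A ?M 1"
      proof (rule M.pairing_kernel[OF S X(1)])
        fix d assume d: "d \<in> carrier P.D"
        interpret p: lin M.C1 ?M "M.pair d"
          by (rule linI[OF M.C1.cspace_axioms M.M.cspace_axioms M.pair(1)[OF d]])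
        have "P.cls (P.telem \<one>\<^bsub>A\<^esub> [d]) \<in> carrier (preproj_alg A lam)"
          unfolding P.preproj_carrier using P.telem_closed(2)[OF d] by (rule imageI)
        then have "?th sigma d = ?th tau d"
          using unique sigma(1) tau(1) by blast
        then have "M.pair d X0 \<oplus>\<^bsub>?M\<^esub> M.pair d X = M.pair d X0"
          using sigma(2) tau(2) d X0 X by (simp add: p.add)
        then show "M.pair d X = \<zero>\<^bsub>?M\<^esub>"
          using M.M.add.l_cancel_one[of "M.pair d X0" "M.pair d X"] X X0 by simp
      qed
    qed
  next
    assume trivial: ?trivial
    interpret c: lin M.C1 ?M M.comm_map
      by (rule linI[OF M.C1.cspace_axioms M.M.cspace_axioms M.comm_map(1)])
    show ?unique
    proof (intro allI impI, elim conjE)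
      fix sigma tau assume s: "P.extends ?E rho sigma" and t: "P.extends ?E rho tau"
      obtain X where X: "X \<in> carrier M.C1" "M.comm_map X = rho lam"
        "\<forall>d\<in>carrier P.D. ?th sigma d = M.pair d X"
        using to_chain[OF s] by blast
      obtain Y where Y: "Y \<in> carrier M.C1" "M.comm_map Y = rho lam"
        "\<forall>d\<in>carrier P.D. ?th tau d = M.pair d Y"
        using to_chain[OF t] by blast
      have "M.comm_map (X \<ominus>\<^bsub>M.C1\<^esub> Y) = \<zero>\<^bsub>?M\<^esub>"
        using X Y rlam by (simp add: c.diff)
      then have B: "X \<ominus>\<^bsub>M.C1\<^esub> Y \<in> hoch_boundaries A ?M 1"
        using trivial X(1) Y(1) unfolding M.homology_1_trivial_iff by simp
      have "?th sigma d = ?th tau d" if d: "d \<in> carrier P.D" for d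
      proof -
        interpret p: lin M.C1 ?M "M.pair d"
          by (rule linI[OF M.C1.cspace_axioms M.M.cspace_axioms M.pair(1)[OF d]])
        have "M.pair d X \<ominus>\<^bsub>?M\<^esub> M.pair d Y = \<zero>\<^bsub>?M\<^esub>"
          using M.pair_boundary[OF d B] X(1) Y(1) by (simp add: p.diff)
        then show ?thesis
          using X(1,3) Y(1,3) d by (simp add: M.M.minus_eq_zero_iff)
      qed
      from P.extension_eqI[OF E s t this]
      show "\<forall>x\<in>carrier (preproj_alg A lam). sigma x = tau x"
        by blast
    qed
  qed
  from 1 2 3 show ?thesis
    unfolding ext by blast
qed

end
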